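(* Let $(E,\mathcal{B},m)$ be a $\sigma$-finite measure space. Let $D_0$ be a dense linear subspace of $L^2(m)$ and let $L_0\colon D_0\to L^2(m)$ be a symmetric linear operator which is upper bounded, i.e. $\sup_{u\in D_0\setminus\{0\}}(L_0u,u)_2\,\|u\|_2^{-2}<\infty$. Suppose that $L_0(D_0)\subset L^1(m)$ and that for every $T\in(0,\infty)$ the linear span of $$\{\, f'\otimes\varphi+f\otimes L_0\varphi \;:\; \varphi\in D_0,\ f\in C^1([0,T];\mathbb{R}),\ f(T)=0 \,\}$$ is a dense subset of $L^{1}([0,T]\times E,\,dt\otimes m)$. Then the set $\mathcal{M}_{sym,M}(L_0,D_0)$ consists of at most one element. If, moreover, the semigroup generated by the Friedrichs extension of $(L_0,D_0)$ is sub-Markovian, then this extension is the unique element of $\mathcal{M}_{sym,M}(L_0,D_0)$.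
   Context: All $L^p$-spaces are real; $(\cdot,\cdot)_2$ and $\|\cdot\|_2$ are the inner product and norm of $L^2(m)$. For $f\colon[0,T]\to\mathbb{R}$ and $\varphi\colon E\to\mathbb{R}$ put $(f\otimes\varphi)(t,x)=f(t)\varphi(x)$; thus $f'\otimes\varphi+f\otimes L_0\varphi=(\frac{\partial}{\partial s}+L_0)(f\otimes\varphi)$. A linear operator $L\colon D(L)\subset L^2(m)\to L^2(m)$ is called a generator on $L^2(m)$ if it is the generator of a strongly continuous semigroup $(e^{tL})_{t\ge0}$ of everywhere defined continuous linear operators on $L^2(m)$. $L_1\subset L_2$ means that the graph of $L_1$ is contained in the graph of $L_2$; $L$ is symmetric if $L\subset L^*$. The semigroup $(e^{tL})_{t\ge0}$ is sub-Markovian if for every $t\ge0$ and every $u\in L^2(m)$ with $0\le u\le1$ one has $0\le e^{tL}u\le1$ ($m$-a.e.). $\mathcal{M}_{sym,M}(L_0,D_0)$ is the set of all linear operators $L\colon D(L)\subset L^2(m)\to L^2(m)$ such that $L_0\subset L$, $L$ is a generator on $L^2(m)$, $L$ is symmetric, and $(e^{tL})_{t\ge0}$ is sub-Markovian. The Friedrichs extension of $(L_0,D_0)$ is the upper bounded self-adjoint extension associated with the closure of the upper bounded quadratic form $(u,v)\mapsto(L_0u,v)_2$ on $D_0$. *)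

theory Defs
  imports "HOL-Analysis.Analysis"
begin

text \<open>
  The library has no type of \<open>L\<^sup>p(M)\<close>-classes, so elements of \<open>L\<^sup>2(M)\<close> and \<open>L\<^sup>1(M)\<close> are handled
  through representatives, and an operator on \<open>L\<^sup>2(M)\<close> is given by its graph.  Graphs are required
  to be saturated under almost-everywhere equality in both components; hence equality and inclusion
  of such sets of pairs are exactly equality and inclusion of operators on \<open>L\<^sup>2(M)\<close>.
\<close>

definition L1_space :: "'a measure \<Rightarrow> ('a \<Rightarrow> real) set" where
  "L1_space M = {u. integrable M u}"

definition L1_norm :: "'a measure \<Rightarrow> ('a \<Rightarrow> real) \<Rightarrow> real" where
  "L1_norm M u = (LINT x|M. \<bar>u x\<bar>)"

definition L2_space :: "'a measure \<Rightarrow> ('a \<Rightarrow> real) set" where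
  "L2_space M = {u. u \<in> borel_measurable M \<and> integrable M (\<lambda>x. (u x)\<^sup>2)}"

definition L2_inner :: "'a measure \<Rightarrow> ('a \<Rightarrow> real) \<Rightarrow> ('a \<Rightarrow> real) \<Rightarrow> real" where
  "L2_inner M u v = (LINT x|M. u x * v x)"

definition L2_norm :: "'a measure \<Rightarrow> ('a \<Rightarrow> real) \<Rightarrow> real" where
  "L2_norm M u = sqrt (L2_inner M u u)"

definition dense_subset_L1 :: "'a measure \<Rightarrow> ('a \<Rightarrow> real) set \<Rightarrow> bool" where
  "dense_subset_L1 M S \<longleftrightarrow> S \<subseteq> L1_space M \<and>
     (\<forall>u\<in>L1_space M. \<forall>\<epsilon>>0. \<exists>v\<in>S. L1_norm M (\<lambda>x. u x - v x) < \<epsilon>)"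

definition dense_subset_L2 :: "'a measure \<Rightarrow> ('a \<Rightarrow> real) set \<Rightarrow> bool" where
  "dense_subset_L2 M S \<longleftrightarrow> S \<subseteq> L2_space M \<and>
     (\<forall>u\<in>L2_space M. \<forall>\<epsilon>>0. \<exists>v\<in>S. L2_norm M (\<lambda>x. u x - v x) < \<epsilon>)"

definition fun_span :: "('b \<Rightarrow> real) set \<Rightarrow> ('b \<Rightarrow> real) set" where
  "fun_span S = {(\<lambda>z. \<Sum>i<n. c i * g i z) | (n::nat) (c :: nat \<Rightarrow> real) g. \<forall>i<n. g i \<in> S}"


subsection \<open>Operators\<close>

type_synonym 'a operator = "(('a \<Rightarrow> real) \<times> ('a \<Rightarrow> real)) set"

definition linear_operator :: "'a measure \<Rightarrow> 'a operator \<Rightarrow> bool" where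
  "linear_operator M L \<longleftrightarrow>
     L \<subseteq> L2_space M \<times> L2_space M \<and>
     ((\<lambda>x. 0), (\<lambda>x. 0)) \<in> L \<and>
     (\<forall>(u, v)\<in>L. \<forall>(u', v')\<in>L. \<forall>a b. ((\<lambda>x. a * u x + b * u' x), (\<lambda>x. a * v x + b * v' x)) \<in> L) \<and>
     (\<forall>(u, v)\<in>L. \<forall>(u', v')\<in>L. (AE x in M. u x = u' x) \<longrightarrow> (AE x in M. v x = v' x)) \<and>
     (\<forall>(u, v)\<in>L. \<forall>u'\<in>L2_space M. \<forall>v'\<in>L2_space M.
        (AE x in M. u x = u' x) \<longrightarrow> (AE x in M. v x = v' x) \<longrightarrow> (u', v') \<in> L)"

definition adjoint_operator :: "'a measure \<Rightarrow> 'a operator \<Rightarrow> 'a operator" where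
  "adjoint_operator M L =
     {(v, w) \<in> L2_space M \<times> L2_space M. \<forall>(u, z)\<in>L. L2_inner M z v = L2_inner M u w}"

definition symmetric_operator :: "'a measure \<Rightarrow> 'a operator \<Rightarrow> bool" where
  "symmetric_operator M L \<longleftrightarrow> L \<subseteq> adjoint_operator M L"

definition upper_bounded :: "'a measure \<Rightarrow> 'a operator \<Rightarrow> bool" where
  "upper_bounded M L \<longleftrightarrow>
     bdd_above {L2_inner M v u / (L2_norm M u)\<^sup>2 | u v. (u, v) \<in> L \<and> \<not> (AE x in M. u x = 0)}"


subsection \<open>Semigroups and generators\<close>

text \<open>The values of \<open>T t u\<close> are irrelevant for negative \<open>t\<close> and for \<open>u\<close> outside \<open>L\<^sup>2(M)\<close>.\<close>

definition bounded_linear_map :: "'a measure \<Rightarrow> (('a \<Rightarrow> real) \<Rightarrow> 'a \<Rightarrow> real) \<Rightarrow> bool" where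
  "bounded_linear_map M S \<longleftrightarrow>
     (\<forall>u\<in>L2_space M. S u \<in> L2_space M) \<and>
     (\<forall>u\<in>L2_space M. \<forall>v\<in>L2_space M. (AE x in M. u x = v x) \<longrightarrow> (AE x in M. S u x = S v x)) \<and>
     (\<forall>u\<in>L2_space M. \<forall>v\<in>L2_space M. \<forall>a b.
        AE x in M. S (\<lambda>y. a * u y + b * v y) x = a * S u x + b * S v x) \<and>
     (\<exists>C. \<forall>u\<in>L2_space M. L2_norm M (S u) \<le> C * L2_norm M u)"

definition C0_semigroup :: "'a measure \<Rightarrow> (real \<Rightarrow> ('a \<Rightarrow> real) \<Rightarrow> 'a \<Rightarrow> real) \<Rightarrow> bool" where
  "C0_semigroup M T \<longleftrightarrow>
     (\<forall>t\<ge>0. bounded_linear_map M (T t)) \<and>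
     (\<forall>u\<in>L2_space M. AE x in M. T 0 u x = u x) \<and>
     (\<forall>s\<ge>0. \<forall>t\<ge>0. \<forall>u\<in>L2_space M. AE x in M. T (s + t) u x = T s (T t u) x) \<and>
     (\<forall>u\<in>L2_space M. ((\<lambda>t. L2_norm M (\<lambda>x. T t u x - u x)) \<longlongrightarrow> 0) (at_right 0))"

definition generator_of ::
    "'a measure \<Rightarrow> (real \<Rightarrow> ('a \<Rightarrow> real) \<Rightarrow> 'a \<Rightarrow> real) \<Rightarrow> 'a operator" where
  "generator_of M T =
     {(u, v) \<in> L2_space M \<times> L2_space M.
        ((\<lambda>t. L2_norm M (\<lambda>x. (T t u x - u x) / t - v x)) \<longlongrightarrow> 0) (at_right 0)}"

definition is_generator :: "'a measure \<Rightarrow> 'a operator \<Rightarrow> bool" where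
  "is_generator M L \<longleftrightarrow> (\<exists>T. C0_semigroup M T \<and> generator_of M T = L)"

text \<open>
  The semigroup \<open>(e\<^bsup>tL\<^esup>)\<^sub>t\<close>.  A generator determines it only up to the choice of representatives,
  hence \<open>SOME\<close> instead of \<open>THE\<close>.  If \<open>L\<close> is not a generator, the value is unspecified.
\<close>

definition semigroup_of ::
    "'a measure \<Rightarrow> 'a operator \<Rightarrow> real \<Rightarrow> ('a \<Rightarrow> real) \<Rightarrow> 'a \<Rightarrow> real" where
  "semigroup_of M L = (SOME T. C0_semigroup M T \<and> generator_of M T = L)"

definition sub_Markovian :: "'a measure \<Rightarrow> (real \<Rightarrow> ('a \<Rightarrow> real) \<Rightarrow> 'a \<Rightarrow> real) \<Rightarrow> bool" where
  "sub_Markovian M T \<longleftrightarrow>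
     (\<forall>t\<ge>0. \<forall>u\<in>L2_space M. (AE x in M. 0 \<le> u x \<and> u x \<le> 1) \<longrightarrow>
        (AE x in M. 0 \<le> T t u x \<and> T t u x \<le> 1))"

definition M_sym_Markov :: "'a measure \<Rightarrow> 'a operator \<Rightarrow> 'a operator set" where
  "M_sym_Markov M L\<^sub>0 =
     {L. linear_operator M L \<and> L\<^sub>0 \<subseteq> L \<and> is_generator M L \<and> symmetric_operator M L \<and>
         sub_Markovian M (semigroup_of M L)}"


subsection \<open>Friedrichs extension\<close>

text \<open>
  The value of \<open>L\<close> at \<open>u\<close> is unique up to almost-everywhere equality, so the form below does not
  depend on the choice made by \<open>SOME\<close>.
\<close>

definition operator_form :: "'a measure \<Rightarrow> 'a operator \<Rightarrow> ('a \<Rightarrow> real) \<Rightarrow> ('a \<Rightarrow> real) \<Rightarrow> real" where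
  "operator_form M L u v = L2_inner M (SOME w. (u, w) \<in> L) v"

text \<open>
  \<open>us\<close> lies in the form domain \<open>D\<close>, converges to \<open>u\<close> in \<open>L\<^sup>2(M)\<close> and is Cauchy for the form \<open>q\<close>.
  Because of the \<open>L\<^sup>2\<close>-convergence, for a form with \<open>q u u \<le> c \<parallel>u\<parallel>\<^sup>2\<close> this is the same as being
  Cauchy for the norm induced by the positive form \<open>(c + 1) (u, v) - q u v\<close>.
\<close>

definition form_approx ::
    "'a measure \<Rightarrow> ('a \<Rightarrow> real) set \<Rightarrow> (('a \<Rightarrow> real) \<Rightarrow> ('a \<Rightarrow> real) \<Rightarrow> real)
       \<Rightarrow> (nat \<Rightarrow> 'a \<Rightarrow> real) \<Rightarrow> ('a \<Rightarrow> real) \<Rightarrow> bool" where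
  "form_approx M D q us u \<longleftrightarrow>
     (\<forall>n. us n \<in> D) \<and>
     (\<lambda>n. L2_norm M (\<lambda>x. us n x - u x)) \<longlonglongrightarrow> 0 \<and>
     (\<forall>\<epsilon>>0. \<exists>N. \<forall>m\<ge>N. \<forall>n\<ge>N.
        \<bar>q (\<lambda>x. us m x - us n x) (\<lambda>x. us m x - us n x)\<bar> < \<epsilon>)"

definition closure_domain ::
    "'a measure \<Rightarrow> ('a \<Rightarrow> real) set \<Rightarrow> (('a \<Rightarrow> real) \<Rightarrow> ('a \<Rightarrow> real) \<Rightarrow> real)
       \<Rightarrow> ('a \<Rightarrow> real) set" where
  "closure_domain M D q = {u \<in> L2_space M. \<exists>us. form_approx M D q us u}"

definition closure_form ::
    "'a measure \<Rightarrow> ('a \<Rightarrow> real) set \<Rightarrow> (('a \<Rightarrow> real) \<Rightarrow> ('a \<Rightarrow> real) \<Rightarrow> real)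
       \<Rightarrow> ('a \<Rightarrow> real) \<Rightarrow> ('a \<Rightarrow> real) \<Rightarrow> real" where
  "closure_form M D q u v =
     (THE r. \<forall>us vs. form_approx M D q us u \<longrightarrow> form_approx M D q vs v \<longrightarrow>
        (\<lambda>n. q (us n) (vs n)) \<longlonglongrightarrow> r)"

definition form_operator ::
    "'a measure \<Rightarrow> ('a \<Rightarrow> real) set \<Rightarrow> (('a \<Rightarrow> real) \<Rightarrow> ('a \<Rightarrow> real) \<Rightarrow> real)
       \<Rightarrow> 'a operator" where
  "form_operator M D q =
     {(u, w). u \<in> D \<and> w \<in> L2_space M \<and> (\<forall>v\<in>D. q u v = L2_inner M w v)}"

definition Friedrichs_extension :: "'a measure \<Rightarrow> 'a operator \<Rightarrow> 'a operator" where
  "Friedrichs_extension M L\<^sub>0 =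
     form_operator M (closure_domain M (Domain L\<^sub>0) (operator_form M L\<^sub>0))
       (closure_form M (Domain L\<^sub>0) (operator_form M L\<^sub>0))"


subsection \<open>The parabolic test set\<close>

text \<open>\<open>f'\<close> is the derivative of \<open>f\<close> on \<open>[0, b]\<close>, one-sided at the end points.\<close>

definition C1_with_deriv :: "real \<Rightarrow> (real \<Rightarrow> real) \<Rightarrow> (real \<Rightarrow> real) \<Rightarrow> bool" where
  "C1_with_deriv b f f' \<longleftrightarrow>
     (\<forall>t\<in>{0..b}. (f has_real_derivative f' t) (at t within {0..b})) \<and> continuous_on {0..b} f'"

definition tensor :: "(real \<Rightarrow> real) \<Rightarrow> ('a \<Rightarrow> real) \<Rightarrow> real \<times> 'a \<Rightarrow> real" (infixr \<open>\<otimes>\<^sub>t\<close> 75) where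
  "f \<otimes>\<^sub>t \<phi> = (\<lambda>(t, x). f t * \<phi> x)"

definition parabolic_range :: "real \<Rightarrow> 'a operator \<Rightarrow> (real \<times> 'a \<Rightarrow> real) set" where
  "parabolic_range b L\<^sub>0 =
     {(\<lambda>z. (f' \<otimes>\<^sub>t \<phi>) z + (f \<otimes>\<^sub>t \<psi>) z) | f f' \<phi> \<psi>.
        (\<phi>, \<psi>) \<in> L\<^sub>0 \<and> C1_with_deriv b f f' \<and> f b = 0}"

end

theory Submission
  imports Defs "HOL-Library.Function_Algebras"
begin

text \<open>
  Uniqueness: for a symmetric sub-Markovian semigroup \<open>T\<close> generated by an extension of \<open>L\<^sub>0\<close>, and
  \<open>0 \<le> u \<le> 1\<close>, the function \<open>(t, x) \<mapsto> T t u x\<close> is bounded and solves the Cauchy problem weakly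
  against the test functions \<open>f \<otimes> \<phi>\<close>.  The difference of two such solutions is an element of
  \<open>L\<^sup>\<infinity>\<close>, the dual of \<open>L\<^sup>1\<close>, which annihilates the dense parabolic range, so it vanishes.

  Existence: the Friedrichs extension \<open>F\<close> satisfies \<open>(F u, u) \<le> c (u, u)\<close>, and \<open>l - F\<close> is onto for
  \<open>l > c\<close> by a variational argument on the form domain.  Hence \<open>F - c\<close> generates a contraction
  semigroup, obtained as the limit of the implicit Euler scheme
  \<open>(1 - 2\<^sup>-\<^sup>n (F - c))\<^sup>-\<^sup>k\<close>, \<open>k = \<lfloor>2\<^sup>n t\<rfloor>\<close>.
\<close>

section \<open>Semi-inner product spaces\<close>

text \<open>Sub-Markovianity keeps the two solutions bounded, so that they act on
  \<open>L^1\<close>. Symmetry lets the semigroup act on the test function instead, so that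
  \<open>(T t u, \<phi>)\<close> is differentiable for every \<open>u\<close> and not only for
  \<open>u\<close> in the domain of the generator; later it also reduces a general \<open>v\<close>
  to functions with values in \<open>[0, 1]\<close>. A strongly continuous semigroup comes with no
  bound that is uniform in \<open>t\<close> near 0, and differentiating its orbits from the left
  requires one; this is why a uniform boundedness principle appears.

  For existence, dyadic step lengths make consecutive Euler schemes comparable: two short steps of
  length \<open>k\<close> replace a long one at the price of \<open>k^2\<close> times the norm of
  \<open>A^2 u\<close>. On the domain of \<open>A^2\<close> the increments are thus dominated by a
  geometric series, and contractivity extends the limit to the whole space. The scheme shows
  directly only that the operator is contained in the generator of the limit semigroup; equality
  follows because the resolvent equation is already solvable in the smaller operator.\<close>

text \<open>In the instance \<open>L\<^sup>2(M)\<close> the elements of \<open>X\<close> are functions rather than classes, so an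
  equation between \<open>u\<close> and \<open>v\<close> takes the form \<open>nrm (u - v) = 0\<close>.\<close>

locale semi_inner =
  fixes X :: "'v::real_vector set" and ip :: "'v \<Rightarrow> 'v \<Rightarrow> real"
  assumes subspace_X: "subspace X"
    and ip_sym: "u \<in> X \<Longrightarrow> v \<in> X \<Longrightarrow> ip u v = ip v u"
    and ip_add_left: "u \<in> X \<Longrightarrow> v \<in> X \<Longrightarrow> w \<in> X \<Longrightarrow> ip (u + v) w = ip u w + ip v w"
    and ip_scale_left: "u \<in> X \<Longrightarrow> v \<in> X \<Longrightarrow> ip (c *\<^sub>R u) v = c * ip u v"
    and ip_nonneg: "u \<in> X \<Longrightarrow> 0 \<le> ip u u"
begin

definition nrm :: "'v \<Rightarrow> real" where "nrm u = sqrt (ip u u)"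

lemma X_closed [simp]:
  "0 \<in> X"
  "u \<in> X \<Longrightarrow> v \<in> X \<Longrightarrow> u + v \<in> X"
  "u \<in> X \<Longrightarrow> v \<in> X \<Longrightarrow> u - v \<in> X"
  "u \<in> X \<Longrightarrow> - u \<in> X"
  "u \<in> X \<Longrightarrow> c *\<^sub>R u \<in> X"
  using subspace_X by (auto simp: subspace_0 subspace_add subspace_diff subspace_neg subspace_scale)

lemma ip_add_right: "u \<in> X \<Longrightarrow> v \<in> X \<Longrightarrow> w \<in> X \<Longrightarrow> ip w (u + v) = ip w u + ip w v"
  by (metis X_closed(2) ip_add_left ip_sym)

lemma ip_scale_right: "u \<in> X \<Longrightarrow> v \<in> X \<Longrightarrow> ip v (c *\<^sub>R u) = c * ip v u"
  by (metis X_closed(5) ip_scale_left ip_sym)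

lemma ip_minus_left: "u \<in> X \<Longrightarrow> v \<in> X \<Longrightarrow> ip (- u) v = - ip u v"
  using ip_scale_left[of u v "-1"] by simp

lemma ip_minus_right: "u \<in> X \<Longrightarrow> v \<in> X \<Longrightarrow> ip v (- u) = - ip v u"
  using ip_scale_right[of u v "-1"] by simp

lemma ip_diff_left: "u \<in> X \<Longrightarrow> v \<in> X \<Longrightarrow> w \<in> X \<Longrightarrow> ip (u - v) w = ip u w - ip v w"
  using ip_add_left[of u "- v" w] by (simp add: ip_minus_left)

lemma ip_diff_right: "u \<in> X \<Longrightarrow> v \<in> X \<Longrightarrow> w \<in> X \<Longrightarrow> ip w (u - v) = ip w u - ip w v"
  using ip_add_right[of u "- v" w] by (simp add: ip_minus_right)

lemmas ip_linear = ip_add_left ip_add_right ip_scale_left ip_scale_right ip_minus_left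
  ip_minus_right ip_diff_left ip_diff_right

lemma nrm_nonneg [simp]: "u \<in> X \<Longrightarrow> 0 \<le> nrm u"
  by (simp add: nrm_def ip_nonneg)

lemma nrm_sq: "u \<in> X \<Longrightarrow> (nrm u)\<^sup>2 = ip u u"
  by (simp add: nrm_def ip_nonneg)

lemma nrm_zero [simp]: "nrm 0 = 0"
  using ip_scale_left[of 0 0 0] by (simp add: nrm_def)

lemma nrm_scale: "u \<in> X \<Longrightarrow> nrm (c *\<^sub>R u) = \<bar>c\<bar> * nrm u"
  by (simp add: nrm_def ip_linear real_sqrt_mult flip: mult.assoc)

lemma nrm_minus [simp]: "u \<in> X \<Longrightarrow> nrm (- u) = nrm u"
  by (simp add: nrm_def ip_linear)

lemma nrm_commute: "u \<in> X \<Longrightarrow> v \<in> X \<Longrightarrow> nrm (u - v) = nrm (v - u)"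
  using nrm_minus[of "u - v"] by simp

lemma Cauchy_Schwarz:
  assumes "u \<in> X" "v \<in> X" shows "\<bar>ip u v\<bar> \<le> nrm u * nrm v"
proof -
  have pos: "0 \<le> ip u u + 2 * s * ip u v + s\<^sup>2 * ip v v" for s
    using ip_nonneg[of "u + s *\<^sub>R v"] assms
    by (simp add: ip_linear ip_sym[of v u] power2_eq_square algebra_simps)
  have "(ip u v)\<^sup>2 \<le> ip u u * ip v v"
  proof (cases "ip v v = 0")
    case True
    have "ip u v = 0"
    proof (rule ccontr)
      assume "ip u v \<noteq> 0"
      \<comment> \<open>This value of \<open>s\<close> turns the quadratic in \<open>pos\<close>
        into \<open>-1\<close>.\<close>
      then show False
        using pos[of "- (ip u u + 1) / (2 * ip u v)"] True by (simp add: field_simps)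
    qed
    then show ?thesis by (simp add: True)
  next
    case False
    then have "0 < ip v v" using ip_nonneg[OF assms(2)] by linarith
    then show ?thesis
      using pos[of "- ip u v / ip v v"] by (simp add: field_simps power2_eq_square)
  qed
  then have "sqrt ((ip u v)\<^sup>2) \<le> sqrt (ip u u * ip v v)" by (rule real_sqrt_le_mono)
  then show ?thesis by (simp add: nrm_def real_sqrt_mult)
qed

lemma nrm_triangle: assumes "u \<in> X" "v \<in> X" shows "nrm (u + v) \<le> nrm u + nrm v"
proof (rule power2_le_imp_le)
  show "(nrm (u + v))\<^sup>2 \<le> (nrm u + nrm v)\<^sup>2"
    using Cauchy_Schwarz[OF assms] assms
    by (simp add: nrm_sq ip_linear ip_sym[of v u] power2_sum)
qed (use assms in auto)

lemma nrm_triangle_sub: "u \<in> X \<Longrightarrow> v \<in> X \<Longrightarrow> nrm u \<le> nrm v + nrm (u - v)"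
  using nrm_triangle[of v "u - v"] by simp

lemma nrm_triangle_diff: "u \<in> X \<Longrightarrow> v \<in> X \<Longrightarrow> nrm (u - v) \<le> nrm u + nrm v"
  using nrm_triangle[of u "- v"] by simp

lemma nrm_diff_triangle:
  "u \<in> X \<Longrightarrow> v \<in> X \<Longrightarrow> w \<in> X \<Longrightarrow> nrm (u - w) \<le> nrm (u - v) + nrm (v - w)"
  using nrm_triangle[of "u - v" "v - w"] by simp

lemma abs_nrm_diff: "u \<in> X \<Longrightarrow> v \<in> X \<Longrightarrow> \<bar>nrm u - nrm v\<bar> \<le> nrm (u - v)"
  using nrm_triangle_sub[of u v] nrm_triangle_sub[of v u] nrm_commute[of u v] by linarith

lemma nrm_lincomb:
  "u \<in> X \<Longrightarrow> v \<in> X \<Longrightarrow> nrm (a *\<^sub>R u + b *\<^sub>R v) \<le> \<bar>a\<bar> * nrm u + \<bar>b\<bar> * nrm v"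
  using nrm_triangle[of "a *\<^sub>R u" "b *\<^sub>R v"] by (simp add: nrm_scale)

lemma nrm_eq_of_null_diff: "u \<in> X \<Longrightarrow> v \<in> X \<Longrightarrow> nrm (u - v) = 0 \<Longrightarrow> nrm u = nrm v"
  using abs_nrm_diff[of u v] by simp

lemma ip_null_left: "u \<in> X \<Longrightarrow> v \<in> X \<Longrightarrow> w \<in> X \<Longrightarrow> nrm (u - v) = 0 \<Longrightarrow> ip u w = ip v w"
  using Cauchy_Schwarz[of "u - v" w] by (simp add: ip_linear)

lemma tendsto_ip:
  assumes "((\<lambda>s. nrm (a s - x)) \<longlongrightarrow> 0) F" "((\<lambda>s. nrm (b s - y)) \<longlongrightarrow> 0) F"
    and "eventually (\<lambda>s. a s \<in> X \<and> b s \<in> X) F" "x \<in> X" "y \<in> X"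
  shows "((\<lambda>s. ip (a s) (b s)) \<longlongrightarrow> ip x y) F"
proof -
  have lim: "((\<lambda>s. nrm (a s - x) * nrm (b s - y) + nrm (a s - x) * nrm y + nrm x * nrm (b s - y))
      \<longlongrightarrow> 0) F"
    by (intro tendsto_eq_intros assms(1,2)) (auto intro!: assms tendsto_eq_intros)
  have "eventually (\<lambda>s. norm (ip (a s) (b s) - ip x y) \<le>
      nrm (a s - x) * nrm (b s - y) + nrm (a s - x) * nrm y + nrm x * nrm (b s - y)) F"
    using assms(3)
  proof eventually_elim
    case (elim s)
    have "ip (a s) (b s) - ip x y = ip (a s - x) (b s - y) + ip (a s - x) y + ip x (b s - y)"
      using elim assms by (simp add: ip_linear)
    then show ?case
      using Cauchy_Schwarz[of "a s - x" "b s - y"] Cauchy_Schwarz[of "a s - x" y]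
        Cauchy_Schwarz[of x "b s - y"] elim assms by simp
  qed
  from this lim have "((\<lambda>s. ip (a s) (b s) - ip x y) \<longlongrightarrow> 0) F"
    by (rule Lim_null_comparison)
  then show ?thesis by (simp add: LIM_zero_iff)
qed

lemma tendsto_nrm:
  assumes "((\<lambda>s. nrm (a s - x)) \<longlongrightarrow> 0) F" "eventually (\<lambda>s. a s \<in> X) F" "x \<in> X"
  shows "((\<lambda>s. nrm (a s)) \<longlongrightarrow> nrm x) F"
proof -
  have "((\<lambda>s. nrm (a s) - nrm x) \<longlongrightarrow> 0) F"
    by (rule tendsto_0_le[where K=1, OF assms(1)])
      (use assms(2,3) in \<open>auto elim!: eventually_mono simp: abs_nrm_diff\<close>)
  then show ?thesis by (simp add: LIM_zero_iff)
qed

lemma null_by_orthogonality: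
  assumes dense: "\<And>e. 0 < e \<Longrightarrow> \<exists>v\<in>D. nrm (u - v) < e"
    and D: "D \<subseteq> X" and u: "u \<in> X" and orth: "\<And>v. v \<in> D \<Longrightarrow> ip u v = 0"
  shows "nrm u = 0"
proof (rule ccontr)
  assume "nrm u \<noteq> 0"
  then have pos: "0 < nrm u" using u by (simp add: less_le)
  then obtain v where v: "v \<in> D" "nrm (u - v) < nrm u" using dense by blast
  then have vX: "v \<in> X" using D by auto
  have "(nrm u)\<^sup>2 = ip u (u - v)" using u vX orth[OF v(1)] by (simp add: nrm_sq ip_linear)
  also have "\<dots> \<le> nrm u * nrm (u - v)" using Cauchy_Schwarz[of u "u - v"] u vX by simp
  also have "\<dots> < nrm u * nrm u" using pos v by (intro mult_strict_left_mono)
  finally show False by (simp add: power2_eq_square)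
qed

lemma nrm_lim_le:
  assumes "(\<lambda>n. nrm (a n - x)) \<longlonglongrightarrow> 0" "\<And>n. a n \<in> X" "x \<in> X"
    and "\<And>n. nrm (a n) \<le> c n" "c \<longlonglongrightarrow> r"
  shows "nrm x \<le> r"
  by (rule LIMSEQ_le[OF tendsto_nrm[OF assms(1)] assms(5)]) (use assms in auto)

lemma tendsto_nrm_diff:
  assumes "(\<lambda>n. nrm (a n - x)) \<longlonglongrightarrow> 0" "(\<lambda>n. nrm (b n - y)) \<longlonglongrightarrow> 0"
    and "\<And>n. a n \<in> X" "x \<in> X" "\<And>n. b n \<in> X" "y \<in> X"
  shows "(\<lambda>n. nrm ((a n - b n) - (x - y))) \<longlonglongrightarrow> 0"
proof (rule tendsto_sandwich[of "\<lambda>_. 0" _ _ "\<lambda>n. nrm (a n - x) + nrm (b n - y)"])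
  have "nrm ((a n - b n) - (x - y)) \<le> nrm (a n - x) + nrm (b n - y)" for n
    using nrm_triangle_diff[of "a n - x" "b n - y"] assms by (simp add: algebra_simps)
  then show "\<forall>\<^sub>F n in sequentially. nrm ((a n - b n) - (x - y)) \<le> nrm (a n - x) + nrm (b n - y)"
    by simp
  show "(\<lambda>n. nrm (a n - x) + nrm (b n - y)) \<longlonglongrightarrow> 0"
    using tendsto_add[OF assms(1,2)] by simp
qed (use assms in auto)

end

locale semi_hilbert = semi_inner +
  assumes complete: "(\<And>n::nat. f n \<in> X) \<Longrightarrow>
    (\<And>e. 0 < e \<Longrightarrow> \<exists>N. \<forall>m\<ge>N. \<forall>n\<ge>N. nrm (f m - f n) < e) \<Longrightarrow>
    \<exists>l\<in>X. (\<lambda>n. nrm (f n - l)) \<longlonglongrightarrow> 0"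
begin

lemma complete_summable:
  assumes f: "\<And>n. f n \<in> X" and le: "\<And>n. nrm (f (Suc n) - f n) \<le> r n" and "summable r"
  shows "\<exists>l\<in>X. (\<lambda>n. nrm (f n - l)) \<longlonglongrightarrow> 0"
proof (rule complete[OF f])
  fix e :: real assume "0 < e"
  have tele: "nrm (f (m + k) - f m) \<le> sum r {m..<m+k}" for m k
  proof (induction k)
    case (Suc k)
    have "nrm (f (m + Suc k) - f m) \<le> nrm (f (Suc (m + k)) - f (m + k)) + nrm (f (m + k) - f m)"
      using nrm_diff_triangle[of "f (m + Suc k)" "f (m + k)" "f m"] f by simp
    then show ?case using Suc le[of "m + k"] by simp
  qed simp
  obtain N where N: "\<And>m n. m \<ge> N \<Longrightarrow> norm (sum r {m..<n}) < e"
    using \<open>summable r\<close>[unfolded summable_Cauchy] \<open>0 < e\<close> by blast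
  have *: "nrm (f n - f m) < e" if "N \<le> m" "m \<le> n" for m n
    using tele[of m "n - m"] N[of m n] that by simp
  have "nrm (f m - f n) < e" if "N \<le> m" "N \<le> n" for m n
    using *[of m n] *[of n m] that nrm_commute[OF f f, of m n] by (cases "m \<le> n") auto
  then show "\<exists>N. \<forall>m\<ge>N. \<forall>n\<ge>N. nrm (f m - f n) < e" by blast
qed

end

section \<open>Contraction semigroups generated by dissipative operators\<close>

lemma small_multiple:
  fixes y e :: real assumes "0 \<le> y" "0 < e" shows "\<exists>d>0. d * y \<le> e"
  using assms by (intro exI[of _ "e / (y + 1)"]) (simp add: field_simps add_nonneg_pos)

text \<open>The pair in \<open>A_surj\<close> encodes \<open>u - h * A u = w\<close>, so this
  assumption is the range condition of Lumer and Phillips, imposed for every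
  \<open>h > 0\<close>.\<close>

locale m_dissipative = semi_hilbert +
  fixes A :: "('a \<times> 'a) set"
  assumes A_subset: "A \<subseteq> X \<times> X"
    and A_linear: "(u, v) \<in> A \<Longrightarrow> (u', v') \<in> A \<Longrightarrow>
      (a *\<^sub>R u + b *\<^sub>R u', a *\<^sub>R v + b *\<^sub>R v') \<in> A"
    and A_dissipative: "(u, v) \<in> A \<Longrightarrow> ip v u \<le> 0"
    and A_surj: "0 < h \<Longrightarrow> w \<in> X \<Longrightarrow> \<exists>u. (u, (1 / h) *\<^sub>R (u - w)) \<in> A"
    and A_dense: "u \<in> X \<Longrightarrow> 0 < e \<Longrightarrow> \<exists>(u', v) \<in> A. nrm (u - u') < e"
begin

lemma A_X: "(u, v) \<in> A \<Longrightarrow> u \<in> X" "(u, v) \<in> A \<Longrightarrow> v \<in> X"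
  using A_subset by auto

lemma A_diff: "(u, v) \<in> A \<Longrightarrow> (u', v') \<in> A \<Longrightarrow> (u - u', v - v') \<in> A"
  using A_linear[of u v u' v' 1 "-1"] by simp

lemma A_add: "(u, v) \<in> A \<Longrightarrow> (u', v') \<in> A \<Longrightarrow> (u + u', v + v') \<in> A"
  using A_linear[of u v u' v' 1 1] by simp

lemma A_scale: "(u, v) \<in> A \<Longrightarrow> (a *\<^sub>R u, a *\<^sub>R v) \<in> A"
  using A_linear[of u v u v a 0] by simp

text \<open>Expanding the square, the mixed term is \<open>- 2 * h * ip v u\<close>, which
  dissipativity makes nonnegative. This is the source of the norm estimates for resolvents.\<close>

lemma accretive:
  assumes "(u, v) \<in> A" "0 \<le> h" shows "nrm u \<le> nrm (u - h *\<^sub>R v)"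
proof (rule power2_le_imp_le)
  have X: "u \<in> X" "v \<in> X" using A_X assms by auto
  have "ip (u - h *\<^sub>R v) (u - h *\<^sub>R v) = ip u u - 2 * (h * ip v u) + h\<^sup>2 * ip v v"
    using X by (simp add: ip_linear ip_sym[of u v] power2_eq_square algebra_simps)
  moreover have "h * ip v u \<le> 0" "0 \<le> h\<^sup>2 * ip v v"
    using assms A_dissipative ip_nonneg[OF X(2)] by (auto simp: mult_nonneg_nonpos)
  ultimately show "(nrm u)\<^sup>2 \<le> (nrm (u - h *\<^sub>R v))\<^sup>2"
    using X by (simp add: nrm_sq)
qed (use A_X assms in auto)

section \<open>Resolvents \<open>J h = (1 - h A)^(-1)\<close>, fixed up to null vectors, and their
  powers\<close>

definition J :: "real \<Rightarrow> 'a \<Rightarrow> 'a" where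
  "J h w = (SOME u. (u, (1 / h) *\<^sub>R (u - w)) \<in> A)"

lemma J_in_A: "0 < h \<Longrightarrow> w \<in> X \<Longrightarrow> (J h w, (1 / h) *\<^sub>R (J h w - w)) \<in> A"
  unfolding J_def by (rule someI_ex) (rule A_surj)

lemma J_X [simp]: "0 < h \<Longrightarrow> w \<in> X \<Longrightarrow> J h w \<in> X"
  using A_X J_in_A by blast

text \<open>A pair \<open>(u, v)\<close> of \<open>A\<close> solves the resolvent equation exactly
  for the datum \<open>u - h v\<close>, so the distance from \<open>J h w\<close> to
  \<open>u\<close> is controlled by the residual of \<open>u\<close> in the equation for
  \<open>w\<close>. Suitable choices of the pair give contractivity, linearity and expansions in
  \<open>h\<close>.\<close>

lemma J_dist:
  assumes "0 < h" "w \<in> X" "(u, v) \<in> A"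
  shows "nrm (J h w - u) \<le> nrm (w - (u - h *\<^sub>R v))"
proof -
  have "(J h w - u, (1 / h) *\<^sub>R (J h w - w) - v) \<in> A"
    using A_diff J_in_A assms by blast
  from accretive[OF this, of h] show ?thesis
    using \<open>0 < h\<close> by (simp add: algebra_simps)
qed

lemma J_contraction:
  assumes "0 < h" "w \<in> X" "w' \<in> X" shows "nrm (J h w - J h w') \<le> nrm (w - w')"
  using J_dist[OF assms(1,2) J_in_A[OF assms(1,3)]] assms(1) by simp

lemma Jn_X [simp]: "0 < h \<Longrightarrow> w \<in> X \<Longrightarrow> (J h ^^ n) w \<in> X"
  by (induction n) auto

lemma Jn_contraction:
  "0 < h \<Longrightarrow> w \<in> X \<Longrightarrow> w' \<in> X \<Longrightarrow> nrm ((J h ^^ n) w - (J h ^^ n) w') \<le> nrm (w - w')"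
  by (induction n) (auto intro: order_trans[OF J_contraction])

lemma J_zero: assumes "0 < h" shows "nrm (J h 0) = 0"
proof -
  obtain u v where "(u, v) \<in> A" using A_dense[of 0 1] by auto
  from A_scale[OF this, of 0] have "(0, 0) \<in> A" by simp
  from J_dist[OF assms X_closed(1) this] show ?thesis
    using assms by (intro antisym) simp_all
qed

lemma Jn_zero: "0 < h \<Longrightarrow> nrm ((J h ^^ n) 0) = 0"
proof (induction n)
  case (Suc n)
  have "nrm ((J h ^^ Suc n) 0) \<le> nrm (J h 0) + nrm (J h ((J h ^^ n) 0) - J h 0)"
    using nrm_triangle_sub[of "(J h ^^ Suc n) 0" "J h 0"] Suc.prems by simp
  also have "\<dots> \<le> 0"
    using J_contraction[of h "(J h ^^ n) 0" 0] Suc by (simp add: J_zero)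
  finally show ?case using Suc.prems by (intro antisym nrm_nonneg) simp_all
qed simp

lemma Jn_nrm_le: assumes "0 < h" "w \<in> X" shows "nrm ((J h ^^ n) w) \<le> nrm w"
  using Jn_contraction[OF assms X_closed(1), of n] Jn_zero[OF assms(1), of n]
    nrm_triangle_sub[of "(J h ^^ n) w" "(J h ^^ n) 0"] assms by simp

text \<open>\<open>SOME\<close> picks one of several null-equivalent resolvents, so linearity can
  only be asserted in the seminorm; \<open>J_dist\<close> carries a null defect from one power to
  the next.\<close>

lemma Jn_linear:
  assumes h: "0 < h" and X: "u \<in> X" "w \<in> X"
  shows "nrm ((J h ^^ n) (a *\<^sub>R u + b *\<^sub>R w) - (a *\<^sub>R (J h ^^ n) u + b *\<^sub>R (J h ^^ n) w)) = 0"
proof (induction n)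
  case (Suc n)
  let ?p = "(J h ^^ n) (a *\<^sub>R u + b *\<^sub>R w)" and ?x = "(J h ^^ n) u" and ?y = "(J h ^^ n) w"
  have X': "?p \<in> X" "?x \<in> X" "?y \<in> X" using assms by auto
  have "(a *\<^sub>R J h ?x + b *\<^sub>R J h ?y, a *\<^sub>R ((1/h) *\<^sub>R (J h ?x - ?x)) + b *\<^sub>R ((1/h) *\<^sub>R (J h ?y - ?y))) \<in> A"
    using A_linear J_in_A h X' by blast
  from J_dist[OF h X'(1) this]
  have "nrm (J h ?p - (a *\<^sub>R J h ?x + b *\<^sub>R J h ?y)) \<le> nrm (?p - (a *\<^sub>R ?x + b *\<^sub>R ?y))"
    using h by (simp add: algebra_simps)
  moreover have "0 \<le> nrm (J h ?p - (a *\<^sub>R J h ?x + b *\<^sub>R J h ?y))" using X' h by simp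
  ultimately show ?case using Suc by simp
qed simp

lemma J_near:
  assumes "0 < h" "(u, v) \<in> A" shows "nrm (J h u - u) \<le> h * nrm v"
  using J_dist[OF assms(1) A_X(1)[OF assms(2)] assms(2)] assms A_X(2)[OF assms(2)]
  by (simp add: nrm_scale)

lemma Jn_near:
  assumes "0 < h" "(u, v) \<in> A" shows "nrm ((J h ^^ n) u - u) \<le> n * h * nrm v"
proof (induction n)
  case (Suc n)
  have X: "u \<in> X" using A_X assms by blast
  have "nrm ((J h ^^ Suc n) u - u) \<le> nrm (J h ((J h ^^ n) u) - J h u) + nrm (J h u - u)"
    using nrm_diff_triangle[of "(J h ^^ Suc n) u" "J h u" u] X assms by simp
  also have "\<dots> \<le> nrm ((J h ^^ n) u - u) + h * nrm v"
    using J_contraction[of h "(J h ^^ n) u" u] J_near[OF assms] X assms by simp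
  finally show ?case using Suc by (simp add: algebra_simps)
qed simp

lemma Jn_shift:
  assumes "0 < h" "(u, v) \<in> A"
  shows "nrm ((J h ^^ (n + k)) u - (J h ^^ n) u) \<le> k * h * nrm v"
  using Jn_contraction[of h "(J h ^^ k) u" u n] Jn_near[OF assms, of k] A_X[OF assms(2)] assms
  by (simp add: funpow_add)

section \<open>Halving the step length on the domain of \<open>A^2\<close>\<close>

definition D2 :: "real \<Rightarrow> real \<Rightarrow> 'a \<Rightarrow> bool" where
  "D2 B C u \<longleftrightarrow> (\<exists>y z. (u, y) \<in> A \<and> (y, z) \<in> A \<and> nrm y \<le> B \<and> nrm z \<le> C)"

lemma D2_X: "D2 B C u \<Longrightarrow> u \<in> X" by (auto simp: D2_def A_X)

text \<open>\<open>q\<close> is \<open>A (J k x)\<close>, and it is also the resolvent of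
  \<open>y = A x\<close>, because \<open>q - k A q = y\<close>. Hence a resolvent does not increase
  the norms of \<open>A x\<close> and \<open>A^2 x\<close>, and the constants in \<open>D2\<close>
  survive any number of steps.\<close>

lemma resolvent_step:
  assumes "0 < k" "(x, y) \<in> A" "(y, z) \<in> A"
  defines "q \<equiv> (1 / k) *\<^sub>R (J k x - x)"
  shows "(J k x, q) \<in> A" "(q, (1 / k) *\<^sub>R (q - y)) \<in> A" "nrm q \<le> nrm y"
    "nrm ((1 / k) *\<^sub>R (q - y)) \<le> nrm z"
proof -
  have X: "x \<in> X" "y \<in> X" "z \<in> X" using A_X assms by auto
  show p: "(J k x, q) \<in> A" unfolding q_def using J_in_A assms X by blast
  show q: "(q, (1 / k) *\<^sub>R (q - y)) \<in> A"
    using A_scale[OF A_diff[OF p assms(2)], of "1 / k"] unfolding q_def .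
  show "nrm q \<le> nrm y" using accretive[OF q, of k] \<open>0 < k\<close> by simp
  have qX: "q \<in> X" using A_X q by blast
  have "nrm (q - y) \<le> nrm ((q - y) - k *\<^sub>R ((1 / k) *\<^sub>R (q - y) - z))"
    by (rule accretive) (use A_diff[OF q assms(3)] \<open>0 < k\<close> in auto)
  also have "\<dots> = k * nrm z" using \<open>0 < k\<close> X nrm_scale[of z k] by (simp add: scaleR_diff_right)
  finally show "nrm ((1 / k) *\<^sub>R (q - y)) \<le> nrm z"
    using \<open>0 < k\<close> nrm_scale[OF X_closed(3)[OF qX X(2)], of "1 / k"]
    by (simp add: pos_divide_le_eq mult.commute)
qed

lemma D2_J: assumes "0 < k" "D2 B C x" shows "D2 B C (J k x)"
proof -
  obtain y z where "(x, y) \<in> A" "(y, z) \<in> A" "nrm y \<le> B" "nrm z \<le> C"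
    using assms by (auto simp: D2_def)
  then show ?thesis
    unfolding D2_def using resolvent_step[OF \<open>0 < k\<close>, of x y z] order_trans by blast
qed

text \<open>Two steps of length \<open>k\<close> agree with one step of length \<open>2 k\<close> up to \<open>k\<^sup>2 A\<^sup>2\<close>, because
  \<open>(1 - k A)\<^sup>2 = (1 - 2 k A) + k\<^sup>2 A\<^sup>2\<close>.\<close>

lemma J_halve:
  assumes k: "0 < k" and D: "D2 B C x"
  shows "nrm (J (2 * k) x - J k (J k x)) \<le> k\<^sup>2 * C"
proof -
  obtain y z where A: "(x, y) \<in> A" "(y, z) \<in> A" and C: "nrm z \<le> C"
    using D by (auto simp: D2_def)
  define p where "p = J k x"
  define r where "r = J k p"
  define e where "e = p - x"
  define q where "q = (1 / k) *\<^sub>R e"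
  have X: "x \<in> X" "y \<in> X" "z \<in> X" using A_X A by auto
  have pX: "p \<in> X" using X k by (simp add: p_def)
  have rX: "r \<in> X" using pX k by (simp add: r_def)
  have pA: "(p, q) \<in> A" and qy: "nrm ((1 / k) *\<^sub>R (q - y)) \<le> nrm z"
    using resolvent_step[OF k A] by (auto simp: p_def q_def e_def)
  have qX: "q \<in> X" using pA A_X by blast
  have rA: "(r, (1 / k) *\<^sub>R (r - p)) \<in> A" unfolding r_def using J_in_A k pX by blast
  \<comment> \<open>\<open>r - p - e = r - 2 p + x\<close> is the residual of \<open>r\<close> in
    the equation for step \<open>2 * k\<close>. Applying \<open>1 - k A\<close> to it leaves
    \<open>k (q - y)\<close>, so accretivity bounds it.\<close>
  have "(r - p - e, (1 / k) *\<^sub>R (r - p) - q - (q - y)) \<in> A"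
    unfolding e_def using A_diff[OF A_diff[OF rA pA] A_diff[OF pA A(1)]] by simp
  from accretive[OF this, of k] have "nrm (r - p - e) \<le> nrm (k *\<^sub>R (q - y))"
    using k by (simp add: q_def algebra_simps)
  also have "\<dots> = k\<^sup>2 * nrm ((1 / k) *\<^sub>R (q - y))"
    using k X qX by (simp add: nrm_scale power2_eq_square)
  also have "\<dots> \<le> k\<^sup>2 * C" using qy C by (intro mult_left_mono) auto
  finally have *: "nrm (r - p - e) \<le> k\<^sup>2 * C" .
  have "nrm (J (2 * k) x - r) \<le> nrm (x - (r - (2 * k) *\<^sub>R ((1 / k) *\<^sub>R (r - p))))"
    using J_dist[OF _ X(1) rA, of "2 * k"] k by simp
  also have "x - (r - (2 * k) *\<^sub>R ((1 / k) *\<^sub>R (r - p))) = r - p - e"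
    using k by (simp add: e_def scaleR_2 algebra_simps)
  finally show ?thesis using * by (simp add: r_def p_def)
qed

text \<open>The long steps are replaced one at a time: the remaining powers of
  \<open>J (2 * k)\<close> do not enlarge the error already made, and by \<open>D2_J\<close> every
  new starting point satisfies the same bound \<open>C\<close>.\<close>

lemma Jn_halve:
  assumes k: "0 < k" and D: "D2 B C x"
  shows "nrm ((J (2 * k) ^^ n) x - (J k ^^ (2 * n)) x) \<le> n * (k\<^sup>2 * C)"
  using D
proof (induction n arbitrary: x)
  case (Suc n)
  let ?y = "J k (J k x)"
  have D: "D2 B C ?y" using Suc.prems D2_J k by blast
  have X: "x \<in> X" "?y \<in> X" using Suc.prems D D2_X by blast+
  have "nrm ((J (2 * k) ^^ n) (J (2 * k) x) - (J k ^^ (2 * n)) ?y)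
      \<le> nrm ((J (2 * k) ^^ n) (J (2 * k) x) - (J (2 * k) ^^ n) ?y)
        + nrm ((J (2 * k) ^^ n) ?y - (J k ^^ (2 * n)) ?y)"
    by (rule nrm_diff_triangle) (use X k in auto)
  also have "\<dots> \<le> k\<^sup>2 * C + n * (k\<^sup>2 * C)"
    using Jn_contraction[of "2 * k" "J (2 * k) x" ?y n] J_halve[OF k Suc.prems] Suc.IH[OF D] X k
    by simp
  finally show ?case by (simp add: algebra_simps funpow_Suc_right del: funpow.simps)
qed simp

text \<open>The scheme is compared with the Taylor polynomial \<open>u + n h v\<close>. Step
  \<open>n + 1\<close> leaves the residual \<open>(n + 1) h^2 z\<close>, and these residuals add up
  because \<open>J h\<close> is a contraction.\<close>

lemma Jn_expand:
  assumes h: "0 < h" and A: "(u, v) \<in> A" "(v, z) \<in> A"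
  shows "nrm ((J h ^^ n) u - u - (n * h) *\<^sub>R v) \<le> (n * h)\<^sup>2 * nrm z"
proof -
  have X: "u \<in> X" "v \<in> X" "z \<in> X" using A_X A by auto
  have "nrm ((J h ^^ n) u - u - (n * h) *\<^sub>R v) \<le> (\<Sum>i\<le>n. i) * h\<^sup>2 * nrm z"
  proof (induction n)
    case (Suc n)
    let ?w = "(J h ^^ n) u"
    have "(u + (Suc n * h) *\<^sub>R v, v + (Suc n * h) *\<^sub>R z) \<in> A"
      by (rule A_add[OF A(1) A_scale[OF A(2)]])
    from J_dist[OF h _ this, of ?w]
    have "nrm (J h ?w - u - (Suc n * h) *\<^sub>R v)
        \<le> nrm ((?w - u - (n * h) *\<^sub>R v) + (Suc n * h\<^sup>2) *\<^sub>R z)"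
      using X h by (simp add: algebra_simps power2_eq_square)
    also have "\<dots> \<le> nrm (?w - u - (n * h) *\<^sub>R v) + nrm ((Suc n * h\<^sup>2) *\<^sub>R z)"
      using nrm_triangle X h by simp
    also have "\<dots> \<le> (\<Sum>i\<le>n. i) * h\<^sup>2 * nrm z + Suc n * h\<^sup>2 * nrm z"
      using Suc X nrm_scale[of z "Suc n * h\<^sup>2"] by simp
    finally show ?case by (simp add: algebra_simps)
  qed simp
  also have "\<dots> \<le> (n\<^sup>2) * h\<^sup>2 * nrm z"
  proof -
    have "(\<Sum>i\<le>n. i) \<le> n\<^sup>2"
      by (induction n) (auto simp: power2_eq_square)
    then have "real (\<Sum>i\<le>n. i) \<le> real (n\<^sup>2)" by (rule of_nat_mono)
    then show ?thesis using X by (intro mult_right_mono) auto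
  qed
  finally show ?thesis by (simp add: power_mult_distrib)
qed

text \<open>If \<open>x\<close> lies in the domain of \<open>A\<close>, then \<open>J h x\<close>
  lies in that of \<open>A^2\<close>, since \<open>A (J h x) = (J h x - x) / h\<close> is a
  combination of two elements of the domain.\<close>

lemma D2_dense:
  assumes "u \<in> X" "0 < e" shows "\<exists>u' B C. D2 B C u' \<and> nrm (u - u') < e"
proof -
  obtain x y where A: "(x, y) \<in> A" and e: "nrm (u - x) < e / 2"
    using A_dense[of u "e / 2"] assms by auto
  have X: "x \<in> X" "y \<in> X" using A A_X by auto
  obtain h where h: "0 < h" "h * nrm y \<le> e / 2"
    using small_multiple[of "nrm y" "e / 2"] assms X by auto
  have "D2 (nrm ((1 / h) *\<^sub>R (J h x - x))) (nrm ((1 / h) *\<^sub>R ((1 / h) *\<^sub>R (J h x - x) - y))) (J h x)"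
    unfolding D2_def using J_in_A[OF h(1) X(1)] A_scale[OF A_diff[OF J_in_A[OF h(1) X(1)] A]]
    by blast
  moreover have "nrm (u - J h x) < e"
    using nrm_diff_triangle[of u x "J h x"] e J_near[OF h(1) A] h assms X
      nrm_commute[of x "J h x"] by simp
  ultimately show ?thesis by blast
qed

lemma J_tendsto:
  assumes "w \<in> X" shows "((\<lambda>h. nrm (J h w - w)) \<longlongrightarrow> 0) (at_right 0)"
proof (rule tendstoI)
  fix e :: real assume "0 < e"
  obtain x y where A: "(x, y) \<in> A" and e: "nrm (w - x) < e / 3"
    using A_dense[of w "e / 3"] assms \<open>0 < e\<close> by auto
  have X: "x \<in> X" "y \<in> X" using A A_X by auto
  obtain d where d: "0 < d" "d * nrm y \<le> e / 3"
    using small_multiple[of "nrm y" "e / 3"] \<open>0 < e\<close> X by auto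
  have "nrm (J h w - w) < e" if h: "0 < h" "h < d" for h
  proof -
    have "nrm (J h w - w) \<le> nrm (J h w - J h x) + nrm (J h x - x) + nrm (x - w)"
      using nrm_diff_triangle[of "J h w" "J h x" w] nrm_diff_triangle[of "J h x" x w] h X assms
      by simp
    moreover have "h * nrm y \<le> d * nrm y" using h X by (intro mult_right_mono) auto
    ultimately show ?thesis
      using J_contraction[OF h(1) assms X(1)] J_near[OF h(1) A] e d nrm_commute[of x w] X assms
      by simp
  qed
  then show "\<forall>\<^sub>F h in at_right 0. dist (nrm (J h w - w)) 0 < e"
    using d(1) assms by (auto simp: eventually_at_right_field intro!: exI[of _ d])
qed

section \<open>The implicit Euler scheme along dyadic step lengths and its limit
  \<open>S\<close>\<close>

definition steps :: "nat \<Rightarrow> real \<Rightarrow> nat" where "steps n t = nat \<lfloor>t * 2 ^ n\<rfloor>"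

definition euler :: "nat \<Rightarrow> real \<Rightarrow> 'a \<Rightarrow> 'a" where
  "euler n t = J (1 / 2 ^ n) ^^ steps n t"

definition S :: "real \<Rightarrow> 'a \<Rightarrow> 'a" where
  "S t u = (SOME l. l \<in> X \<and> (\<lambda>n. nrm (euler n t u - l)) \<longlonglongrightarrow> 0)"

lemma steps_le: "0 \<le> t \<Longrightarrow> steps n t * (1 / 2 ^ n) \<le> t"
  by (simp add: steps_def field_simps)

lemma steps_Suc: "0 \<le> t \<Longrightarrow> steps (Suc n) t = 2 * steps n t \<or> steps (Suc n) t = 2 * steps n t + 1"
proof -
  assume "0 \<le> t"
  then have "0 \<le> \<lfloor>t * 2 ^ n\<rfloor>" by simp
  moreover have "\<lfloor>t * 2 ^ Suc n\<rfloor> = 2 * \<lfloor>t * 2 ^ n\<rfloor> \<or> \<lfloor>t * 2 ^ Suc n\<rfloor> = 2 * \<lfloor>t * 2 ^ n\<rfloor> + 1"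
  proof -
    have "t * 2 ^ Suc n = 2 * (t * 2 ^ n)" by simp
    then show ?thesis by linarith
  qed
  ultimately show ?thesis unfolding steps_def by linarith
qed

lemma steps_add:
  assumes "0 \<le> s" "0 \<le> t"
  shows "\<exists>k\<le>1. steps n (s + t) = steps n s + steps n t + k"
proof -
  have "0 \<le> \<lfloor>s * 2 ^ n\<rfloor>" "0 \<le> \<lfloor>t * 2 ^ n\<rfloor>" using assms by auto
  moreover have "\<lfloor>(s + t) * 2 ^ n\<rfloor> = \<lfloor>s * 2 ^ n\<rfloor> + \<lfloor>t * 2 ^ n\<rfloor>
      \<or> \<lfloor>(s + t) * 2 ^ n\<rfloor> = \<lfloor>s * 2 ^ n\<rfloor> + \<lfloor>t * 2 ^ n\<rfloor> + 1"
    unfolding distrib_right by linarith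
  ultimately show ?thesis unfolding steps_def
    by (auto intro: exI[of _ 0] exI[of _ 1] simp: nat_add_distrib)
qed

lemma steps_tendsto: assumes "0 \<le> t" shows "(\<lambda>n. steps n t * (1 / 2 ^ n)) \<longlonglongrightarrow> t"
proof (rule tendsto_sandwich[of "\<lambda>n. t - (1 / 2) ^ n" _ _ "\<lambda>n. t"])
  have "t - (1 / 2) ^ n \<le> steps n t * (1 / 2 ^ n)" for n
  proof -
    have "t * 2 ^ n - 1 \<le> steps n t" unfolding steps_def by linarith
    then have "(t * 2 ^ n - 1) / 2 ^ n \<le> steps n t / 2 ^ n" by (intro divide_right_mono) auto
    then show ?thesis by (simp add: diff_divide_distrib power_one_over)
  qed
  then show "\<forall>\<^sub>F n in sequentially. t - (1 / 2) ^ n \<le> steps n t * (1 / 2 ^ n)" by simp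
  have "(\<lambda>n. t - (1 / 2) ^ n) \<longlonglongrightarrow> t - 0"
    by (intro tendsto_intros LIMSEQ_power_zero) simp
  then show "(\<lambda>n. t - (1 / 2) ^ n) \<longlonglongrightarrow> t" by simp
qed (use assms steps_le in auto)

lemma euler_X [simp]: "u \<in> X \<Longrightarrow> euler n t u \<in> X"
  by (simp add: euler_def)

lemma euler_contraction: "u \<in> X \<Longrightarrow> w \<in> X \<Longrightarrow> nrm (euler n t u - euler n t w) \<le> nrm (u - w)"
  unfolding euler_def by (rule Jn_contraction) auto

text \<open>With \<open>2 * k = (1 / 2) ^ n\<close>, each of the at most \<open>t / (2 * k)\<close>
  long steps costs \<open>k^2 * C\<close> when halved, and rounding adds at most one short step,
  which costs \<open>k * B\<close>. Both costs are rounded up to multiples of \<open>2 * k\<close>,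
  which is summable in \<open>n\<close>.\<close>

lemma euler_Suc:
  assumes t: "0 \<le> t" and D: "D2 B C u"
  shows "nrm (euler (Suc n) t u - euler n t u) \<le> (t * C + B) * (1 / 2) ^ n"
proof -
  define k :: real where "k = 1 / 2 ^ Suc n"
  have k: "0 < k" "1 / 2 ^ n = 2 * k" "(1 / 2) ^ n = 2 * k" by (auto simp: k_def power_divide)
  define j where "j = steps n t"
  obtain v z where A: "(u, v) \<in> A" "(v, z) \<in> A" and BC: "nrm v \<le> B" "nrm z \<le> C"
    using D by (auto simp: D2_def)
  have X: "u \<in> X" "v \<in> X" "z \<in> X" using A A_X by auto
  have "0 \<le> B" "0 \<le> C" using BC nrm_nonneg X order_trans by blast+
  have "\<exists>i\<le>1. steps (Suc n) t = 2 * j + i"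
    using steps_Suc[OF t, of n] by (auto simp: j_def intro: exI[of _ 0] exI[of _ 1])
  then obtain i where i: "i \<le> 1" "steps (Suc n) t = 2 * j + i" by blast
  have "nrm (euler (Suc n) t u - euler n t u)
      \<le> nrm ((J k ^^ (2 * j + i)) u - (J k ^^ (2 * j)) u)
        + nrm ((J k ^^ (2 * j)) u - (J (2 * k) ^^ j) u)"
    unfolding euler_def i k(2) j_def[symmetric] k_def[symmetric]
    by (rule nrm_diff_triangle) (use X k in auto)
  also have "\<dots> \<le> i * k * nrm v + j * (k\<^sup>2 * C)"
    using Jn_shift[OF k(1) A(1), of "2 * j" i] Jn_halve[OF k(1) D, of j]
      nrm_commute[of "(J k ^^ (2 * j)) u" "(J (2 * k) ^^ j) u"] X k by simp
  also have "\<dots> \<le> 2 * k * B + 2 * k * (t * C)"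
  proof (rule add_mono)
    have "i * k \<le> 2 * k" using i k by (intro mult_right_mono) auto
    then show "i * k * nrm v \<le> 2 * k * B"
      using BC \<open>0 \<le> B\<close> X k by (intro mult_mono) auto
    have "j * (2 * k) \<le> t" using steps_le[OF t, of n] k by (simp add: j_def)
    then have "j * (2 * k) * (k * C) \<le> t * (k * C)"
      using k \<open>0 \<le> C\<close> by (intro mult_right_mono) auto
    moreover have "0 \<le> t * (k * C)" using k \<open>0 \<le> C\<close> t by auto
    ultimately show "j * (k\<^sup>2 * C) \<le> 2 * k * (t * C)"
      by (simp add: power2_eq_square algebra_simps)
  qed
  finally show ?thesis by (simp add: k algebra_simps)
qed

lemma euler_convergent_D2:
  assumes "0 \<le> t" "D2 B C u"
  shows "\<exists>l\<in>X. (\<lambda>n. nrm (euler n t u - l)) \<longlonglongrightarrow> 0"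
proof (rule complete_summable)
  show "summable (\<lambda>n. (t * C + B) * (1 / 2) ^ n)"
    by (intro summable_mult summable_geometric) simp
qed (use assms D2_X euler_Suc in auto)

lemma euler_convergent:
  assumes t: "0 \<le> t" and u: "u \<in> X"
  shows "\<exists>l\<in>X. (\<lambda>n. nrm (euler n t u - l)) \<longlonglongrightarrow> 0"
proof (rule complete)
  fix e :: real assume "0 < e"
  obtain w B C where D: "D2 B C w" and w: "nrm (u - w) < e / 4"
    using D2_dense[OF u, of "e / 4"] \<open>0 < e\<close> by auto
  have wX: "w \<in> X" using D D2_X by blast
  obtain l where l: "l \<in> X" "(\<lambda>n. nrm (euler n t w - l)) \<longlonglongrightarrow> 0"
    using euler_convergent_D2[OF t D] by blast
  obtain N where N: "\<And>n. n \<ge> N \<Longrightarrow> nrm (euler n t w - l) < e / 4"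
    using LIMSEQ_D[OF l(2), of "e / 4"] \<open>0 < e\<close> l wX by auto
  have near: "nrm (euler n t u - l) < e / 2" if "n \<ge> N" for n
    using nrm_diff_triangle[of "euler n t u" "euler n t w" l] euler_contraction[OF u wX, of n t]
      N[OF that] w u wX l by simp
  have "nrm (euler m t u - euler n t u) < e" if "m \<ge> N" "n \<ge> N" for m n
    using nrm_diff_triangle[of "euler m t u" l "euler n t u"] near[OF that(1)] near[OF that(2)]
      nrm_commute[of "euler n t u" l] u l by simp
  then show "\<exists>N. \<forall>m\<ge>N. \<forall>n\<ge>N. nrm (euler m t u - euler n t u) < e" by blast
qed (use u in auto)

lemma
  assumes "0 \<le> t" "u \<in> X"
  shows S_X [simp]: "S t u \<in> X"
    and euler_tendsto: "(\<lambda>n. nrm (euler n t u - S t u)) \<longlonglongrightarrow> 0"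
  using someI_ex[of "\<lambda>l. l \<in> X \<and> (\<lambda>n. nrm (euler n t u - l)) \<longlonglongrightarrow> 0"] euler_convergent[OF assms]
  unfolding S_def by blast+

lemma S_contraction:
  assumes "0 \<le> t" "u \<in> X" "w \<in> X" shows "nrm (S t u - S t w) \<le> nrm (u - w)"
  by (rule nrm_lim_le[OF tendsto_nrm_diff[OF euler_tendsto euler_tendsto] _ _ euler_contraction])
    (use assms in auto)

lemma S_nrm_le:
  assumes "0 \<le> t" "u \<in> X" shows "nrm (S t u) \<le> nrm u"
  by (rule nrm_lim_le[OF euler_tendsto _ _ _ tendsto_const]) (use assms in \<open>auto simp: euler_def Jn_nrm_le\<close>)

lemma S_zero: assumes "u \<in> X" shows "nrm (S 0 u - u) = 0"
proof -
  have "(\<lambda>n. nrm (u - S 0 u)) \<longlonglongrightarrow> 0"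
    using euler_tendsto[of 0 u] assms by (simp add: euler_def steps_def)
  then show ?thesis using nrm_commute[of u "S 0 u"] assms by (simp add: LIMSEQ_const_iff)
qed

lemma S_linear:
  assumes "0 \<le> t" "u \<in> X" "w \<in> X"
  shows "nrm (S t (a *\<^sub>R u + b *\<^sub>R w) - (a *\<^sub>R S t u + b *\<^sub>R S t w)) = 0"
proof -
  let ?y = "a *\<^sub>R u + b *\<^sub>R w" and ?r = "\<lambda>n. a *\<^sub>R euler n t u + b *\<^sub>R euler n t w"
  have "(\<lambda>n. nrm (?r n - (a *\<^sub>R S t u + b *\<^sub>R S t w))) \<longlonglongrightarrow> 0"
  proof (rule tendsto_sandwich[of "\<lambda>_. 0" _ _
        "\<lambda>n. \<bar>a\<bar> * nrm (euler n t u - S t u) + \<bar>b\<bar> * nrm (euler n t w - S t w)"])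
    show "\<forall>\<^sub>F n in sequentially. nrm (?r n - (a *\<^sub>R S t u + b *\<^sub>R S t w)) \<le>
        \<bar>a\<bar> * nrm (euler n t u - S t u) + \<bar>b\<bar> * nrm (euler n t w - S t w)"
      using nrm_lincomb[of "euler _ t u - S t u" "euler _ t w - S t w" a b] assms
      by (intro always_eventually allI) (simp add: algebra_simps)
    show "(\<lambda>n. \<bar>a\<bar> * nrm (euler n t u - S t u) + \<bar>b\<bar> * nrm (euler n t w - S t w)) \<longlonglongrightarrow> 0"
      using assms by (auto intro!: tendsto_eq_intros euler_tendsto)
  qed (use assms in auto)
  from tendsto_nrm_diff[OF euler_tendsto this, of t ?y]
  have "nrm (S t ?y - (a *\<^sub>R S t u + b *\<^sub>R S t w)) \<le> 0"
    by (rule nrm_lim_le[OF _ _ _ _ tendsto_const])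
      (use assms in \<open>auto simp: euler_def Jn_linear\<close>)
  then show ?thesis using assms by (intro antisym nrm_nonneg) simp_all
qed

text \<open>Here \<open>x\<close> stands for the norm of the defect in some identity; the lemma
  extends seminorm identities from the domain of \<open>A\<close> to all of
  \<open>X\<close>.\<close>

lemma null_by_dense:
  assumes u: "u \<in> X" and le: "\<And>w v. (w, v) \<in> A \<Longrightarrow> x \<le> c * nrm (u - w)" and "0 \<le> x" "0 \<le> c"
  shows "x = (0::real)"
proof (rule ccontr)
  assume "x \<noteq> 0"
  then have "0 < x" using assms by simp
  then obtain d where d: "0 < d" "d * c \<le> x / 2" using small_multiple[of c "x / 2"] assms by auto
  obtain w v where A: "(w, v) \<in> A" "nrm (u - w) < d" using A_dense[OF u d(1)] by auto
  have "c * nrm (u - w) \<le> c * d" using A \<open>0 \<le> c\<close> by (intro mult_left_mono) auto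
  then show False using le[OF A(1)] d \<open>0 < x\<close> by (simp add: mult.commute)
qed

text \<open>Rounding down is not additive: the scheme for \<open>s + t\<close> may take one step
  more than those for \<open>s\<close> and \<open>t\<close> together. On the domain of
  \<open>A\<close> this step costs only \<open>2^-n * nrm v\<close>, which disappears in the
  limit.\<close>

lemma S_add_A:
  assumes st: "0 \<le> s" "0 \<le> t" and A: "(u, v) \<in> A"
  shows "nrm (S (s + t) u - S s (S t u)) = 0"
proof -
  have X: "u \<in> X" "v \<in> X" using A A_X by auto
  let ?h = "\<lambda>n. 1 / 2 ^ n :: real"
  have le: "nrm (euler n (s + t) u - euler n s (S t u)) \<le> ?h n * nrm v + nrm (euler n t u - S t u)" for n
  proof -
    obtain k where k: "k \<le> 1" "steps n (s + t) = steps n s + steps n t + k"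
      using steps_add[OF st] by blast
    have "nrm (euler n (s + t) u - euler n s (euler n t u)) \<le> k * ?h n * nrm v"
      unfolding euler_def k(2) using Jn_shift[OF _ A, of "?h n" "steps n s + steps n t" k]
      by (simp add: funpow_add)
    also have "\<dots> \<le> ?h n * nrm v" using k X by (intro mult_right_mono) (auto simp: divide_right_mono)
    finally show ?thesis
      using nrm_diff_triangle[of "euler n (s + t) u" "euler n s (euler n t u)" "euler n s (S t u)"]
        euler_contraction[of "euler n t u" "S t u" n s] X st by simp
  qed
  have h0: "?h \<longlonglongrightarrow> 0" using LIMSEQ_power_zero[of "1 / 2 :: real"] by (simp add: power_divide)
  have "(\<lambda>n. ?h n * nrm v + nrm (euler n t u - S t u)) \<longlonglongrightarrow> 0 * nrm v + 0"
    by (intro tendsto_intros euler_tendsto h0) (use X st in auto)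
  then have "nrm (S (s + t) u - S s (S t u)) \<le> 0"
    using nrm_lim_le[OF tendsto_nrm_diff[OF euler_tendsto euler_tendsto] _ _ le] st X by simp
  then show ?thesis using X st by (intro antisym nrm_nonneg) simp_all
qed

lemma S_add:
  assumes st: "0 \<le> s" "0 \<le> t" and u: "u \<in> X"
  shows "nrm (S (s + t) u - S s (S t u)) = 0"
\<comment> \<open>The factor 2 counts two contractions, \<open>S (s + t)\<close> and the composition
  of \<open>S s\<close> with \<open>S t\<close>.\<close>
proof (rule null_by_dense[OF u, of _ 2])
  fix w v assume A: "(w, v) \<in> A"
  then have w: "w \<in> X" using A_X by blast
  have "nrm (S (s + t) u - S s (S t u)) \<le> nrm (S (s + t) u - S (s + t) w)
      + nrm (S (s + t) w - S s (S t w)) + nrm (S s (S t w) - S s (S t u))"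
    using nrm_diff_triangle[of "S (s + t) u" "S (s + t) w" "S s (S t u)"]
      nrm_diff_triangle[of "S (s + t) w" "S s (S t w)" "S s (S t u)"] st u w by simp
  also have "\<dots> \<le> 2 * nrm (u - w)"
    using S_contraction[of "s + t" u w] S_contraction[of s "S t w" "S t u"] S_contraction[of t w u]
      S_add_A[OF st A] nrm_commute[of u w] st u w by simp
  finally show "nrm (S (s + t) u - S s (S t u)) \<le> 2 * nrm (u - w)" .
qed (use st u in auto)

lemma S_Lipschitz:
  assumes t: "0 \<le> t" and A: "(u, v) \<in> A" shows "nrm (S t u - u) \<le> t * nrm v"
proof -
  have X: "u \<in> X" "v \<in> X" using A A_X by auto
  have "nrm (euler n t u - u) \<le> t * nrm v" for n
    using Jn_near[OF _ A, of "1 / 2 ^ n" "steps n t"]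
      mult_right_mono[OF steps_le[OF t, of n], of "nrm v"] X by (simp add: euler_def)
  then show ?thesis
    using nrm_lim_le[OF tendsto_nrm_diff[OF euler_tendsto[OF t X(1)], of "\<lambda>_. u" u]
      _ _ _ tendsto_const] X t by simp
qed

lemma S_expand:
  assumes t: "0 \<le> t" and A: "(u, v) \<in> A" "(v, z) \<in> A"
  shows "nrm (S t u - u - t *\<^sub>R v) \<le> t\<^sup>2 * nrm z"
proof -
  have X: "u \<in> X" "v \<in> X" "z \<in> X" using A A_X by auto
  let ?r = "\<lambda>n. steps n t * (1 / 2 ^ n) :: real"
  have "(\<lambda>n. \<bar>?r n - t\<bar> * nrm v) \<longlonglongrightarrow> \<bar>t - t\<bar> * nrm v"
    by (intro tendsto_intros steps_tendsto t)
  then have 1: "(\<lambda>n. nrm (?r n *\<^sub>R v - t *\<^sub>R v)) \<longlonglongrightarrow> 0"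
    using X by (simp add: nrm_scale flip: scaleR_diff_left)
  have 2: "(\<lambda>n. nrm ((euler n t u - u) - (S t u - u))) \<longlonglongrightarrow> 0"
    using euler_tendsto[OF t X(1)] by simp
  have le: "nrm (euler n t u - u - ?r n *\<^sub>R v) \<le> (?r n)\<^sup>2 * nrm z" for n
    unfolding euler_def by (rule Jn_expand[OF _ A]) simp
  have lim: "(\<lambda>n. (?r n)\<^sup>2 * nrm z) \<longlonglongrightarrow> t\<^sup>2 * nrm z"
    by (intro tendsto_intros steps_tendsto t)
  show ?thesis
    by (rule nrm_lim_le[OF tendsto_nrm_diff[OF 2 1] _ _ le lim]) (use X t in auto)
qed

lemma S_continuous:
  assumes u: "u \<in> X" shows "((\<lambda>t. nrm (S t u - u)) \<longlongrightarrow> 0) (at_right 0)"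
proof (rule tendstoI)
  fix e :: real assume "0 < e"
  obtain x y where A: "(x, y) \<in> A" and e: "nrm (u - x) < e / 3"
    using A_dense[of u "e / 3"] u \<open>0 < e\<close> by auto
  have X: "x \<in> X" "y \<in> X" using A A_X by auto
  obtain d where d: "0 < d" "d * nrm y \<le> e / 3"
    using small_multiple[of "nrm y" "e / 3"] \<open>0 < e\<close> X by auto
  have "nrm (S t u - u) < e" if t: "0 < t" "t < d" for t
  proof -
    have "nrm (S t u - u) \<le> nrm (S t u - S t x) + nrm (S t x - x) + nrm (x - u)"
      using nrm_diff_triangle[of "S t u" "S t x" u] nrm_diff_triangle[of "S t x" x u] t X u by simp
    moreover have "t * nrm y \<le> d * nrm y" using t X by (intro mult_right_mono) auto
    ultimately show ?thesis
      using S_contraction[of t u x] S_Lipschitz[OF _ A, of t] e d nrm_commute[of x u] X u t by simp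
  qed
  then show "\<forall>\<^sub>F t in at_right 0. dist (nrm (S t u - u)) 0 < e"
    using d(1) u by (auto simp: eventually_at_right_field intro!: exI[of _ d])
qed

text \<open>\<open>S_expand\<close> applies \<open>A\<close> twice, so \<open>u\<close> is replaced
  by \<open>x = J h u\<close>. Its image \<open>y\<close> is near \<open>v\<close>, since
  \<open>J h\<close> commutes with \<open>A\<close> up to null vectors and tends to the identity.
  The rest \<open>u - x\<close> enters through the Lipschitz bound \<open>t * nrm (v - y)\<close>,
  which is still of order \<open>t\<close>. The converse inclusion of generators is part of
  \<open>gen_rescaled\<close>.\<close>

lemma S_generator:
  assumes A: "(u, v) \<in> A"
  shows "((\<lambda>t. nrm ((1 / t) *\<^sub>R (S t u - u) - v)) \<longlongrightarrow> 0) (at_right 0)"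
proof (rule tendstoI)
  fix e :: real assume "0 < e"
  have X: "u \<in> X" "v \<in> X" using A A_X by auto
  have "\<forall>\<^sub>F h in at_right 0. dist (nrm (J h v - v)) 0 < e / 3 \<and> 0 < h"
    using tendstoD[OF J_tendsto[OF X(2)], of "e / 3"] \<open>0 < e\<close>
    by (intro eventually_conj) (auto simp: eventually_at_right_less)
  then obtain h where h: "0 < h" "nrm (J h v - v) < e / 3"
    using X eventually_happens'[OF trivial_limit_at_right_real] by (metis (no_types, lifting) J_X X_closed(3) abs_of_nonneg diff_zero dist_real_def nrm_nonneg)
  define x where "x = J h u"
  define y where "y = (1 / h) *\<^sub>R (x - u)"
  define z where "z = (1 / h) *\<^sub>R (y - v)"
  have xy: "(x, y) \<in> A" unfolding x_def y_def using J_in_A h X by blast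
  have yz: "(y, z) \<in> A" unfolding z_def using A_scale[OF A_diff[OF xy A], of "1 / h"]
    by (simp add: y_def)
  have XX: "x \<in> X" "y \<in> X" "z \<in> X" using xy yz A_X by auto
  have "nrm (J h v - y) \<le> 0"
    using J_dist[OF h(1) X(2) yz] h by (simp add: z_def)
  then have vy: "nrm (v - y) < e / 3"
    using nrm_diff_triangle[of v "J h v" y] nrm_commute[of v "J h v"] h X XX by simp
  obtain d where d: "0 < d" "d * nrm z \<le> e / 3"
    using small_multiple[of "nrm z" "e / 3"] \<open>0 < e\<close> XX by auto
  have "nrm ((1 / t) *\<^sub>R (S t u - u) - v) < e" if t: "0 < t" "t < d" for t
  proof -
    have lin: "nrm (S t (u - x) - (S t u - S t x)) = 0"
      using S_linear[of t u x 1 "-1"] t X XX by simp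
    \<comment> \<open>\<open>?p2\<close> is the linearity defect of \<open>S t\<close>, a null
      vector that need not be 0.\<close>
    let ?p1 = "S t x - x - t *\<^sub>R y" and ?p2 = "S t (u - x) - (S t u - S t x)"
      and ?p3 = "S t (u - x) - (u - x)" and ?p4 = "t *\<^sub>R (v - y)"
    have pX: "?p1 \<in> X" "?p2 \<in> X" "?p3 \<in> X" "?p4 \<in> X" using X XX t by auto
    have "S t u - u - t *\<^sub>R v = ?p1 - ?p2 + ?p3 - ?p4"
      by (simp add: algebra_simps)
    also have "nrm \<dots> \<le> nrm (?p1 - ?p2 + ?p3) + nrm ?p4"
      by (rule nrm_triangle_diff) (use X XX t in simp_all)
    also have "nrm (?p1 - ?p2 + ?p3) \<le> nrm (?p1 - ?p2) + nrm ?p3"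
      by (rule nrm_triangle) (use X XX t in simp_all)
    also have "nrm (?p1 - ?p2) \<le> nrm ?p1 + nrm ?p2"
      by (rule nrm_triangle_diff) (use X XX t in simp_all)
    finally have "nrm (S t u - u - t *\<^sub>R v) \<le> nrm ?p1 + nrm ?p2 + nrm ?p3 + nrm ?p4" by simp
    also have "\<dots> \<le> t\<^sup>2 * nrm z + t * nrm (v - y) + t * nrm (v - y)"
      using S_expand[OF _ xy yz, of t] S_Lipschitz[OF _ A_diff[OF A xy], of t] lin t X XX
        nrm_scale[of "v - y" t] by simp
    also have "\<dots> = t * (t * nrm z + 2 * nrm (v - y))"
      by (simp add: power2_eq_square algebra_simps)
    also have "\<dots> < t * e"
    proof (rule mult_strict_left_mono)
      have "t * nrm z \<le> d * nrm z" using t XX by (intro mult_right_mono) auto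
      then show "t * nrm z + 2 * nrm (v - y) < e" using d vy by simp
    qed (use t in auto)
    finally have "nrm (S t u - u - t *\<^sub>R v) < t * e" .
    moreover have "(1 / t) *\<^sub>R (S t u - u) - v = (1 / t) *\<^sub>R (S t u - u - t *\<^sub>R v)"
      using t by (simp add: scaleR_diff_right)
    ultimately show ?thesis using t X nrm_scale[of "S t u - u - t *\<^sub>R v" "1 / t"]
      by (simp add: pos_divide_less_eq mult.commute)
  qed
  moreover have "eventually (\<lambda>t. 0 < t \<and> t < d) (at_right (0::real))"
    using d(1) by (auto simp: eventually_at_right_field intro!: exI[of _ d])
  ultimately show "\<forall>\<^sub>F t in at_right 0. dist (nrm ((1 / t) *\<^sub>R (S t u - u) - v)) 0 < e"
    using X by (auto elim!: eventually_mono)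
qed

end

section \<open>Strongly continuous semigroups\<close>

lemma exp_tendsto: "((\<lambda>t. exp (c * t)) \<longlongrightarrow> 1) (at_right (0::real))"
  by (auto intro!: tendsto_eq_intros)

lemma exp_quotient_tendsto: "((\<lambda>t. (exp (c * t) - 1) / t) \<longlongrightarrow> c) (at_right (0::real))"
proof -
  have "((\<lambda>t. exp (c * t)) has_real_derivative c) (at 0)" by (auto intro!: derivative_eq_intros)
  then show ?thesis by (auto simp: has_field_derivative_iff intro: tendsto_mono[OF at_le])
qed

section \<open>Uniform boundedness and a product rule for curves\<close>

context semi_hilbert
begin

text \<open>The gliding-hump argument in the form of Sokal: of \<open>x + r \<xi>\<close> and \<open>x - r \<xi>\<close>, at least one has an
  image of norm at least \<open>r \<parallel>P \<xi>\<parallel>\<close>, so no category argument is needed.\<close>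

lemma uniform_boundedness:
  fixes P :: "nat \<Rightarrow> 'a \<Rightarrow> 'a"
  assumes PX: "\<And>n u. u \<in> X \<Longrightarrow> P n u \<in> X"
    and lin: "\<And>n u v a b. u \<in> X \<Longrightarrow> v \<in> X \<Longrightarrow>
      nrm (P n (a *\<^sub>R u + b *\<^sub>R v) - (a *\<^sub>R P n u + b *\<^sub>R P n v)) = 0"
    and bdd: "\<And>n. \<exists>C. \<forall>u\<in>X. nrm (P n u) \<le> C * nrm u"
    and pointwise: "\<And>u. u \<in> X \<Longrightarrow> \<exists>C. \<forall>n. nrm (P n u) \<le> C"
  shows "\<exists>K. \<forall>n. \<forall>u\<in>X. nrm (P n u) \<le> K * nrm u"
proof (rule ccontr)
  assume unb: "\<not> ?thesis"
  define N where "N n = (SUP u\<in>{u\<in>X. nrm u \<le> 1}. nrm (P n u))" for n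
  have bddN: "bdd_above ((\<lambda>u. nrm (P n u)) ` {u\<in>X. nrm u \<le> 1})" for n
  proof -
    obtain C where C: "\<forall>u\<in>X. nrm (P n u) \<le> C * nrm u" using bdd by blast
    have "nrm (P n u) \<le> \<bar>C\<bar>" if "u \<in> X" "nrm u \<le> 1" for u
    proof -
      have "C * nrm u \<le> \<bar>C\<bar> * 1" using that by (intro mult_mono) auto
      then show ?thesis using C that by fastforce
    qed
    then show ?thesis by (intro bdd_aboveI[of _ "\<bar>C\<bar>"]) auto
  qed
  have N_bound: "nrm (P n u) \<le> N n * nrm u" if u: "u \<in> X" for n u
  proof (cases "nrm u = 0")
    case True
    obtain C where "\<forall>u\<in>X. nrm (P n u) \<le> C * nrm u" using bdd by blast
    then show ?thesis using u True by fastforce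
  next
    case False
    then have pos: "0 < nrm u" using u by (simp add: less_le)
    let ?c = "1 / nrm u"
    have "nrm (P n (?c *\<^sub>R u)) = nrm (?c *\<^sub>R P n u)"
      using nrm_eq_of_null_diff[of "P n (?c *\<^sub>R u)" "?c *\<^sub>R P n u"] lin[OF u u, of n ?c 0] PX u by simp
    also have "\<dots> = nrm (P n u) / nrm u" using pos PX u by (simp add: nrm_scale)
    finally have "nrm (P n u) / nrm u = nrm (P n (?c *\<^sub>R u))" ..
    also have "\<dots> \<le> N n"
      unfolding N_def by (rule cSUP_upper[OF _ bddN]) (use u pos in \<open>auto simp: nrm_scale\<close>)
    finally show ?thesis using pos by (simp add: field_simps)
  qed
  have N_nonneg: "0 \<le> N n" for n
    unfolding N_def by (rule cSUP_upper2[OF bddN, of 0]) (use PX in auto)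
  \<comment> \<open>The inequality says that \<open>3/4 * r * N n < nrm (P n x')\<close>. The factor
    3/4 has to exceed the share 1/2 of \<open>r\<close> that all later corrections can use
    up.\<close>
  have hump: "\<exists>x'\<in>X. nrm (x' - x) \<le> r \<and> 1 / 2 * r < nrm (P n x') / N n * (2 / 3)"
    if x: "x \<in> X" and r: "0 < r" and n: "0 < N n" for x r n
  proof -
    have "3 / 4 * N n < N n" using n by simp
    then obtain \<xi> where \<xi>: "\<xi> \<in> X" "nrm \<xi> \<le> 1" "3 / 4 * N n < nrm (P n \<xi>)"
      unfolding N_def by (subst (asm) less_cSUP_iff[OF _ bddN]) (auto intro: exI[of _ 0])
    have X': "x + r *\<^sub>R \<xi> \<in> X" "x - r *\<^sub>R \<xi> \<in> X" using x \<xi> by auto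
    have "2 * r * nrm (P n \<xi>) = nrm ((2 * r) *\<^sub>R P n \<xi>)"
      using r \<xi> PX by (simp add: nrm_scale)
    also have "\<dots> = nrm (P n ((2 * r) *\<^sub>R \<xi>))"
      using nrm_eq_of_null_diff[of "P n ((2 * r) *\<^sub>R \<xi>)" "(2 * r) *\<^sub>R P n \<xi>"]
        lin[OF \<xi>(1) \<xi>(1), of n "2 * r" 0] PX \<xi> by simp
    also have "(2 * r) *\<^sub>R \<xi> = 1 *\<^sub>R (x + r *\<^sub>R \<xi>) + (- 1) *\<^sub>R (x - r *\<^sub>R \<xi>)"
      by (simp add: scaleR_2 flip: scaleR_scaleR)
    also have "nrm (P n \<dots>) = nrm (1 *\<^sub>R P n (x + r *\<^sub>R \<xi>) + (- 1) *\<^sub>R P n (x - r *\<^sub>R \<xi>))"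
      by (rule nrm_eq_of_null_diff) (use lin[OF X', of n 1 "-1"] PX X' \<xi>(1) in simp_all)
    also have "\<dots> \<le> nrm (P n (x + r *\<^sub>R \<xi>)) + nrm (P n (x - r *\<^sub>R \<xi>))"
      using nrm_lincomb[of "P n (x + r *\<^sub>R \<xi>)" "P n (x - r *\<^sub>R \<xi>)" 1 "-1"] PX X' by simp
    finally have "r * nrm (P n \<xi>) \<le> nrm (P n (x + r *\<^sub>R \<xi>)) \<or> r * nrm (P n \<xi>) \<le> nrm (P n (x - r *\<^sub>R \<xi>))"
      by linarith
    moreover have "nrm (r *\<^sub>R \<xi>) \<le> r"
      using mult_left_mono[OF \<xi>(2), of r] r \<xi> by (simp add: nrm_scale)
    ultimately obtain x' where x': "x' \<in> X" "nrm (x' - x) \<le> r" "r * nrm (P n \<xi>) \<le> nrm (P n x')"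
      using X' \<xi>(1) by (auto simp del: scaleR_minus_left)
    have "r * (3 / 4 * N n) < r * nrm (P n \<xi>)" using \<xi> r by (intro mult_strict_left_mono)
    then have "1 / 2 * r < nrm (P n x') / N n * (2 / 3)" using x' n by (simp add: field_simps)
    then show ?thesis using x' by blast
  qed
  have "\<exists>n. (4::real) ^ k < N n" for k
  proof (rule ccontr)
    assume "\<not> ?thesis"
    then have "nrm (P n u) \<le> 4 ^ k * nrm u" if "u \<in> X" for n u
      using N_bound[OF that, of n] mult_right_mono[of "N n" "4 ^ k" "nrm u"] that
      by (meson linorder_not_less nrm_nonneg order_trans)
    then show False using unb by blast
  qed
  then obtain i where i: "\<And>k. (4::real) ^ k < N (i k)" by metis
  have i0: "0 < N (i k)" for k using i[of k] by (meson less_trans zero_less_numeral zero_less_power)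
  have "\<exists>x'. x \<in> X \<longrightarrow> x' \<in> X \<and> nrm (x' - x) \<le> (1 / 3) ^ k \<and>
      1 / 2 * (1 / 3) ^ k < nrm (P (i k) x') / N (i k) * (2 / 3)" for x k
    using hump[of x "(1 / 3) ^ k" "i k"] i0 by fastforce
  then obtain g where g: "\<And>x k. x \<in> X \<Longrightarrow> g x k \<in> X \<and> nrm (g x k - x) \<le> (1 / 3) ^ k \<and>
      1 / 2 * (1 / 3) ^ k < nrm (P (i k) (g x k)) / N (i k) * (2 / 3)" by metis
  define x where "x = rec_nat 0 (\<lambda>k y. g y k)"
  have x_Suc: "x (Suc k) = g (x k) k" for k by (simp add: x_def)
  have xX: "x k \<in> X" for k by (induction k) (auto simp: x_Suc g, simp add: x_def)
  have step: "nrm (x (Suc k) - x k) \<le> (1 / 3) ^ k" for k unfolding x_Suc using g xX by blast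
  obtain l where l: "l \<in> X" "(\<lambda>n. nrm (x n - l)) \<longlonglongrightarrow> 0"
    using complete_summable[of x, OF xX step] summable_geometric[of "1 / 3 :: real"] by auto
  have tail: "nrm (x (k + j) - x k) \<le> 3 / 2 * (1 / 3) ^ k * (1 - (1 / 3) ^ j)" for k j
  proof (induction j)
    case (Suc j)
    have "nrm (x (k + Suc j) - x k) \<le> (1 / 3) ^ (k + j) + nrm (x (k + j) - x k)"
      using nrm_diff_triangle[of "x (k + Suc j)" "x (k + j)" "x k"] step[of "k + j"] xX by simp
    then show ?case using Suc by (simp add: power_add algebra_simps)
  qed simp
  have lim: "nrm (x k - l) \<le> 3 / 2 * (1 / 3) ^ k" for k
  proof (rule field_le_epsilon)
    fix e :: real assume "0 < e"
    obtain M where M: "\<And>n. n \<ge> M \<Longrightarrow> nrm (x n - l) < e"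
      using LIMSEQ_D[OF l(2) \<open>0 < e\<close>] xX l(1) by auto
    have le: "3 / 2 * (1 / 3) ^ k * (1 - (1 / 3) ^ M) \<le> 3 / 2 * (1 / 3 :: real) ^ k * 1"
      by (intro mult_left_mono) auto
    have "nrm (x k - x (k + M)) \<le> 3 / 2 * (1 / 3) ^ k"
      using order_trans[OF tail le] nrm_commute[of "x k" "x (k + M)"] xX by simp
    moreover have "nrm (x (k + M) - l) < e" using M by simp
    ultimately show "nrm (x k - l) \<le> 3 / 2 * (1 / 3) ^ k + e"
      using nrm_diff_triangle[of "x k" "x (k + M)" l] xX l(1) by force
  qed
  obtain C where C: "\<And>n. nrm (P n l) \<le> C" using pointwise[OF l(1)] by blast
  \<comment> \<open>Move \<open>k\<close> secures a norm of \<open>3/4 * 3^-k * N (i k)\<close>,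
    while the later moves have total length at most \<open>3/2 * 3^-(k+1) = 1/2 * 3^-k\<close>. At
    the limit \<open>1/4 * 3^-k * N (i k)\<close> survives, which is unbounded because
    \<open>N (i k) > 4^k\<close>.\<close>
  have "(1 / 4) * (4 / 3) ^ k \<le> C" for k
  proof -
    let ?n = "i k" and ?x = "x (Suc k)" and ?r = "(1 / 3 :: real) ^ k"
    have "nrm (P ?n (1 *\<^sub>R ?x + (- 1) *\<^sub>R l) - (1 *\<^sub>R P ?n ?x + (- 1) *\<^sub>R P ?n l)) = 0"
      by (rule lin) (use xX l in auto)
    then have "nrm (P ?n ?x - P ?n l) = nrm (P ?n (?x - l))"
      using nrm_eq_of_null_diff[of "P ?n (?x - l)" "P ?n ?x - P ?n l"] PX xX l(1) by simp
    also have "\<dots> \<le> N ?n * (1 / 2 * ?r)"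
      using N_bound[of "?x - l" ?n] mult_left_mono[OF lim[of "Suc k"] N_nonneg[of ?n]] xX l(1)
      by simp
    finally have 1: "nrm (P ?n ?x) \<le> C + N ?n * (1 / 2 * ?r)"
      using nrm_triangle_sub[of "P ?n ?x" "P ?n l"] PX xX l(1) C[of ?n] by simp
    have "1 / 2 * ?r < nrm (P ?n ?x) / N ?n * (2 / 3)" using g[OF xX, of k k] by (simp add: x_Suc)
    then have "3 / 4 * ?r * N ?n < nrm (P ?n ?x)" using i0[of k] by (simp add: field_simps)
    then have "1 / 4 * (?r * N ?n) \<le> C" using 1 by (simp add: algebra_simps)
    moreover have "?r * 4 ^ k \<le> ?r * N ?n" using i[of k] by (intro mult_left_mono) auto
    moreover have "?r * 4 ^ k = (4 / 3) ^ k" by (simp add: power_divide)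
    ultimately show ?thesis by simp
  qed
  then have "(4 / 3 :: real) ^ k \<le> 4 * C" for k by (simp add: mult.commute)
  moreover obtain k where "4 * C < (4 / 3 :: real) ^ k"
    using real_arch_pow[of "4 / 3" "4 * C"] by auto
  ultimately show False by (simp add: linorder_not_le[symmetric])
qed

lemma has_real_derivative_ip:
  assumes a: "((\<lambda>s. nrm ((1 / (s - t)) *\<^sub>R (a s - a t) - a')) \<longlongrightarrow> 0) (at t within I)"
    and b: "((\<lambda>s. nrm ((1 / (s - t)) *\<^sub>R (b s - b t) - b')) \<longlongrightarrow> 0) (at t within I)"
    and cont: "((\<lambda>s. nrm (b s - b t)) \<longlongrightarrow> 0) (at t within I)"
    and X: "\<And>s. s \<in> I \<Longrightarrow> a s \<in> X" "\<And>s. s \<in> I \<Longrightarrow> b s \<in> X" "a' \<in> X" "b' \<in> X" and t: "t \<in> I"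
  shows "((\<lambda>s. ip (a s) (b s)) has_real_derivative ip a' (b t) + ip (a t) b') (at t within I)"
proof -
  have I: "eventually (\<lambda>s. s \<in> I) (at t within I)" by (simp add: eventually_at_filter)
  have "((\<lambda>s. ip ((1 / (s - t)) *\<^sub>R (a s - a t)) (b s) + ip (a t) ((1 / (s - t)) *\<^sub>R (b s - b t)))
      \<longlongrightarrow> ip a' (b t) + ip (a t) b') (at t within I)"
    by (intro tendsto_add tendsto_ip a b cont) (use I X t in \<open>auto elim!: eventually_mono\<close>)
  moreover have "eventually (\<lambda>s. ip ((1 / (s - t)) *\<^sub>R (a s - a t)) (b s)
      + ip (a t) ((1 / (s - t)) *\<^sub>R (b s - b t))
      = (ip (a s) (b s) - ip (a t) (b t)) / (s - t)) (at t within I)"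
    using I by eventually_elim (use X t in \<open>simp add: ip_linear field_simps diff_divide_distrib\<close>)
  ultimately show ?thesis
    unfolding has_field_derivative_iff by (rule Lim_transform_eventually)
qed

end

locale semi_hilbert_semigroup = semi_hilbert +
  fixes T :: "real \<Rightarrow> 'a \<Rightarrow> 'a"
  assumes T_X [simp]: "0 \<le> t \<Longrightarrow> u \<in> X \<Longrightarrow> T t u \<in> X"
    and T_linear: "0 \<le> t \<Longrightarrow> u \<in> X \<Longrightarrow> v \<in> X \<Longrightarrow>
      nrm (T t (a *\<^sub>R u + b *\<^sub>R v) - (a *\<^sub>R T t u + b *\<^sub>R T t v)) = 0"
    and T_bounded: "0 \<le> t \<Longrightarrow> \<exists>C. \<forall>u\<in>X. nrm (T t u) \<le> C * nrm u"
    and T_zero: "u \<in> X \<Longrightarrow> nrm (T 0 u - u) = 0"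
    and T_add: "0 \<le> s \<Longrightarrow> 0 \<le> t \<Longrightarrow> u \<in> X \<Longrightarrow> nrm (T (s + t) u - T s (T t u)) = 0"
    and T_continuous: "u \<in> X \<Longrightarrow> ((\<lambda>t. nrm (T t u - u)) \<longlongrightarrow> 0) (at_right 0)"
begin

definition gen :: "('a \<times> 'a) set" where
  "gen = {(u, v). u \<in> X \<and> v \<in> X \<and>
     ((\<lambda>t. nrm ((1 / t) *\<^sub>R (T t u - u) - v)) \<longlongrightarrow> 0) (at_right 0)}"

section \<open>Local bounds, continuity and differentiability of orbits\<close>

lemma T_continuous0:
  assumes "u \<in> X" shows "((\<lambda>t. nrm (T t u - u)) \<longlongrightarrow> 0) (at 0 within {0..})"
  using T_continuous[OF assms] by (simp add: at_within_Ici_at_right)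

text \<open>Linearity in the shape of a difference quotient minus its expected limit, as
  \<open>quotient_bound\<close> uses it.\<close>

lemma T_linear3:
  assumes "0 \<le> t" "x \<in> X" "y \<in> X" "z \<in> X"
  shows "nrm (T t (c *\<^sub>R (x - y) - z) - (c *\<^sub>R (T t x - T t y) - T t z)) = 0"
proof -
  have 1: "nrm (T t (1 *\<^sub>R (c *\<^sub>R x + (- c) *\<^sub>R y) + (- 1) *\<^sub>R z)
      - (1 *\<^sub>R T t (c *\<^sub>R x + (- c) *\<^sub>R y) + (- 1) *\<^sub>R T t z)) = 0"
    by (rule T_linear) (use assms in auto)
  have 2: "nrm (T t (c *\<^sub>R x + (- c) *\<^sub>R y) - (c *\<^sub>R T t x + (- c) *\<^sub>R T t y)) = 0"
    by (rule T_linear) (use assms in auto)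
  have "nrm (T t (c *\<^sub>R (x - y) - z) - (c *\<^sub>R (T t x - T t y) - T t z)) \<le> 0"
    using nrm_triangle[of "T t (c *\<^sub>R (x - y) - z) - (T t (c *\<^sub>R (x - y)) - T t z)"
        "T t (c *\<^sub>R (x - y)) - c *\<^sub>R (T t x - T t y)"] 1 2 assms
    by (simp add: algebra_simps)
  then show ?thesis using assms by (intro antisym nrm_nonneg) simp_all
qed

lemma T_diff:
  assumes "0 \<le> t" "x \<in> X" "y \<in> X" shows "nrm (T t x - T t y) = nrm (T t (x - y))"
  using nrm_eq_of_null_diff[of "T t (x - y)" "T t x - T t y"] T_linear[OF assms, of 1 "-1"] assms
  by simp

text \<open>\<open>T_bounded\<close> treats every \<open>t\<close> separately. If no common bound
  held near 0, there would be times tending to 0 along which the operator norms are unbounded,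
  whereas every single orbit converges along them; this contradicts uniform boundedness.\<close>

lemma T_locally_bounded: "\<exists>d>0. \<exists>K. \<forall>t\<in>{0..d}. \<forall>u\<in>X. nrm (T t u) \<le> K * nrm u"
proof (rule ccontr)
  assume "\<not> ?thesis"
  then have "\<exists>t\<in>{0..1 / real (Suc n)}. \<exists>u\<in>X. n * nrm u < nrm (T t u)" for n
    by (meson linorder_not_less of_nat_0_less_iff zero_less_Suc zero_less_divide_1_iff)
  then obtain t :: "nat \<Rightarrow> real" and u :: "nat \<Rightarrow> 'a" where t: "\<And>n. t n \<in> {0..1 / real (Suc n)}"
    and u: "\<And>n. u n \<in> X \<and> real n * nrm (u n) < nrm (T (t n) (u n))" by metis
  have t_lim: "t \<longlonglongrightarrow> 0"
    by (rule tendsto_sandwich[OF _ _ tendsto_const LIMSEQ_inverse_real_of_nat])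
      (use t in \<open>auto simp: inverse_eq_divide\<close>)
  have "\<exists>K. \<forall>n. \<forall>u\<in>X. nrm (T (t n) u) \<le> K * nrm u"
  proof (rule uniform_boundedness)
    fix x assume x: "x \<in> X"
    \<comment> \<open>Some \<open>t n\<close> may be 0, so the limit is taken within
      \<open>{0..}\<close> and the value at 0 is supplied by \<open>T_zero\<close>.\<close>
    have "((\<lambda>s. nrm (T s x - x)) \<longlongrightarrow> nrm (T 0 x - x)) (at 0 within {0..})"
      using T_continuous0[OF x] T_zero[OF x] by simp
    then have "continuous (at 0 within {0..}) (\<lambda>s. nrm (T s x - x))"
      by (simp add: continuous_within)
    then have "(\<lambda>n. nrm (T (t n) x - x)) \<longlonglongrightarrow> nrm (T 0 x - x)"
      by (rule continuous_within_tendsto_compose[OF _ _ t_lim]) (use t in auto)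
    then have "(\<lambda>n. nrm (T (t n) x)) \<longlonglongrightarrow> nrm x"
      by (intro tendsto_nrm) (use T_zero[OF x] t x in auto)
    then have "Bseq (\<lambda>n. nrm (T (t n) x))" by (intro convergent_imp_Bseq convergentI)
    then obtain C where C: "\<And>n. norm (nrm (T (t n) x)) \<le> C" by (auto simp: Bseq_def)
    have "nrm (T (t n) x) \<le> C" for n using C[of n] by simp
    then show "\<exists>C. \<forall>n. nrm (T (t n) x) \<le> C" by blast
  next
    show "T (t n) x \<in> X" if "x \<in> X" for n x using t that by simp
    show "nrm (T (t n) (a *\<^sub>R x + b *\<^sub>R y) - (a *\<^sub>R T (t n) x + b *\<^sub>R T (t n) y)) = 0"
      if "x \<in> X" "y \<in> X" for n x y a b by (rule T_linear) (use t that in auto)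
    show "\<exists>C. \<forall>u\<in>X. nrm (T (t n) u) \<le> C * nrm u" for n
      by (rule T_bounded) (use t in auto)
  qed
  then obtain K where K: "\<And>n v. v \<in> X \<Longrightarrow> nrm (T (t n) v) \<le> K * nrm v" by blast
  obtain n where "K \<le> real n" using real_arch_simple by blast
  then have "K * nrm (u n) \<le> n * nrm (u n)" using u by (intro mult_right_mono) auto
  then show False using u[of n] K[of "u n" n] by simp
qed

lemma T_bounded_on: "\<exists>K\<ge>0. \<forall>t\<in>{0..b}. \<forall>u\<in>X. nrm (T t u) \<le> K * nrm u"
proof -
  obtain d K where d: "0 < d" and K: "\<And>t u. t \<in> {0..d} \<Longrightarrow> u \<in> X \<Longrightarrow> nrm (T t u) \<le> K * nrm u"
    using T_locally_bounded by blast
  \<comment> \<open>At least 1, so that the power belonging to a longer interval also serves the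
    shorter ones.\<close>
  define K' where "K' = max 1 K"
  have K': "nrm (T t u) \<le> K' * nrm u" if "t \<in> {0..d}" "u \<in> X" for t u
    using K[OF that] mult_right_mono[of K K' "nrm u"] that by (simp add: K'_def)
  have "\<forall>t\<in>{0..Suc n * d}. \<forall>u\<in>X. nrm (T t u) \<le> K' ^ Suc n * nrm u" for n
  proof (induction n)
    case (Suc n)
    show ?case
    proof (intro ballI)
      fix t u assume t: "t \<in> {0..Suc (Suc n) * d}" and u: "u \<in> X"
      show "nrm (T t u) \<le> K' ^ Suc (Suc n) * nrm u"
      proof (cases "t \<le> d")
        case True
        have "1 \<le> K' ^ Suc n" by (rule one_le_power) (simp add: K'_def)
        then have "K' * nrm u * 1 \<le> K' * nrm u * K' ^ Suc n"
          using u by (intro mult_left_mono) (auto simp: K'_def)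
        then show ?thesis using K'[of t u] True t u by (simp add: algebra_simps)
      next
        case False
        then have t': "t - d \<in> {0..Suc n * d}" using t by (simp add: algebra_simps)
        have "nrm (T t u) = nrm (T d (T (t - d) u))"
          using nrm_eq_of_null_diff[of "T t u" "T d (T (t - d) u)"] T_add[of d "t - d" u] t t' u d
          by simp
        also have "\<dots> \<le> K' * nrm (T (t - d) u)" using K' d t' u by simp
        also have "\<dots> \<le> K' * (K' ^ Suc n * nrm u)"
          using Suc t' u by (intro mult_left_mono) (auto simp: K'_def)
        finally show ?thesis by simp
      qed
    qed
  qed (use K' in simp)
  moreover obtain n where "b \<le> real n * d"
    using d real_arch_simple[of "b / d"] by (auto simp: field_simps)
  moreover have "real n * d \<le> Suc n * d" using d by simp
  moreover have "0 \<le> K' ^ Suc n" by (simp add: K'_def)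
  ultimately show ?thesis
    by (intro exI[of _ "K' ^ Suc n"] conjI ballI) (metis atLeastAtMost_iff order_trans)+
qed

text \<open>Both one-sided cases are expanded around the smaller of the two times, so that a single
  limit at 0 from the right serves for \<open>s < t\<close> and \<open>t < s\<close>.\<close>

lemma abs_diff_at_right:
  "filterlim (\<lambda>s. \<bar>s - t\<bar>) (at_right 0) (at t within {0..})" for t :: real
  by (rule tendsto_imp_filterlim_at_right)
    (auto intro!: tendsto_eq_intros simp: eventually_at_filter)

lemma T_orbit_continuous:
  assumes t: "0 \<le> t" and u: "u \<in> X"
  shows "((\<lambda>s. nrm (T s u - T t u)) \<longlongrightarrow> 0) (at t within {0..})"
proof -
  obtain K where K: "0 \<le> K" "\<And>s u. s \<in> {0..t + 1} \<Longrightarrow> u \<in> X \<Longrightarrow> nrm (T s u) \<le> K * nrm u"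
    using T_bounded_on[of "t + 1"] by blast
  have near: "nrm (T (m + r) u - T m u) \<le> K * nrm (T r u - u)" if "0 \<le> m" "m \<le> t + 1" "0 \<le> r" for m r
  proof -
    have "nrm (T (m + r) u - T m u) \<le> nrm (T m (T r u) - T m u)"
      using nrm_diff_triangle[of "T (m + r) u" "T m (T r u)" "T m u"] T_add[of m r u] that u by simp
    also have "\<dots> \<le> K * nrm (T r u - u)" using T_diff[of m "T r u" u] K(2) that u by simp
    finally show ?thesis .
  qed
  have lim: "((\<lambda>s. K * nrm (T \<bar>s - t\<bar> u - u)) \<longlongrightarrow> 0) (at t within {0..})"
    using tendsto_mult_left[OF filterlim_compose[OF T_continuous[OF u] abs_diff_at_right], of K t]
    by simp
  have "eventually (\<lambda>s. s < t + 1 \<and> 0 \<le> s) (at t within {0..})"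
    by (intro eventually_conj order_tendstoD(2)[OF tendsto_ident_at]) (auto simp: eventually_at_filter)
  then have "eventually (\<lambda>s. norm (nrm (T s u - T t u)) \<le> K * nrm (T \<bar>s - t\<bar> u - u)) (at t within {0..})"
  proof eventually_elim
    case (elim s)
    show ?case
    proof (cases "t \<le> s")
      case True
      then show ?thesis using near[of t "s - t"] t u by simp
    next
      case False
      then show ?thesis using near[of s "t - s"] nrm_commute[of "T s u" "T t u"] elim t u by simp
    qed
  qed
  from this lim show ?thesis by (rule Lim_null_comparison)
qed

text \<open>Up to null vectors the operator \<open>T m\<close> factors out of the difference
  quotient at \<open>m\<close> and leaves the one at 0.\<close>

lemma quotient_bound:
  assumes "0 \<le> m" "0 < r" "u \<in> X" "v \<in> X" and K: "\<And>w. w \<in> X \<Longrightarrow> nrm (T m w) \<le> K * nrm w"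
  shows "nrm ((1 / r) *\<^sub>R (T (m + r) u - T m u) - T m v) \<le> K * nrm ((1 / r) *\<^sub>R (T r u - u) - v)"
proof -
  let ?x = "(1 / r) *\<^sub>R (T (m + r) u - T m u) - T m v"
    and ?y = "(1 / r) *\<^sub>R (T m (T r u) - T m u) - T m v"
    and ?z = "(1 / r) *\<^sub>R (T r u - u) - v"
  have "?x - ?y = (1 / r) *\<^sub>R (T (m + r) u - T m (T r u))" by (simp add: algebra_simps)
  then have "nrm (?x - ?y) = 0"
    using T_add[of m r u] assms nrm_scale[of "T (m + r) u - T m (T r u)" "1 / r"] by simp
  then have "nrm ?x = nrm ?y" by (intro nrm_eq_of_null_diff) (use assms in auto)
  also have "\<dots> = nrm (T m ?z)"
    using nrm_eq_of_null_diff[of "T m ?z" ?y] T_linear3[of m "T r u" u v "1 / r"] assms by simp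
  also have "\<dots> \<le> K * nrm ?z" by (rule K) (use assms in auto)
  finally show ?thesis .
qed

lemma T_orbit_derivative:
  assumes t: "0 \<le> t" and uv: "(u, v) \<in> gen"
  shows "((\<lambda>s. nrm ((1 / (s - t)) *\<^sub>R (T s u - T t u) - T t v)) \<longlongrightarrow> 0) (at t within {0..})"
proof -
  have X: "u \<in> X" "v \<in> X" using uv by (auto simp: gen_def)
  obtain K where K: "0 \<le> K" "\<And>s u. s \<in> {0..t + 1} \<Longrightarrow> u \<in> X \<Longrightarrow> nrm (T s u) \<le> K * nrm u"
    using T_bounded_on[of "t + 1"] by blast
  let ?b = "\<lambda>s. K * nrm ((1 / \<bar>s - t\<bar>) *\<^sub>R (T \<bar>s - t\<bar> u - u) - v) + nrm (T s v - T t v)"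
  have "((\<lambda>r. nrm ((1 / r) *\<^sub>R (T r u - u) - v)) \<longlongrightarrow> 0) (at_right 0)" using uv by (simp add: gen_def)
  from filterlim_compose[OF this abs_diff_at_right[of t]]
  have lim: "(?b \<longlongrightarrow> 0) (at t within {0..})"
    using tendsto_add[OF tendsto_mult_left[of _ 0 _ K] T_orbit_continuous[OF t X(2)]] by simp
  have "eventually (\<lambda>s. s < t + 1 \<and> 0 \<le> s \<and> s \<noteq> t) (at t within {0..})"
    by (intro eventually_conj order_tendstoD(2)[OF tendsto_ident_at]) (auto simp: eventually_at_filter)
  then have "eventually (\<lambda>s. norm (nrm ((1 / (s - t)) *\<^sub>R (T s u - T t u) - T t v)) \<le> ?b s) (at t within {0..})"
  proof eventually_elim
    case (elim s)
    have "nrm ((1 / (s - t)) *\<^sub>R (T s u - T t u) - T t v) \<le> ?b s"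
    proof (cases "t < s")
      case True
      then have "nrm ((1 / (s - t)) *\<^sub>R (T s u - T t u) - T t v)
          \<le> K * nrm ((1 / (s - t)) *\<^sub>R (T (s - t) u - u) - v)"
        using quotient_bound[of t "s - t" u v K] K(2) t X by simp
      moreover have "0 \<le> nrm (T s v - T t v)" using elim t X by simp
      ultimately show ?thesis using True by simp
    next
      case False
      \<comment> \<open>To the left of \<open>t\<close> the quotient is based at \<open>s\<close>
        and therefore approximates \<open>T s v\<close>; the second summand of \<open>?b\<close>
        pays for replacing it by \<open>T t v\<close>.\<close>
      then have st: "s < t" using elim by simp
      have "(1 / (s - t)) *\<^sub>R (T s u - T t u) = (1 / (t - s)) *\<^sub>R (T t u - T s u)"
      proof -
        have "1 / (s - t) = - (1 / (t - s))" by (metis minus_diff_eq minus_divide_right)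
        moreover have "T s u - T t u = - (T t u - T s u)" by simp
        ultimately show ?thesis by (simp only: scaleR_minus_left scaleR_minus_right minus_minus)
      qed
      moreover have "nrm ((1 / (t - s)) *\<^sub>R (T t u - T s u) - T s v)
          \<le> K * nrm ((1 / (t - s)) *\<^sub>R (T (t - s) u - u) - v)"
        using quotient_bound[of s "t - s" u v K] K(2) elim st X by simp
      ultimately show ?thesis
        using nrm_diff_triangle[of "(1 / (t - s)) *\<^sub>R (T t u - T s u)" "T s v" "T t v"] st t elim X
        by simp
    qed
    then show ?case using X t elim by simp
  qed
  from this lim show ?thesis by (rule Lim_null_comparison)
qed

lemma gen_invariant:
  assumes t: "0 \<le> t" and uv: "(u, v) \<in> gen" shows "(T t u, T t v) \<in> gen"
proof -
  have X: "u \<in> X" "v \<in> X" using uv by (auto simp: gen_def)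
  obtain K where K: "\<And>u. u \<in> X \<Longrightarrow> nrm (T t u) \<le> K * nrm u" using T_bounded[OF t] by blast
  have lim: "((\<lambda>r. K * nrm ((1 / r) *\<^sub>R (T r u - u) - v)) \<longlongrightarrow> 0) (at_right 0)"
    using uv by (auto simp: gen_def intro: tendsto_mult_right_zero)
  have "eventually (\<lambda>r. norm (nrm ((1 / r) *\<^sub>R (T r (T t u) - T t u) - T t v))
      \<le> K * nrm ((1 / r) *\<^sub>R (T r u - u) - v)) (at_right 0)"
    using eventually_at_right_less[of 0]
  proof eventually_elim
    case (elim r)
    let ?x = "(1 / r) *\<^sub>R (T r (T t u) - T t u) - T t v"
      and ?y = "(1 / r) *\<^sub>R (T (t + r) u - T t u) - T t v"
    have "?y - ?x = (1 / r) *\<^sub>R (T (t + r) u - T r (T t u))" by (simp add: algebra_simps)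
    then have "nrm (?y - ?x) = 0"
      using T_add[of r t u] elim t X nrm_scale[of "T (t + r) u - T r (T t u)" "1 / r"]
      by (simp add: add.commute)
    then have "nrm ?y = nrm ?x" by (intro nrm_eq_of_null_diff) (use elim t X in auto)
    then show ?case using quotient_bound[OF t elim X K] elim t X by simp
  qed
  from Lim_null_comparison[OF this lim] show ?thesis using t X by (simp add: gen_def)
qed

text \<open>For \<open>u\<close> and \<open>w\<close> in the domain of the generator, the derivative
  of \<open>s \<mapsto> ip (T (t - s) u) (T s w)\<close> consists of two terms that cancel by
  symmetry. The values at \<open>s = 0\<close> and \<open>s = t\<close> are the two sides of the
  claim; density and the boundedness of \<open>T t\<close> give the general case.\<close>

lemma T_symmetric:
  assumes dense: "\<And>u e. u \<in> X \<Longrightarrow> 0 < e \<Longrightarrow> \<exists>(u', v)\<in>gen. nrm (u - u') < e"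
    and sym: "\<And>u v u' v'. (u, v) \<in> gen \<Longrightarrow> (u', v') \<in> gen \<Longrightarrow> ip v u' = ip u v'"
    and t: "0 \<le> t" and X: "u \<in> X" "w \<in> X"
  shows "ip (T t u) w = ip u (T t w)"
proof -
  have gen: "ip (T t u) w = ip u (T t w)" if uv: "(u, v) \<in> gen" and wy: "(w, y) \<in> gen" for u v w y
  proof -
    have X: "u \<in> X" "v \<in> X" "w \<in> X" "y \<in> X" using uv wy by (auto simp: gen_def)
    have "((\<lambda>s. ip (T (t - s) u) (T s w)) has_real_derivative 0) (at s within {0..t})"
      if s: "s \<in> {0..t}" for s
    proof -
      have refl: "filterlim (\<lambda>r. t - r) (at (t - s) within {0..}) (at s within {0..t})"
        unfolding filterlim_at
        by (auto simp: eventually_at_filter intro!: tendsto_eq_intros)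
      have sub: "at s within {0..t} \<le> at s within {0..}" by (rule at_le) auto
      have "((\<lambda>r. nrm ((1 / (r - s)) *\<^sub>R (T (t - r) u - T (t - s) u) - (- T (t - s) v))) \<longlongrightarrow> 0)
          (at s within {0..t})"
      proof (rule Lim_transform_eventually[OF
            filterlim_compose[OF T_orbit_derivative[OF _ uv, of "t - s"] refl]])
        have "nrm ((1 / (t - r - (t - s))) *\<^sub>R (T (t - r) u - T (t - s) u) - T (t - s) v)
          = nrm ((1 / (r - s)) *\<^sub>R (T (t - r) u - T (t - s) u) - (- T (t - s) v))"
          if "r \<in> {0..t}" for r
        proof -
          have "1 / (t - r - (t - s)) = - (1 / (r - s))"
            by (simp add: minus_divide_right)
          then have "(1 / (t - r - (t - s))) *\<^sub>R (T (t - r) u - T (t - s) u) - T (t - s) v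
            = - ((1 / (r - s)) *\<^sub>R (T (t - r) u - T (t - s) u) - (- T (t - s) v))"
            by simp
          then show ?thesis
            using nrm_minus[of "(1 / (r - s)) *\<^sub>R (T (t - r) u - T (t - s) u) - (- T (t - s) v)"]
              that s X by simp
        qed
        then show "\<forall>\<^sub>F r in at s within {0..t}.
            nrm ((1 / (t - r - (t - s))) *\<^sub>R (T (t - r) u - T (t - s) u) - T (t - s) v)
            = nrm ((1 / (r - s)) *\<^sub>R (T (t - r) u - T (t - s) u) - (- T (t - s) v))"
          by (simp add: eventually_at_filter)
      qed (use s in auto)
      moreover have "((\<lambda>r. nrm ((1 / (r - s)) *\<^sub>R (T r w - T s w) - T s y)) \<longlongrightarrow> 0) (at s within {0..t})"
        using tendsto_mono[OF sub T_orbit_derivative[OF _ wy]] s by simp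
      moreover have "((\<lambda>r. nrm (T r w - T s w)) \<longlongrightarrow> 0) (at s within {0..t})"
        using tendsto_mono[OF sub T_orbit_continuous[OF _ X(3)]] s by simp
      ultimately have "((\<lambda>r. ip (T (t - r) u) (T r w)) has_real_derivative
          ip (- T (t - s) v) (T s w) + ip (T (t - s) u) (T s y)) (at s within {0..t})"
        by (rule has_real_derivative_ip) (use s X in auto)
      moreover have "ip (T (t - s) v) (T s w) = ip (T (t - s) u) (T s y)"
        by (rule sym) (use gen_invariant uv wy s in auto)
      ultimately show ?thesis using s X by (simp add: ip_linear)
    qed
    then have "\<exists>c. \<forall>s\<in>{0..t}. ip (T (t - s) u) (T s w) = c"
      by (intro has_field_derivative_zero_constant) auto
    then obtain c where "\<And>s. s \<in> {0..t} \<Longrightarrow> ip (T (t - s) u) (T s w) = c" by blast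
    from this[of 0] this[of t] have "ip (T t u) (T 0 w) = ip (T 0 u) (T t w)" using t by simp
    moreover have "ip (T t u) (T 0 w) = ip (T t u) w"
      using ip_null_left[of "T 0 w" w "T t u"] T_zero[of w] X t by (simp add: ip_sym)
    moreover have "ip (T 0 u) (T t w) = ip u (T t w)"
      using ip_null_left[of "T 0 u" u "T t w"] T_zero[of u] X t by simp
    ultimately show ?thesis by simp
  qed
  obtain K where K: "\<And>u. u \<in> X \<Longrightarrow> nrm (T t u) \<le> K * nrm u" using T_bounded[OF t] by blast
  have seq: "\<exists>a. (\<forall>n. a n \<in> X \<and> (\<exists>v. (a n, v) \<in> gen)) \<and> (\<lambda>n. nrm (a n - x)) \<longlonglongrightarrow> 0" if x: "x \<in> X" for x
  proof -
    have "\<exists>y. (\<exists>v. (y, v) \<in> gen) \<and> nrm (x - y) < 1 / real (Suc n)" for n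
      using dense[OF x, of "1 / real (Suc n)"] by auto
    then obtain a where a: "\<And>n. (\<exists>v. (a n, v) \<in> gen) \<and> nrm (x - a n) < 1 / real (Suc n)" by metis
    then have aX: "a n \<in> X" for n unfolding gen_def by blast
    have "(\<lambda>n. nrm (a n - x)) \<longlonglongrightarrow> 0"
      by (rule tendsto_sandwich[OF _ _ tendsto_const LIMSEQ_inverse_real_of_nat])
        (use a aX x nrm_commute[of x] in \<open>auto simp: inverse_eq_divide less_imp_le\<close>)
    then show ?thesis using a aX by blast
  qed
  have T_lim: "(\<lambda>n. nrm (T t (a n) - T t x)) \<longlonglongrightarrow> 0"
    if a: "\<And>n. a n \<in> X" "(\<lambda>n. nrm (a n - x)) \<longlonglongrightarrow> 0" and x: "x \<in> X" for a :: "nat \<Rightarrow> 'a" and x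
  proof (rule Lim_null_comparison)
    show "\<forall>\<^sub>F n in sequentially. norm (nrm (T t (a n) - T t x)) \<le> K * nrm (a n - x)"
      using K[of "a _ - x"] T_diff[OF t a(1) x] a(1) x t by simp
    show "(\<lambda>n. K * nrm (a n - x)) \<longlonglongrightarrow> 0" using tendsto_mult_left[OF a(2), of K] by simp
  qed
  obtain a where a: "\<And>n. a n \<in> X" "\<And>n. \<exists>v. (a n, v) \<in> gen" "(\<lambda>n. nrm (a n - u)) \<longlonglongrightarrow> 0"
    using seq[OF X(1)] by blast
  obtain b where b: "\<And>n. b n \<in> X" "\<And>n. \<exists>v. (b n, v) \<in> gen" "(\<lambda>n. nrm (b n - w)) \<longlonglongrightarrow> 0"
    using seq[OF X(2)] by blast
  have 1: "(\<lambda>n. ip (T t (a n)) (b n)) \<longlonglongrightarrow> ip (T t u) w"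
    by (rule tendsto_ip[OF T_lim[OF a(1,3)] b(3)]) (use a b X t in auto)
  have 2: "(\<lambda>n. ip (a n) (T t (b n))) \<longlonglongrightarrow> ip u (T t w)"
    by (rule tendsto_ip[OF a(3) T_lim[OF b(1,3)]]) (use a b X t in auto)
  have "ip (T t (a n)) (b n) = ip (a n) (T t (b n))" for n using gen a(2) b(2) by blast
  then show ?thesis using 1 2 LIMSEQ_unique by simp
qed

lemma gen_diff:
  assumes "(u, v) \<in> gen" "(u', v') \<in> gen" shows "(u - u', v - v') \<in> gen"
proof -
  have X: "u \<in> X" "v \<in> X" "u' \<in> X" "v' \<in> X" using assms by (auto simp: gen_def)
  let ?Q = "\<lambda>u v t. nrm ((1 / t) *\<^sub>R (T t u - u) - v)"
  have lim: "((\<lambda>t. ?Q u v t + ?Q u' v' t) \<longlongrightarrow> 0) (at_right 0)"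
    using tendsto_add[of "?Q u v" 0 _ "?Q u' v'" 0] assms by (simp add: gen_def)
  have "eventually (\<lambda>t. norm (?Q (u - u') (v - v') t) \<le> ?Q u v t + ?Q u' v' t) (at_right 0)"
    using eventually_at_right_less[of 0]
  proof eventually_elim
    case (elim t)
    let ?x = "(1 / t) *\<^sub>R (T t (u - u') - (u - u')) - (v - v')"
      and ?y = "((1 / t) *\<^sub>R (T t u - u) - v) - ((1 / t) *\<^sub>R (T t u' - u') - v')"
    have "?x - ?y = (1 / t) *\<^sub>R (T t (u - u') - (T t u - T t u'))"
      by (simp add: algebra_simps)
    then have "nrm (?x - ?y) = 0"
      using T_linear[of t u u' 1 "-1"] nrm_scale[of "T t (u - u') - (T t u - T t u')" "1 / t"] elim X
      by simp
    then have "nrm ?x = nrm ?y" by (intro nrm_eq_of_null_diff) (use elim X in auto)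
    also have "\<dots> \<le> ?Q u v t + ?Q u' v' t" by (rule nrm_triangle_diff) (use elim X in auto)
    finally show ?case using elim X by simp
  qed
  from Lim_null_comparison[OF this lim] show ?thesis using X by (simp add: gen_def)
qed

text \<open>The inequality \<open>ip (T t u) u \<le> exp (c * t) * ip u u\<close> becomes an
  equality at \<open>t = 0\<close> and is differentiated there.\<close>

lemma gen_upper_bound:
  assumes growth: "\<And>t. 0 < t \<Longrightarrow> nrm (T t u) \<le> exp (c * t) * nrm u" and uw: "(u, w) \<in> gen"
  shows "ip w u \<le> c * ip u u"
proof -
  have X: "u \<in> X" "w \<in> X" using uw by (auto simp: gen_def)
  have "((\<lambda>t. ip ((1 / t) *\<^sub>R (T t u - u)) u) \<longlongrightarrow> ip w u) (at_right 0)"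
    by (rule tendsto_ip)
      (use uw X in \<open>auto simp: gen_def intro!: eventually_mono[OF eventually_at_right_less]\<close>)
  moreover have "((\<lambda>t. (exp (c * t) - 1) / t * ip u u) \<longlongrightarrow> c * ip u u) (at_right 0)"
    by (intro tendsto_mult_right exp_quotient_tendsto)
  moreover have "eventually (\<lambda>t. ip ((1 / t) *\<^sub>R (T t u - u)) u \<le> (exp (c * t) - 1) / t * ip u u) (at_right 0)"
    using eventually_at_right_less[of 0]
  proof eventually_elim
    case (elim t)
    have "ip (T t u) u \<le> nrm (T t u) * nrm u" using Cauchy_Schwarz[of "T t u" u] X elim by simp
    also have "\<dots> \<le> exp (c * t) * nrm u * nrm u"
      using growth[OF elim] X by (intro mult_right_mono) auto
    also have "\<dots> = exp (c * t) * ip u u" using X nrm_sq[of u] by (simp add: power2_eq_square)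
    finally show ?case using X elim by (simp add: ip_linear divide_right_mono left_diff_distrib)
  qed
  ultimately show ?thesis by (intro tendsto_le[OF trivial_limit_at_right_real])
qed

text \<open>The semigroup acts on the test element, hence \<open>u\<close> is arbitrary. Together
  with symmetry this is the weak evolution equation for \<open>T s u\<close>.\<close>

lemma weak_derivative:
  assumes "u \<in> X" "(\<phi>, \<psi>) \<in> gen" "0 \<le> t"
  shows "((\<lambda>s. ip u (T s \<phi>)) has_real_derivative ip u (T t \<psi>)) (at t within {0..})"
proof -
  have X: "\<phi> \<in> X" "\<psi> \<in> X" using assms by (auto simp: gen_def)
  have "((\<lambda>s. ip u (T s \<phi>)) has_real_derivative ip 0 (T t \<phi>) + ip u (T t \<psi>)) (at t within {0..})"
    by (rule has_real_derivative_ip[OF _ T_orbit_derivative T_orbit_continuous])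
      (use assms X in auto)
  then show ?thesis using ip_diff_left[of 0 0 "T t \<phi>"] assms X by simp
qed

lemma weak_continuous:
  assumes "u \<in> X" "w \<in> X" shows "continuous_on {0..} (\<lambda>s. ip u (T s w))"
  unfolding continuous_on_def
proof
  fix t :: real assume t: "t \<in> {0..}"
  show "((\<lambda>s. ip u (T s w)) \<longlongrightarrow> ip u (T t w)) (at t within {0..})"
    by (rule tendsto_ip[OF _ T_orbit_continuous])
      (use t assms in \<open>auto simp: eventually_at_filter\<close>)
qed

text \<open>The uniqueness argument identifies two semigroups only modulo null vectors; for their
  generators this gives true equality.\<close>

lemma gen_cong:
  assumes T': "semi_hilbert_semigroup X ip T'"
    and null: "\<And>t u. 0 \<le> t \<Longrightarrow> u \<in> X \<Longrightarrow> nrm (T t u - T' t u) = 0"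
  shows "gen = semi_hilbert_semigroup.gen X ip T'"
proof -
  interpret T': semi_hilbert_semigroup X ip T' by (rule T')
  have "((\<lambda>t. nrm ((1 / t) *\<^sub>R (T t u - u) - v)) \<longlongrightarrow> 0) (at_right 0) \<longleftrightarrow>
      ((\<lambda>t. nrm ((1 / t) *\<^sub>R (T' t u - u) - v)) \<longlongrightarrow> 0) (at_right 0)" if X: "u \<in> X" "v \<in> X" for u v
  proof (rule tendsto_cong)
    show "\<forall>\<^sub>F t in at_right 0. nrm ((1 / t) *\<^sub>R (T t u - u) - v) = nrm ((1 / t) *\<^sub>R (T' t u - u) - v)"
      using eventually_at_right_less[of 0]
    proof eventually_elim
      case (elim t)
      let ?x = "(1 / t) *\<^sub>R (T t u - u) - v" and ?y = "(1 / t) *\<^sub>R (T' t u - u) - v"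
      have "?x - ?y = (1 / t) *\<^sub>R (T t u - T' t u)" by (simp add: algebra_simps)
      then have "nrm (?x - ?y) = 0"
        using null[of t u] nrm_scale[of "T t u - T' t u" "1 / t"] elim X by simp
      then show ?case using elim X by (intro nrm_eq_of_null_diff) auto
    qed
  qed
  then show ?thesis unfolding gen_def T'.gen_def by blast
qed

end

section \<open>Semibounded forms and the Friedrichs construction\<close>

text \<open>\<open>q_operator\<close> says that the form comes from an operator; this is what makes
  it closable.\<close>

locale semibounded_form = semi_hilbert +
  fixes D :: "'a set" and q :: "'a \<Rightarrow> 'a \<Rightarrow> real" and c :: real
  assumes subspace_D: "subspace D" and D_subset: "D \<subseteq> X"
    and q_sym: "u \<in> D \<Longrightarrow> v \<in> D \<Longrightarrow> q u v = q v u"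
    and q_add_left: "u \<in> D \<Longrightarrow> v \<in> D \<Longrightarrow> w \<in> D \<Longrightarrow> q (u + v) w = q u w + q v w"
    and q_scale_left: "u \<in> D \<Longrightarrow> v \<in> D \<Longrightarrow> q (a *\<^sub>R u) v = a * q u v"
    and q_bounded: "u \<in> D \<Longrightarrow> q u u \<le> c * ip u u"
    and q_operator: "u \<in> D \<Longrightarrow> \<exists>w\<in>X. \<forall>v\<in>D. q u v = ip w v"
begin

lemma D_X [simp]: "u \<in> D \<Longrightarrow> u \<in> X" using D_subset by auto

text \<open>The shift is \<open>c + 1\<close> and not \<open>c\<close>, so that
  \<open>fip u u\<close> dominates \<open>ip u u\<close> and the form norm controls the ambient
  one.\<close>

definition fip :: "'a \<Rightarrow> 'a \<Rightarrow> real" where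
  "fip u v = (c + 1) * ip u v - q u v"

sublocale form: semi_inner D fip
proof
  show "subspace D" by (rule subspace_D)
  fix u v w a assume D: "u \<in> D" "v \<in> D" "w \<in> D"
  show "fip u v = fip v u"
    using D by (simp add: fip_def ip_sym q_sym)
  show "fip (u + v) w = fip u w + fip v w"
    using D by (simp add: fip_def ip_linear q_add_left algebra_simps)
  show "fip (a *\<^sub>R u) v = a * fip u v"
    using D by (simp add: fip_def ip_linear q_scale_left algebra_simps)
  show "0 \<le> fip u u"
    using q_bounded[of u] ip_nonneg[of u] D by (simp add: fip_def algebra_simps)
qed

abbreviation "fnrm \<equiv> form.nrm"

lemma fnrm_sq: "u \<in> D \<Longrightarrow> (fnrm u)\<^sup>2 = (c + 1) * (nrm u)\<^sup>2 - q u u"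
  by (simp add: form.nrm_sq nrm_sq fip_def)

lemma nrm_le_fnrm: assumes "u \<in> D" shows "nrm u \<le> fnrm u"
  by (rule power2_le_imp_le)
    (use assms q_bounded[of u] in \<open>auto simp: fnrm_sq nrm_sq algebra_simps\<close>)

lemma q_right:
  "u \<in> D \<Longrightarrow> v \<in> D \<Longrightarrow> w \<in> D \<Longrightarrow> q w (u + v) = q w u + q w v"
  "u \<in> D \<Longrightarrow> w \<in> D \<Longrightarrow> q w (s *\<^sub>R u) = s * q w u"
  by (simp_all add: q_sym[of w] q_add_left q_scale_left)

section \<open>The closure of the form\<close>

definition approx :: "(nat \<Rightarrow> 'a) \<Rightarrow> 'a \<Rightarrow> bool" where
  "approx us u \<longleftrightarrow> (\<forall>n. us n \<in> D) \<and> (\<lambda>n. nrm (us n - u)) \<longlonglongrightarrow> 0 \<and>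
     (\<forall>\<epsilon>>0. \<exists>N. \<forall>m\<ge>N. \<forall>n\<ge>N. \<bar>q (us m - us n) (us m - us n)\<bar> < \<epsilon>)"

lemma fnrm_small:
  assumes "d \<in> D" "0 < e" "nrm d < k" "\<bar>c + 1\<bar> * k\<^sup>2 \<le> e\<^sup>2 / 4" "\<bar>q d d\<bar> < e\<^sup>2 / 2"
  shows "fnrm d < e"
proof (rule power2_less_imp_less)
  have "(nrm d)\<^sup>2 \<le> k\<^sup>2" using assms by (intro power_mono) auto
  then have "\<bar>c + 1\<bar> * (nrm d)\<^sup>2 \<le> \<bar>c + 1\<bar> * k\<^sup>2" by (intro mult_left_mono) auto
  moreover have "(c + 1) * (nrm d)\<^sup>2 \<le> \<bar>c + 1\<bar> * (nrm d)\<^sup>2" by (intro mult_right_mono) auto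
  moreover have "0 < e\<^sup>2" using assms by simp
  ultimately show "(fnrm d)\<^sup>2 < e\<^sup>2" using assms(4,5) unfolding fnrm_sq[OF assms(1)] by linarith
qed (use assms in auto)

lemma q_le_fnrm: assumes "d \<in> D" shows "\<bar>q d d\<bar> \<le> (\<bar>c + 1\<bar> + 1) * (fnrm d)\<^sup>2"
proof -
  have n: "(nrm d)\<^sup>2 \<le> (fnrm d)\<^sup>2" using nrm_le_fnrm assms by (intro power_mono) auto
  have "q d d = (c + 1) * (nrm d)\<^sup>2 - (fnrm d)\<^sup>2" using fnrm_sq assms by simp
  then have "\<bar>q d d\<bar> \<le> \<bar>(c + 1) * (nrm d)\<^sup>2\<bar> + (fnrm d)\<^sup>2"
    using abs_triangle_ineq4[of "(c + 1) * (nrm d)\<^sup>2" "(fnrm d)\<^sup>2"] by simp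
  also have "\<bar>(c + 1) * (nrm d)\<^sup>2\<bar> \<le> \<bar>c + 1\<bar> * (fnrm d)\<^sup>2"
    unfolding abs_mult using n by (intro mult_mono) auto
  finally show ?thesis by (simp add: algebra_simps)
qed

text \<open>At a difference \<open>d\<close>, the values \<open>- q d d\<close> and
  \<open>(fnrm d)^2\<close> differ by \<open>(c + 1) * (nrm d)^2\<close>, which becomes small along
  a sequence that converges for \<open>nrm\<close>. The version with \<open>fnrm\<close> has a
  triangle inequality.\<close>

lemma approx_iff:
  assumes "u \<in> X"
  shows "approx us u \<longleftrightarrow> (\<forall>n. us n \<in> D) \<and> (\<lambda>n. nrm (us n - u)) \<longlonglongrightarrow> 0 \<and>
     (\<forall>\<epsilon>>0. \<exists>N. \<forall>m\<ge>N. \<forall>n\<ge>N. fnrm (us m - us n) < \<epsilon>)"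
proof (intro iffI conjI)
  assume A: "approx us u"
  then have D: "us n \<in> D" for n by (simp add: approx_def)
  then show "\<forall>n. us n \<in> D" by simp
  show lim: "(\<lambda>n. nrm (us n - u)) \<longlonglongrightarrow> 0" using A by (simp add: approx_def)
  show "\<forall>\<epsilon>>0. \<exists>N. \<forall>m\<ge>N. \<forall>n\<ge>N. fnrm (us m - us n) < \<epsilon>"
  proof (intro allI impI)
    fix e :: real assume e: "0 < e"
    obtain \<delta> where \<delta>: "0 < \<delta>" "\<delta> * \<bar>c + 1\<bar> \<le> e\<^sup>2 / 4"
      using small_multiple[of "\<bar>c + 1\<bar>" "e\<^sup>2 / 4"] e by auto
    define k where "k = sqrt \<delta>"
    have k: "0 < k" "\<bar>c + 1\<bar> * k\<^sup>2 \<le> e\<^sup>2 / 4"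
      using \<delta> by (simp_all add: k_def mult.commute)
    obtain N1 where N1: "\<And>n. n \<ge> N1 \<Longrightarrow> nrm (us n - u) < k / 2"
      using LIMSEQ_D[OF lim, of "k / 2"] k D assms by auto
    obtain N2 where N2: "\<And>m n. m \<ge> N2 \<Longrightarrow> n \<ge> N2 \<Longrightarrow> \<bar>q (us m - us n) (us m - us n)\<bar> < e\<^sup>2 / 2"
      using A e unfolding approx_def by (metis half_gt_zero zero_less_power)
    have "fnrm (us m - us n) < e" if "m \<ge> max N1 N2" "n \<ge> max N1 N2" for m n
    proof (rule fnrm_small[OF _ e _ k(2)])
      have "nrm (us m - us n) \<le> nrm (us m - u) + nrm (us n - u)"
        using nrm_diff_triangle[of "us m" u "us n"] nrm_commute[of u "us n"] D assms by simp
      then show "nrm (us m - us n) < k" using N1[of m] N1[of n] that by simp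
    qed (use e D N2 that in auto)
    then show "\<exists>N. \<forall>m\<ge>N. \<forall>n\<ge>N. fnrm (us m - us n) < e" by blast
  qed
next
  assume A: "(\<forall>n. us n \<in> D) \<and> (\<lambda>n. nrm (us n - u)) \<longlonglongrightarrow> 0 \<and>
     (\<forall>\<epsilon>>0. \<exists>N. \<forall>m\<ge>N. \<forall>n\<ge>N. fnrm (us m - us n) < \<epsilon>)"
  then have D: "us n \<in> D" for n by simp
  show "approx us u"
    unfolding approx_def
  proof (intro conjI allI impI)
    fix e :: real assume e: "0 < e"
    define K where "K = \<bar>c + 1\<bar> + 1"
    have K: "0 < K" by (simp add: K_def)
    then have "0 < sqrt (e / K)" using e by simp
    then obtain N where N: "\<And>m n. m \<ge> N \<Longrightarrow> n \<ge> N \<Longrightarrow> fnrm (us m - us n) < sqrt (e / K)"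
      using A by blast
    have "\<bar>q (us m - us n) (us m - us n)\<bar> < e" if "m \<ge> N" "n \<ge> N" for m n
    proof -
      have "(fnrm (us m - us n))\<^sup>2 < (sqrt (e / K))\<^sup>2"
        using N[OF that] D by (intro power_strict_mono) auto
      then have "K * (fnrm (us m - us n))\<^sup>2 < e"
        using e K by (simp add: field_simps)
      then show ?thesis
        using q_le_fnrm[of "us m - us n"] D by (simp add: K_def)
    qed
    then show "\<exists>N. \<forall>m\<ge>N. \<forall>n\<ge>N. \<bar>q (us m - us n) (us m - us n)\<bar> < e" by blast
  qed (use A in auto)
qed

lemma approx_D: "approx us u \<Longrightarrow> us n \<in> D"
  by (simp add: approx_def)

lemma approx_Cauchy:
  "approx us u \<Longrightarrow> u \<in> X \<Longrightarrow> 0 < e \<Longrightarrow> \<exists>N. \<forall>m\<ge>N. \<forall>n\<ge>N. fnrm (us m - us n) < e"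
  by (simp add: approx_iff)

lemma approx_const: "u \<in> D \<Longrightarrow> approx (\<lambda>_. u) u"
  by (simp add: approx_iff)

lemma approx_null:
  assumes "approx us u" "u \<in> X" "u' \<in> X" "nrm (u - u') = 0" shows "approx us u'"
proof -
  have D: "us n \<in> D" for n using approx_D assms by blast
  have "nrm (us n - u') = nrm (us n - u)" for n
    using nrm_eq_of_null_diff[of "us n - u'" "us n - u"] assms D by simp
  then show ?thesis using assms by (simp add: approx_def)
qed

lemma approx_lincomb:
  assumes A: "approx us u" "approx vs v" and X: "u \<in> X" "v \<in> X"
  shows "approx (\<lambda>n. r *\<^sub>R us n + s *\<^sub>R vs n) (r *\<^sub>R u + s *\<^sub>R v)"
proof -
  have D: "us n \<in> D" "vs n \<in> D" for n using approx_D A by auto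
  have lim: "(\<lambda>n. \<bar>r\<bar> * nrm (us n - u) + \<bar>s\<bar> * nrm (vs n - v)) \<longlonglongrightarrow> 0"
    using A by (auto simp: approx_def intro!: tendsto_eq_intros)
  have "norm (nrm (r *\<^sub>R us n + s *\<^sub>R vs n - (r *\<^sub>R u + s *\<^sub>R v)))
      \<le> \<bar>r\<bar> * nrm (us n - u) + \<bar>s\<bar> * nrm (vs n - v)" for n
    using nrm_lincomb[of "us n - u" "vs n - v" r s] D X by (simp add: algebra_simps)
  then have 1: "(\<lambda>n. nrm (r *\<^sub>R us n + s *\<^sub>R vs n - (r *\<^sub>R u + s *\<^sub>R v))) \<longlonglongrightarrow> 0"
    by (intro Lim_null_comparison[OF always_eventually lim]) auto
  have "\<exists>N. \<forall>m\<ge>N. \<forall>n\<ge>N. fnrm (r *\<^sub>R us m + s *\<^sub>R vs m - (r *\<^sub>R us n + s *\<^sub>R vs n)) < e"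
    if e: "0 < e" for e
  proof -
    obtain k where k: "0 < k" "k * (\<bar>r\<bar> + \<bar>s\<bar>) \<le> e / 2"
      using small_multiple[of "\<bar>r\<bar> + \<bar>s\<bar>" "e / 2"] e by auto
    obtain N1 N2 where N: "\<And>m n. m \<ge> N1 \<Longrightarrow> n \<ge> N1 \<Longrightarrow> fnrm (us m - us n) < k"
      "\<And>m n. m \<ge> N2 \<Longrightarrow> n \<ge> N2 \<Longrightarrow> fnrm (vs m - vs n) < k"
      using approx_Cauchy[OF A(1) X(1) k(1)] approx_Cauchy[OF A(2) X(2) k(1)] by blast
    have "fnrm (r *\<^sub>R us m + s *\<^sub>R vs m - (r *\<^sub>R us n + s *\<^sub>R vs n)) < e"
      if "m \<ge> max N1 N2" "n \<ge> max N1 N2" for m n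
    proof -
      have "fnrm (r *\<^sub>R (us m - us n) + s *\<^sub>R (vs m - vs n))
          \<le> \<bar>r\<bar> * fnrm (us m - us n) + \<bar>s\<bar> * fnrm (vs m - vs n)"
        using form.nrm_lincomb D by simp
      also have "\<dots> \<le> \<bar>r\<bar> * k + \<bar>s\<bar> * k"
        using N(1)[of m n] N(2)[of m n] that by (intro add_mono mult_left_mono) auto
      finally show ?thesis using k e by (simp add: algebra_simps)
    qed
    then show ?thesis by blast
  qed
  then show ?thesis using D X 1 by (simp add: approx_iff)
qed

text \<open>This is closability; it holds because \<open>q u\<close> is continuous for \<open>nrm\<close> for every fixed \<open>u \<in> D\<close>.\<close>

lemma approx_zero:
  assumes "approx ds 0" shows "(\<lambda>n. fnrm (ds n)) \<longlonglongrightarrow> 0"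
proof (rule LIMSEQ_I)
  fix e :: real assume e: "0 < e"
  have D: "ds n \<in> D" for n using approx_D assms by blast
  have lim: "(\<lambda>n. nrm (ds n)) \<longlonglongrightarrow> 0" using assms by (simp add: approx_def)
  obtain N where N: "\<And>m n. m \<ge> N \<Longrightarrow> n \<ge> N \<Longrightarrow> fnrm (ds m - ds n) < e / 2"
    using approx_Cauchy[OF assms, of "e / 2"] e by auto
  have "fnrm (ds n) < e" if n: "n \<ge> N" for n
  proof -
    obtain w where w: "w \<in> X" "\<And>v. v \<in> D \<Longrightarrow> q (ds n) v = ip w v"
      using q_operator[OF D] by blast
    let ?y = "(c + 1) *\<^sub>R ds n - w"
    have y: "?y \<in> X" using D w by simp
    \<comment> \<open>Here \<open>n\<close> is fixed and \<open>m\<close> tends to infinity: the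
      term with \<open>?y\<close> vanishes, and \<open>fnrm (ds n)\<close> cancels from what
      remains.\<close>
    have *: "(fnrm (ds n))\<^sup>2 \<le> fnrm (ds n) * (e / 2) + nrm ?y * nrm (ds m)" if m: "m \<ge> N" for m
    proof -
      have "(fnrm (ds n))\<^sup>2 = fip (ds n) (ds n - ds m) + ip ?y (ds m)"
        using D w by (simp add: form.nrm_sq form.ip_diff_right ip_linear fip_def algebra_simps)
      also have "\<dots> \<le> fnrm (ds n) * fnrm (ds n - ds m) + nrm ?y * nrm (ds m)"
        using form.Cauchy_Schwarz[of "ds n" "ds n - ds m"] Cauchy_Schwarz[of ?y "ds m"] D y
        by simp
      also have "\<dots> \<le> fnrm (ds n) * (e / 2) + nrm ?y * nrm (ds m)"
        using N[OF n m] D by (intro add_right_mono mult_left_mono) auto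
      finally show ?thesis .
    qed
    have "(\<lambda>m. fnrm (ds n) * (e / 2) + nrm ?y * nrm (ds m)) \<longlonglongrightarrow> fnrm (ds n) * (e / 2) + nrm ?y * 0"
      by (intro tendsto_intros lim)
    then have "(fnrm (ds n))\<^sup>2 \<le> fnrm (ds n) * (e / 2)"
      using LIMSEQ_le_const * by fastforce
    then have "fnrm (ds n) \<le> e / 2 \<or> fnrm (ds n) = 0"
      using D[of n] by (auto simp: power2_eq_square mult_le_cancel_left less_le)
    then show ?thesis using e by auto
  qed
  then show "\<exists>N. \<forall>n\<ge>N. norm (fnrm (ds n) - 0) < e" using D by auto
qed

lemma approx_bounded:
  assumes "approx us u" "u \<in> X" shows "\<exists>B>0. \<forall>n. fnrm (us n) \<le> B"
proof -
  have D: "us n \<in> D" for n using approx_D assms by blast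
  obtain N where N: "\<And>m n. m \<ge> N \<Longrightarrow> n \<ge> N \<Longrightarrow> fnrm (us m - us n) < 1"
    using approx_Cauchy[OF assms, of 1] by auto
  define B where "B = (\<Sum>i\<le>N. fnrm (us i)) + 1"
  have pos: "0 \<le> (\<Sum>i\<le>N. fnrm (us i))" using D by (intro sum_nonneg) auto
  have le: "fnrm (us i) \<le> (\<Sum>i\<le>N. fnrm (us i))" if "i \<le> N" for i
    using D that by (intro member_le_sum) auto
  have "fnrm (us n) \<le> B" for n
  proof (cases "n \<le> N")
    case True then show ?thesis using le[of n] by (simp add: B_def)
  next
    case False
    then show ?thesis
      using form.nrm_triangle_sub[of "us n" "us N"] N[of n N] le[of N] D by (simp add: B_def)
  qed
  moreover have "0 < B" using pos by (simp add: B_def)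
  ultimately show ?thesis by blast
qed

lemma approx_convergent:
  assumes A: "approx us u" "approx vs v" and X: "u \<in> X" "v \<in> X"
  shows "convergent (\<lambda>n. fip (us n) (vs n))"
  unfolding Cauchy_convergent_iff[symmetric]
proof (rule metric_CauchyI)
  fix e :: real assume e: "0 < e"
  have D: "us n \<in> D" "vs n \<in> D" for n using approx_D A by auto
  obtain B C where BC: "0 < B" "0 < C" "\<And>n. fnrm (us n) \<le> B" "\<And>n. fnrm (vs n) \<le> C"
    using approx_bounded A X by metis
  have pos: "0 < e / (2 * C)" "0 < e / (2 * B)" using e BC by auto
  obtain N1 where N1: "\<And>m n. m \<ge> N1 \<Longrightarrow> n \<ge> N1 \<Longrightarrow> fnrm (us m - us n) < e / (2 * C)"
    using approx_Cauchy[OF A(1) X(1) pos(1)] by blast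
  obtain N2 where N2: "\<And>m n. m \<ge> N2 \<Longrightarrow> n \<ge> N2 \<Longrightarrow> fnrm (vs m - vs n) < e / (2 * B)"
    using approx_Cauchy[OF A(2) X(2) pos(2)] by blast
  have "dist (fip (us m) (vs m)) (fip (us n) (vs n)) < e" if mn: "m \<ge> max N1 N2" "n \<ge> max N1 N2" for m n
  proof -
    have "fip (us m) (vs m) - fip (us n) (vs n) = fip (us m - us n) (vs m) + fip (us n) (vs m - vs n)"
      using D form.ip_diff_left[of "us m" "us n" "vs m"] form.ip_diff_right[of "vs m" "vs n" "us n"]
      by simp
    then have "\<bar>fip (us m) (vs m) - fip (us n) (vs n)\<bar>
        \<le> fnrm (us m - us n) * fnrm (vs m) + fnrm (us n) * fnrm (vs m - vs n)"
      using form.Cauchy_Schwarz[of "us m - us n" "vs m"] form.Cauchy_Schwarz[of "us n" "vs m - vs n"] D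
      by simp
    also have "\<dots> < (e / (2 * C)) * C + B * (e / (2 * B))"
    proof (rule add_less_le_mono)
      have "fnrm (us m - us n) * fnrm (vs m) \<le> fnrm (us m - us n) * C"
        using BC D by (intro mult_left_mono) auto
      also have "\<dots> < (e / (2 * C)) * C" using N1[of m n] BC mn by (intro mult_strict_right_mono) auto
      finally show "fnrm (us m - us n) * fnrm (vs m) < (e / (2 * C)) * C" .
      show "fnrm (us n) * fnrm (vs m - vs n) \<le> B * (e / (2 * B))"
        using BC D N2[of m n] mn by (intro mult_mono) auto
    qed
    also have "\<dots> = e" using BC by simp
    finally show ?thesis by (simp add: dist_real_def)
  qed
  then show "\<exists>N. \<forall>m\<ge>N. \<forall>n\<ge>N. dist (fip (us m) (vs m)) (fip (us n) (vs n)) < e" by blast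
qed

definition cl_form :: "'a \<Rightarrow> 'a \<Rightarrow> real" where
  "cl_form u v = (THE r. \<forall>us vs. approx us u \<longrightarrow> approx vs v \<longrightarrow> (\<lambda>n. q (us n) (vs n)) \<longlonglongrightarrow> r)"

definition cl_dom :: "'a set" where
  "cl_dom = {u \<in> X. \<exists>us. approx us u}"

text \<open>The \<open>THE\<close> in \<open>cl_form\<close> is meaningful once the limit is known
  not to depend on the two sequences. Two sequences approximating the same element differ by one
  that approximates 0, and by closability that one tends to 0 in the form norm.\<close>

lemma cl_form_tendsto:
  assumes A: "approx us u" "approx vs v" and X: "u \<in> X" "v \<in> X"
  shows "(\<lambda>n. q (us n) (vs n)) \<longlonglongrightarrow> cl_form u v"
proof -
  obtain s where s: "(\<lambda>n. fip (us n) (vs n)) \<longlonglongrightarrow> s"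
    using approx_convergent[OF A X] by (auto simp: convergent_def)
  define r where "r = (c + 1) * ip u v - s"
  have r: "(\<lambda>n. q (us' n) (vs' n)) \<longlonglongrightarrow> r" if A': "approx us' u" "approx vs' v" for us' vs'
  proof -
    have D: "us n \<in> D" "vs n \<in> D" "us' n \<in> D" "vs' n \<in> D" for n using approx_D A A' by auto
    have du: "(\<lambda>n. fnrm (us' n - us n)) \<longlonglongrightarrow> 0"
      using approx_zero[of "\<lambda>n. us' n - us n"] approx_lincomb[OF A'(1) A(1) X(1) X(1), of 1 "-1"] by simp
    have dv: "(\<lambda>n. fnrm (vs' n - vs n)) \<longlonglongrightarrow> 0"
      using approx_zero[of "\<lambda>n. vs' n - vs n"] approx_lincomb[OF A'(2) A(2) X(2) X(2), of 1 "-1"] by simp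
    obtain B C where BC: "\<And>n. fnrm (us n) \<le> B" "\<And>n. fnrm (vs' n) \<le> C"
      using approx_bounded A A' X by metis
    have lim: "(\<lambda>n. fnrm (us' n - us n) * C + B * fnrm (vs' n - vs n)) \<longlonglongrightarrow> 0"
      using du dv by (auto intro!: tendsto_eq_intros)
    have "norm (fip (us' n) (vs' n) - fip (us n) (vs n))
        \<le> fnrm (us' n - us n) * C + B * fnrm (vs' n - vs n)" for n
    proof -
      have "fip (us' n) (vs' n) - fip (us n) (vs n) = fip (us' n - us n) (vs' n) + fip (us n) (vs' n - vs n)"
        using D form.ip_diff_left[of "us' n" "us n" "vs' n"] form.ip_diff_right[of "vs' n" "vs n" "us n"]
        by simp
      then have "\<bar>fip (us' n) (vs' n) - fip (us n) (vs n)\<bar>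
          \<le> fnrm (us' n - us n) * fnrm (vs' n) + fnrm (us n) * fnrm (vs' n - vs n)"
        using form.Cauchy_Schwarz[of "us' n - us n" "vs' n"] form.Cauchy_Schwarz[of "us n" "vs' n - vs n"] D
        by simp
      also have "\<dots> \<le> fnrm (us' n - us n) * C + B * fnrm (vs' n - vs n)"
        using BC D by (intro add_mono mult_left_mono mult_right_mono) auto
      finally show ?thesis by simp
    qed
    then have "(\<lambda>n. fip (us' n) (vs' n) - fip (us n) (vs n)) \<longlonglongrightarrow> 0"
      by (intro Lim_null_comparison[OF always_eventually lim]) auto
    from tendsto_add[OF this s] have a_lim: "(\<lambda>n. fip (us' n) (vs' n)) \<longlonglongrightarrow> s" by simp
    have "(\<lambda>n. ip (us' n) (vs' n)) \<longlonglongrightarrow> ip u v"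
      by (rule tendsto_ip) (use A' D X in \<open>auto simp: approx_def\<close>)
    from tendsto_diff[OF tendsto_mult_left[OF this, of "c + 1"] a_lim] show ?thesis
      by (simp add: r_def fip_def)
  qed
  have "cl_form u v = r"
    unfolding cl_form_def
  proof (rule the_equality)
    show "\<forall>us vs. approx us u \<longrightarrow> approx vs v \<longrightarrow> (\<lambda>n. q (us n) (vs n)) \<longlonglongrightarrow> r" using r by blast
    show "r' = r" if "\<forall>us vs. approx us u \<longrightarrow> approx vs v \<longrightarrow> (\<lambda>n. q (us n) (vs n)) \<longlonglongrightarrow> r'" for r'
      using LIMSEQ_unique r that A by blast
  qed
  then show ?thesis using r[OF A] by simp
qed

lemma D_cl_dom: "D \<subseteq> cl_dom"
  using approx_const by (auto simp: cl_dom_def)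

section \<open>The operator associated with the closed form\<close>

definition friedrichs :: "('a \<times> 'a) set" where
  "friedrichs = {(u, w). u \<in> cl_dom \<and> w \<in> X \<and> (\<forall>v\<in>cl_dom. cl_form u v = ip w v)}"

lemma friedrichs_X: "(u, w) \<in> friedrichs \<Longrightarrow> u \<in> X" "(u, w) \<in> friedrichs \<Longrightarrow> w \<in> X"
  by (auto simp: friedrichs_def cl_dom_def)

lemma friedrichs_linear:
  assumes F: "(u, w) \<in> friedrichs" "(u', w') \<in> friedrichs"
  shows "(r *\<^sub>R u + s *\<^sub>R u', r *\<^sub>R w + s *\<^sub>R w') \<in> friedrichs"
proof -
  obtain us us' where A: "approx us u" "approx us' u'"
    using F by (auto simp: friedrichs_def cl_dom_def)
  have X: "u \<in> X" "u' \<in> X" "w \<in> X" "w' \<in> X" using F friedrichs_X by auto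
  note A' = approx_lincomb[OF A X(1,2), of r s]
  have "cl_form (r *\<^sub>R u + s *\<^sub>R u') v = ip (r *\<^sub>R w + s *\<^sub>R w') v" if v: "v \<in> cl_dom" for v
  proof -
    obtain vs where V: "approx vs v" "v \<in> X" using v by (auto simp: cl_dom_def)
    have D: "us n \<in> D" "us' n \<in> D" "vs n \<in> D" for n using approx_D A V by auto
    have 1: "(\<lambda>n. r * q (us n) (vs n) + s * q (us' n) (vs n)) \<longlonglongrightarrow> r * cl_form u v + s * cl_form u' v"
      by (intro tendsto_intros cl_form_tendsto) (use A V X in auto)
    have "(\<lambda>n. q (r *\<^sub>R us n + s *\<^sub>R us' n) (vs n)) \<longlonglongrightarrow> cl_form (r *\<^sub>R u + s *\<^sub>R u') v"
      by (rule cl_form_tendsto[OF A' V(1)]) (use X V in auto)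
    then have "(\<lambda>n. r * q (us n) (vs n) + s * q (us' n) (vs n)) \<longlonglongrightarrow> cl_form (r *\<^sub>R u + s *\<^sub>R u') v"
      using D by (simp add: q_add_left q_scale_left)
    then have "cl_form (r *\<^sub>R u + s *\<^sub>R u') v = r * cl_form u v + s * cl_form u' v"
      using 1 LIMSEQ_unique by blast
    then show ?thesis using F v V X by (simp add: friedrichs_def ip_linear)
  qed
  then show ?thesis using A' X by (auto simp: friedrichs_def cl_dom_def)
qed

lemma friedrichs_saturated:
  assumes F: "(u, w) \<in> friedrichs" and X': "u' \<in> X" "w' \<in> X"
    and null: "nrm (u - u') = 0" "nrm (w - w') = 0"
  shows "(u', w') \<in> friedrichs"
proof -
  obtain us where A: "approx us u" using F by (auto simp: friedrichs_def cl_dom_def)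
  have X: "u \<in> X" "w \<in> X" using F friedrichs_X by auto
  have A': "approx us u'" using approx_null[OF A X(1) X'(1) null(1)] .
  have "cl_form u' v = ip w' v" if v: "v \<in> cl_dom" for v
  proof -
    obtain vs where V: "approx vs v" "v \<in> X" using v by (auto simp: cl_dom_def)
    have "cl_form u' v = cl_form u v"
      using LIMSEQ_unique[OF cl_form_tendsto[OF A' V(1)] cl_form_tendsto[OF A V(1)]] X X' V by simp
    then show ?thesis using F v ip_null_left[OF X(2) X'(2) V(2) null(2)] by (simp add: friedrichs_def)
  qed
  then show ?thesis using A' X' by (auto simp: friedrichs_def cl_dom_def)
qed

lemma friedrichs_extends:
  assumes "u \<in> D" "w \<in> X" "\<And>v. v \<in> D \<Longrightarrow> q u v = ip w v"
  shows "(u, w) \<in> friedrichs"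
proof -
  have "cl_form u v = ip w v" if v: "v \<in> cl_dom" for v
  proof -
    obtain vs where V: "approx vs v" "v \<in> X" using v by (auto simp: cl_dom_def)
    have D: "vs n \<in> D" for n using approx_D V by auto
    have "(\<lambda>n. q u (vs n)) \<longlonglongrightarrow> cl_form u v"
      by (rule cl_form_tendsto[OF approx_const]) (use assms V in auto)
    moreover have "(\<lambda>n. ip w (vs n)) \<longlonglongrightarrow> ip w v"
      by (rule tendsto_ip) (use V D assms in \<open>auto simp: approx_def\<close>)
    ultimately show ?thesis using LIMSEQ_unique assms D by auto
  qed
  then show ?thesis using assms D_cl_dom by (auto simp: friedrichs_def)
qed

lemma friedrichs_symmetric:
  assumes F: "(u, w) \<in> friedrichs" "(u', w') \<in> friedrichs"
  shows "ip w u' = ip u w'"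
proof -
  obtain us us' where A: "approx us u" "approx us' u'"
    using F by (auto simp: friedrichs_def cl_dom_def)
  have X: "u \<in> X" "u' \<in> X" "w \<in> X" "w' \<in> X" using F friedrichs_X by auto
  have D: "us n \<in> D" "us' n \<in> D" for n using approx_D A by auto
  have "cl_form u u' = cl_form u' u"
    using LIMSEQ_unique[OF cl_form_tendsto[OF A X(1,2)]] cl_form_tendsto[OF A(2,1) X(2,1)]
    by (simp add: q_sym[OF D])
  then show ?thesis using F X ip_sym[of u w'] by (simp add: friedrichs_def)
qed

lemma friedrichs_bounded:
  assumes F: "(u, w) \<in> friedrichs" shows "ip w u \<le> c * ip u u"
proof -
  obtain us where A: "approx us u" using F by (auto simp: friedrichs_def cl_dom_def)
  have X: "u \<in> X" using F friedrichs_X by auto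
  have D: "us n \<in> D" for n using approx_D A by auto
  have "(\<lambda>n. ip (us n) (us n)) \<longlonglongrightarrow> ip u u"
    by (rule tendsto_ip) (use A D X in \<open>auto simp: approx_def\<close>)
  then have "cl_form u u \<le> c * ip u u"
    by (intro LIMSEQ_le[OF cl_form_tendsto[OF A A X X] tendsto_mult_left]) (use q_bounded D in auto)
  then show ?thesis using F by (simp add: friedrichs_def)
qed

text \<open>Riesz representation in the form domain: minimise \<open>l (v, v) - q v v - 2 (w, v)\<close> over \<open>D\<close>; by
  the parallelogram law minimising sequences are Cauchy for the form norm.\<close>

lemma friedrichs_surj:
  assumes l: "c < l" and w: "w \<in> X"
  shows "\<exists>u. (u, l *\<^sub>R u - w) \<in> friedrichs"
proof -
  define b where "b u v = l * ip u v - q u v" for u v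
  define G where "G v = b v v - 2 * ip w v" for v
  have b_ge: "(l - c) * (nrm u)\<^sup>2 \<le> b u u" if "u \<in> D" for u
    using q_bounded[OF that] that by (simp add: b_def nrm_sq algebra_simps)
  have b_nonneg: "0 \<le> b u u" if "u \<in> D" for u
  proof -
    have "0 \<le> (l - c) * (nrm u)\<^sup>2" using l by simp
    then show ?thesis using b_ge[OF that] by linarith
  qed
  have b_exp: "b (u + s *\<^sub>R v) (u + s *\<^sub>R v) = b u u + 2 * s * b u v + s\<^sup>2 * b v v"
    if "u \<in> D" "v \<in> D" for u v s
    using that by (simp add: b_def ip_linear q_add_left q_scale_left q_right q_sym[of v u]
        ip_sym[of v u] power2_eq_square algebra_simps)
  have bdd: "bdd_below (G ` D)"
  proof (rule bdd_belowI2)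
    fix v assume v: "v \<in> D"
    \<comment> \<open>Completing the square in \<open>nrm v\<close> produces the lower bound for
      \<open>G\<close>.\<close>
    have "0 \<le> ((l - c) * nrm v - nrm w)\<^sup>2 / (l - c)" using l by simp
    also have "\<dots> = (l - c) * (nrm v)\<^sup>2 - 2 * (nrm w * nrm v) + (nrm w)\<^sup>2 / (l - c)"
      using l by (simp add: power2_diff power_mult_distrib field_simps power2_eq_square)
    finally have "- ((nrm w)\<^sup>2 / (l - c)) \<le> (l - c) * (nrm v)\<^sup>2 - 2 * (nrm w * nrm v)" by simp
    also have "\<dots> \<le> G v"
      using b_ge[OF v] Cauchy_Schwarz[of w v] w v by (simp add: G_def)
    finally show "- ((nrm w)\<^sup>2 / (l - c)) \<le> G v" .
  qed
  define m where "m = Inf (G ` D)"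
  have m_le: "m \<le> G v" if "v \<in> D" for v unfolding m_def using bdd that by (intro cINF_lower)
  have "\<exists>v\<in>D. G v < m + 1 / real (Suc n)" for n
  proof -
    have "D \<noteq> {}" using subspace_0[OF subspace_D] by blast
    then have "\<exists>x\<in>G ` D. x < m + 1 / real (Suc n)"
      unfolding m_def by (intro cInf_lessD) auto
    then show ?thesis by auto
  qed
  then obtain us where D: "\<And>n. us n \<in> D" and G: "\<And>n. G (us n) < m + 1 / real (Suc n)"
    by metis
  have par: "b (us k - us j) (us k - us j) \<le> 2 / real (Suc k) + 2 / real (Suc j)" for k j
  proof -
    let ?x = "us k" and ?y = "us j"
    let ?h = "(1 / 2) *\<^sub>R (?x + ?y)"
    have bh: "b ?h ?h = (b ?x ?x + 2 * b ?x ?y + b ?y ?y) / 4"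
      using b_exp[of ?x ?y 1] D
      by (simp add: b_def ip_linear q_add_left q_scale_left q_right q_sym[of ?y ?x]
          ip_sym[of ?y ?x] field_simps)
    \<comment> \<open>The linear part of \<open>G\<close> cancels because \<open>?h\<close> is the
      midpoint of \<open>?x\<close> and \<open>?y\<close>.\<close>
    have "b (?x - ?y) (?x - ?y) = 2 * G ?x + 2 * G ?y - 4 * G ?h"
      using b_exp[of ?x ?y "-1"] bh D w by (simp add: G_def ip_linear field_simps)
    moreover have "m \<le> G ?h" by (rule m_le) (simp add: D)
    ultimately show ?thesis using G[of k] G[of j] by simp
  qed
  have small: "\<exists>N. \<forall>k\<ge>N. \<forall>j\<ge>N. b (us k - us j) (us k - us j) < e" if e: "0 < e" for e
  proof -
    obtain N where N: "1 / real (Suc N) < e / 4" using nat_approx_posE[of "e / 4"] e by auto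
    have "b (us k - us j) (us k - us j) < e" if "k \<ge> N" "j \<ge> N" for k j
    proof -
      have "1 / real (Suc k) \<le> 1 / real (Suc N)" "1 / real (Suc j) \<le> 1 / real (Suc N)"
        using that by (auto intro!: divide_left_mono)
      then show ?thesis using par[of k j] N by simp
    qed
    then show ?thesis by blast
  qed
  have nrm_small: "\<exists>N. \<forall>k\<ge>N. \<forall>j\<ge>N. nrm (us k - us j) < e" if e: "0 < e" for e
  proof -
    obtain N where N: "\<And>k j. k \<ge> N \<Longrightarrow> j \<ge> N \<Longrightarrow> b (us k - us j) (us k - us j) < (l - c) * e\<^sup>2"
      using small[of "(l - c) * e\<^sup>2"] l e by auto
    have "nrm (us k - us j) < e" if "k \<ge> N" "j \<ge> N" for k j
    proof (rule power2_less_imp_less)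
      have "(l - c) * (nrm (us k - us j))\<^sup>2 < (l - c) * e\<^sup>2"
        using N[OF that] b_ge[of "us k - us j"] D by simp
      then show "(nrm (us k - us j))\<^sup>2 < e\<^sup>2" using l by simp
    qed (use e in simp)
    then show ?thesis by blast
  qed
  obtain u where u: "u \<in> X" "(\<lambda>n. nrm (us n - u)) \<longlonglongrightarrow> 0"
    using complete[of us] nrm_small D by auto
  have A: "approx us u"
    unfolding approx_def
  proof (intro conjI allI impI)
    fix e :: real assume e: "0 < e"
    obtain N1 where N1: "\<And>k j. k \<ge> N1 \<Longrightarrow> j \<ge> N1 \<Longrightarrow> b (us k - us j) (us k - us j) < e / 2"
      using small[of "e / 2"] e by auto
    obtain \<delta> where \<delta>: "0 < \<delta>" "\<delta> * \<bar>l\<bar> \<le> e / 2"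
      using small_multiple[of "\<bar>l\<bar>" "e / 2"] e by auto
    define f where "f = sqrt \<delta>"
    have f: "0 < f" "\<bar>l\<bar> * f\<^sup>2 \<le> e / 2"
      using \<delta> by (simp_all add: f_def mult.commute)
    obtain N2 where N2: "\<And>k j. k \<ge> N2 \<Longrightarrow> j \<ge> N2 \<Longrightarrow> nrm (us k - us j) < f"
      using nrm_small[OF f(1)] by auto
    have "\<bar>q (us k - us j) (us k - us j)\<bar> < e" if "k \<ge> max N1 N2" "j \<ge> max N1 N2" for k j
    proof -
      let ?d = "us k - us j"
      have d: "?d \<in> D" using D by simp
      have "(nrm ?d)\<^sup>2 \<le> f\<^sup>2" using N2[of k j] that d by (intro power_mono) auto
      then have "\<bar>l * (nrm ?d)\<^sup>2\<bar> \<le> \<bar>l\<bar> * f\<^sup>2" by (simp add: abs_mult mult_left_mono)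
      moreover have "q ?d ?d = l * (nrm ?d)\<^sup>2 - b ?d ?d" using d by (simp add: b_def nrm_sq)
      ultimately show ?thesis using f N1[of k j] that b_nonneg[OF d] by (simp add: abs_if split: if_splits)
    qed
    then show "\<exists>N. \<forall>m\<ge>N. \<forall>n\<ge>N. \<bar>q (us m - us n) (us m - us n)\<bar> < e" by blast
  qed (use D u in auto)
  \<comment> \<open>The infimum need not be attained in \<open>D\<close>, so the Euler-Lagrange
    equation holds only approximately. Since \<open>us n\<close> is within \<open>1 / Suc n\<close>
    of the infimum, varying it by \<open>s *\<^sub>R v\<close> with
    \<open>s = - g / \<alpha>\<close> bounds the first variation \<open>g\<close>. The summand 1 in
    \<open>\<alpha>\<close> keeps the denominator positive when \<open>b v v = 0\<close>.\<close>
  have first_order: "(b (us n) v - ip w v)\<^sup>2 \<le> (b v v + 1) / real (Suc n)" if v: "v \<in> D" for n v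
  proof -
    define g where "g = b (us n) v - ip w v"
    define \<alpha> where "\<alpha> = b v v + 1"
    have \<alpha>: "1 \<le> \<alpha>" using b_nonneg[OF v] by (simp add: \<alpha>_def)
    define s where "s = - g / \<alpha>"
    have "m \<le> G (us n + s *\<^sub>R v)" by (rule m_le) (use D v in simp)
    also have "\<dots> = G (us n) + 2 * s * g + s\<^sup>2 * b v v"
      using b_exp[of "us n" v s] D v w by (simp add: G_def g_def ip_linear algebra_simps)
    finally have "- (1 / real (Suc n)) \<le> 2 * s * g + s\<^sup>2 * b v v" using G[of n] by simp
    also have "\<dots> \<le> 2 * s * g + s\<^sup>2 * \<alpha>"
      by (simp add: \<alpha>_def mult_left_mono)
    also have "\<dots> = - (g\<^sup>2 / \<alpha>)" using \<alpha> by (simp add: s_def power2_eq_square field_simps)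
    finally have "g\<^sup>2 / \<alpha> \<le> 1 / real (Suc n)" by simp
    then show ?thesis using \<alpha> unfolding g_def[symmetric] \<alpha>_def[symmetric]
      by (simp add: pos_divide_le_eq)
  qed
  have "cl_form u v = ip (l *\<^sub>R u - w) v" if v: "v \<in> cl_dom" for v
  proof -
    obtain vs where V: "approx vs v" "v \<in> X" using v by (auto simp: cl_dom_def)
    have VD: "vs n \<in> D" for n using approx_D V by auto
    have ip_uv: "(\<lambda>n. ip (us n) (vs n)) \<longlonglongrightarrow> ip u v"
      by (rule tendsto_ip) (use A V D VD u in \<open>auto simp: approx_def\<close>)
    have ip_vv: "(\<lambda>n. ip (vs n) (vs n)) \<longlonglongrightarrow> ip v v"
      by (rule tendsto_ip) (use V VD in \<open>auto simp: approx_def\<close>)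
    have ip_wv: "(\<lambda>n. ip w (vs n)) \<longlonglongrightarrow> ip w v"
      by (rule tendsto_ip) (use V VD w in \<open>auto simp: approx_def\<close>)
    \<comment> \<open>The test element in \<open>first_order\<close> now varies with
      \<open>n\<close>; its bound still tends to 0 because \<open>b (vs n) (vs n)\<close>
      converges.\<close>
    have "(\<lambda>n. b (vs n) (vs n) + 1) \<longlonglongrightarrow> l * ip v v - cl_form v v + 1"
      unfolding b_def by (intro tendsto_intros ip_vv cl_form_tendsto) (use V in auto)
    from tendsto_mult[OF this LIMSEQ_inverse_real_of_nat]
    have up: "(\<lambda>n. (b (vs n) (vs n) + 1) / real (Suc n)) \<longlonglongrightarrow> 0" by (simp add: divide_inverse)
    have "(\<lambda>n. b (us n) (vs n) - ip w (vs n)) \<longlonglongrightarrow> l * ip u v - cl_form u v - ip w v"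
      unfolding b_def by (intro tendsto_intros ip_uv ip_wv cl_form_tendsto) (use V A u in auto)
    then have "(\<lambda>n. (b (us n) (vs n) - ip w (vs n))\<^sup>2) \<longlonglongrightarrow> (l * ip u v - cl_form u v - ip w v)\<^sup>2"
      by (rule tendsto_power)
    then have "(l * ip u v - cl_form u v - ip w v)\<^sup>2 \<le> 0"
      by (rule LIMSEQ_le[OF _ up]) (use first_order VD in auto)
    then show ?thesis using u V w by (simp add: ip_linear)
  qed
  then have "(u, l *\<^sub>R u - w) \<in> friedrichs"
    using A u w by (auto simp: friedrichs_def cl_dom_def)
  then show ?thesis by blast
qed

text \<open>By saturation \<open>w\<close> and \<open>w'\<close> are both images of
  \<open>u'\<close>, so \<open>w - w'\<close> is orthogonal to the dense set
  \<open>D\<close>.\<close>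

lemma friedrichs_single_valued:
  assumes dense: "\<And>u e. u \<in> X \<Longrightarrow> 0 < e \<Longrightarrow> \<exists>u'\<in>D. nrm (u - u') < e"
    and F: "(u, w) \<in> friedrichs" "(u', w') \<in> friedrichs" and null: "nrm (u - u') = 0"
  shows "nrm (w - w') = 0"
proof -
  have X: "u \<in> X" "u' \<in> X" "w \<in> X" "w' \<in> X" using F friedrichs_X by auto
  have "(u', w) \<in> friedrichs" using friedrichs_saturated[OF F(1) X(2,3) null] by simp
  then have "ip (w - w') v = 0" if "v \<in> D" for v
    using F(2) that D_cl_dom X by (auto simp: friedrichs_def ip_linear)
  then show ?thesis by (intro null_by_orthogonality[of D]) (use dense X in auto)
qed

end

section \<open>Undoing the shift by \<open>c\<close>\<close>

context m_dissipative
begin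

definition rescaled :: "real \<Rightarrow> real \<Rightarrow> 'a \<Rightarrow> 'a" where
  "rescaled c t u = exp (c * t) *\<^sub>R S t u"

lemma rescaled_nrm: "0 \<le> t \<Longrightarrow> u \<in> X \<Longrightarrow> nrm (rescaled c t u) \<le> exp (c * t) * nrm u"
  by (simp add: rescaled_def nrm_scale S_nrm_le)

lemma rescaled_semigroup: "semi_hilbert_semigroup X ip (rescaled c)"
proof
  show "rescaled c t u \<in> X" if "0 \<le> t" "u \<in> X" for t u using that by (simp add: rescaled_def)
  show "\<exists>C. \<forall>u\<in>X. nrm (rescaled c t u) \<le> C * nrm u" if "0 \<le> t" for t
    using rescaled_nrm that by blast
next
  fix t u v r s assume t: "0 \<le> (t::real)" and X: "u \<in> X" "v \<in> X"
  have "rescaled c t (r *\<^sub>R u + s *\<^sub>R v) - (r *\<^sub>R rescaled c t u + s *\<^sub>R rescaled c t v)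
    = exp (c * t) *\<^sub>R (S t (r *\<^sub>R u + s *\<^sub>R v) - (r *\<^sub>R S t u + s *\<^sub>R S t v))"
    by (simp add: rescaled_def algebra_simps)
  then show "nrm (rescaled c t (r *\<^sub>R u + s *\<^sub>R v) - (r *\<^sub>R rescaled c t u + s *\<^sub>R rescaled c t v)) = 0"
    using S_linear[OF t X, of r s] t X
      nrm_scale[of "S t (r *\<^sub>R u + s *\<^sub>R v) - (r *\<^sub>R S t u + s *\<^sub>R S t v)" "exp (c * t)"] by simp
next
  fix u assume X: "u \<in> X"
  show "nrm (rescaled c 0 u - u) = 0" using S_zero[OF X] by (simp add: rescaled_def)
  have lim: "((\<lambda>t. exp (c * t) * nrm (S t u - u) + \<bar>exp (c * t) - 1\<bar> * nrm u) \<longlongrightarrow> 0) (at_right 0)"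
    using S_continuous[OF X] exp_tendsto[of c] by (auto intro!: tendsto_eq_intros)
  have "eventually (\<lambda>t. norm (nrm (rescaled c t u - u))
      \<le> exp (c * t) * nrm (S t u - u) + \<bar>exp (c * t) - 1\<bar> * nrm u) (at_right 0)"
    using eventually_at_right_less[of 0]
  proof eventually_elim
    case (elim t)
    have "rescaled c t u - u = exp (c * t) *\<^sub>R (S t u - u) + (exp (c * t) - 1) *\<^sub>R u"
      by (simp add: rescaled_def algebra_simps)
    then show ?case
      using nrm_lincomb[of "S t u - u" u "exp (c * t)" "exp (c * t) - 1"] elim X
      by (simp add: rescaled_def)
  qed
  from Lim_null_comparison[OF this lim]
  show "((\<lambda>t. nrm (rescaled c t u - u)) \<longlongrightarrow> 0) (at_right 0)" .
next
  fix s t u assume st: "0 \<le> (s::real)" "0 \<le> (t::real)" and X: "u \<in> X"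
  let ?e = "exp (c * s)" and ?f = "exp (c * t)"
  have "S s (?f *\<^sub>R S t u) \<in> X" using st X by simp
  have 1: "nrm (S s (?f *\<^sub>R S t u) - ?f *\<^sub>R S s (S t u)) = 0"
    using S_linear[of s "S t u" "S t u" ?f 0] st X by simp
  have 2: "nrm (S (s + t) u - S s (S t u)) = 0" by (rule S_add[OF st X])
  have "rescaled c (s + t) u - rescaled c s (rescaled c t u)
      = (?e * ?f) *\<^sub>R (S (s + t) u - S s (S t u)) + (- ?e) *\<^sub>R (S s (?f *\<^sub>R S t u) - ?f *\<^sub>R S s (S t u))"
    by (simp add: rescaled_def algebra_simps exp_add)
  also have "nrm \<dots> \<le> \<bar>?e * ?f\<bar> * nrm (S (s + t) u - S s (S t u))
      + \<bar>- ?e\<bar> * nrm (S s (?f *\<^sub>R S t u) - ?f *\<^sub>R S s (S t u))"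
    by (rule nrm_lincomb) (use st X in auto)
  also have "\<dots> = 0" by (simp only: 1 2 mult_zero_right add_0_left)
  finally show "nrm (rescaled c (s + t) u - rescaled c s (rescaled c t u)) = 0"
    using st X by (intro antisym nrm_nonneg) (simp_all add: rescaled_def)
qed

text \<open>The inclusion in \<open>A + c\<close> is a maximality argument. For
  \<open>(u, w)\<close> in the generator, solve \<open>u' - A u' = u - (w - c u)\<close>. The
  generator then maps \<open>d = u - u'\<close> to \<open>(c + 1) d\<close>, whereas the growth
  bound permits at most \<open>c * ip d d\<close> for the pairing with \<open>d\<close>; so
  \<open>d\<close> is null and \<open>saturated\<close> applies.\<close>

lemma gen_rescaled:
  assumes saturated: "\<And>u v u' v'. (u, v) \<in> A \<Longrightarrow> u' \<in> X \<Longrightarrow> v' \<in> X \<Longrightarrow>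
      nrm (u - u') = 0 \<Longrightarrow> nrm (v - v') = 0 \<Longrightarrow> (u', v') \<in> A"
  shows "semi_hilbert_semigroup.gen X ip (rescaled c) = {(u, w). w \<in> X \<and> (u, w - c *\<^sub>R u) \<in> A}"
proof -
  interpret R: semi_hilbert_semigroup X ip "rescaled c" by (rule rescaled_semigroup)
  have super: "(u, v + c *\<^sub>R u) \<in> R.gen" if A: "(u, v) \<in> A" for u v
  proof -
    have X: "u \<in> X" "v \<in> X" using A A_X by auto
    let ?Q = "\<lambda>t. nrm ((1 / t) *\<^sub>R (S t u - u) - v)"
    let ?b = "\<lambda>t. exp (c * t) * ?Q t + (\<bar>(exp (c * t) - 1) / t - c\<bar> * nrm u + \<bar>exp (c * t) - 1\<bar> * nrm v)"
    have 1: "((\<lambda>t. \<bar>(exp (c * t) - 1) / t - c\<bar>) \<longlongrightarrow> 0) (at_right 0)"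
      by (intro tendsto_rabs_zero LIM_zero exp_quotient_tendsto)
    have 2: "((\<lambda>t. \<bar>exp (c * t) - 1\<bar>) \<longlongrightarrow> 0) (at_right 0)"
      using exp_tendsto[of c] by (intro tendsto_rabs_zero) (simp add: LIM_zero_iff)
    have "(?b \<longlongrightarrow> 1 * 0 + (0 * nrm u + 0 * nrm v)) (at_right 0)"
      by (intro tendsto_add tendsto_mult tendsto_const S_generator[OF A] exp_tendsto 1 2)
    then have lim: "(?b \<longlongrightarrow> 0) (at_right 0)" by simp
    have "eventually (\<lambda>t. norm (nrm ((1 / t) *\<^sub>R (rescaled c t u - u) - (v + c *\<^sub>R u))) \<le> ?b t) (at_right 0)"
      using eventually_at_right_less[of 0]
    proof eventually_elim
      case (elim t)
      let ?x = "(1 / t) *\<^sub>R (S t u - u) - v" and ?r = "(exp (c * t) - 1) / t - c"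
        and ?s = "exp (c * t) - 1"
      have "(1 / t) *\<^sub>R (rescaled c t u - u) - (v + c *\<^sub>R u)
          = exp (c * t) *\<^sub>R ?x + 1 *\<^sub>R (?r *\<^sub>R u + ?s *\<^sub>R v)"
        using elim by (simp add: rescaled_def algebra_simps diff_divide_distrib)
      also have "nrm \<dots> \<le> \<bar>exp (c * t)\<bar> * nrm ?x + \<bar>1\<bar> * nrm (?r *\<^sub>R u + ?s *\<^sub>R v)"
        by (rule nrm_lincomb) (use elim X in auto)
      also have "nrm (?r *\<^sub>R u + ?s *\<^sub>R v) \<le> \<bar>?r\<bar> * nrm u + \<bar>?s\<bar> * nrm v"
        by (rule nrm_lincomb) (use X in auto)
      finally show ?case using elim X by (simp add: rescaled_def)
    qed
    from Lim_null_comparison[OF this lim] show ?thesis using X by (simp add: R.gen_def)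
  qed
  have sub: "(u, w - c *\<^sub>R u) \<in> A" if uw: "(u, w) \<in> R.gen" for u w
  proof -
    have X: "u \<in> X" "w \<in> X" using uw by (auto simp: R.gen_def)
    define z where "z = u - (w - c *\<^sub>R u)"
    obtain u' where A: "(u', u' - z) \<in> A" using A_surj[of 1 z] X by (auto simp: z_def)
    have X': "u' \<in> X" using A A_X by blast
    define d where "d = u - u'"
    have "(d, w - (u' - z + c *\<^sub>R u')) \<in> R.gen"
      unfolding d_def by (rule R.gen_diff[OF uw super[OF A]])
    moreover have "w - (u' - z + c *\<^sub>R u') = (c + 1) *\<^sub>R d" by (simp add: z_def d_def algebra_simps)
    ultimately have "(d, (c + 1) *\<^sub>R d) \<in> R.gen" by simp
    from R.gen_upper_bound[OF _ this, of c] have "ip ((c + 1) *\<^sub>R d) d \<le> c * ip d d"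
      using rescaled_nrm X X' by (simp add: d_def)
    then have "ip d d \<le> 0" using X X' by (simp add: d_def ip_linear algebra_simps)
    then have "nrm d = 0" using ip_nonneg[of d] X X' by (simp add: nrm_def d_def)
    then have "nrm (u' - u) = 0" using nrm_commute X X' by (simp add: d_def)
    then show ?thesis using X X' by (intro saturated[OF A]) (auto simp: z_def)
  qed
  show ?thesis
  proof (intro set_eqI iffI)
    fix p assume "p \<in> R.gen"
    then show "p \<in> {(u, w). w \<in> X \<and> (u, w - c *\<^sub>R u) \<in> A}"
      using sub by (cases p) (auto simp: R.gen_def)
  next
    fix p assume "p \<in> {(u, w). w \<in> X \<and> (u, w - c *\<^sub>R u) \<in> A}"
    then show "p \<in> R.gen" using super[of "fst p" "snd p - c *\<^sub>R fst p"] by (cases p) auto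
  qed
qed

end

lemma (in semibounded_form) friedrichs_generates:
  assumes dense: "\<And>u e. u \<in> X \<Longrightarrow> 0 < e \<Longrightarrow> \<exists>u'\<in>D. nrm (u - u') < e"
  shows "\<exists>T. semi_hilbert_semigroup X ip T \<and> semi_hilbert_semigroup.gen X ip T = friedrichs"
proof -
  define A where "A = {(u, v). v \<in> X \<and> (u, v + c *\<^sub>R u) \<in> friedrichs}"
  interpret m_dissipative X ip A
  proof
    show "A \<subseteq> X \<times> X" using friedrichs_X by (auto simp: A_def)
  next
    fix u v u' v' r s assume "(u, v) \<in> A" "(u', v') \<in> A"
    then show "(r *\<^sub>R u + s *\<^sub>R u', r *\<^sub>R v + s *\<^sub>R v') \<in> A"
      using friedrichs_linear[of u "v + c *\<^sub>R u" u' "v' + c *\<^sub>R u'" r s] by (auto simp: A_def algebra_simps)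
  next
    fix u v assume uv: "(u, v) \<in> A"
    then have X: "u \<in> X" "v \<in> X" using friedrichs_X by (auto simp: A_def)
    have "ip (v + c *\<^sub>R u) u \<le> c * ip u u" using uv friedrichs_bounded by (auto simp: A_def)
    then show "ip v u \<le> 0" using X by (simp add: ip_linear)
  next
    fix h w assume h: "0 < (h::real)" and w: "w \<in> X"
    \<comment> \<open>For \<open>A = friedrichs - c\<close> the equation
      \<open>u - h A u = w\<close> reads \<open>(1 / h + c) u - w / h = friedrichs u\<close>, the
      case \<open>l = 1 / h + c > c\<close> of \<open>friedrichs_surj\<close>.\<close>
    then obtain u where u: "(u, (1 / h + c) *\<^sub>R u - (1 / h) *\<^sub>R w) \<in> friedrichs"
      using friedrichs_surj[of "1 / h + c" "(1 / h) *\<^sub>R w"] by auto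
    have "(1 / h + c) *\<^sub>R u - (1 / h) *\<^sub>R w = (1 / h) *\<^sub>R (u - w) + c *\<^sub>R u"
      by (simp add: algebra_simps)
    then show "\<exists>u. (u, (1 / h) *\<^sub>R (u - w)) \<in> A"
      using u w friedrichs_X(1)[OF u] by (intro exI[of _ u]) (simp add: A_def)
  next
    fix u e assume "u \<in> X" "0 < (e::real)"
    then obtain u' where u': "u' \<in> D" "nrm (u - u') < e" using dense by blast
    then obtain w where w: "w \<in> X" "\<forall>v\<in>D. q u' v = ip w v" using q_operator by blast
    then have "(u', w - c *\<^sub>R u') \<in> A" using u' friedrichs_extends[of u' w] by (simp add: A_def)
    then show "\<exists>(u', v)\<in>A. nrm (u - u') < e" using u' by blast
  qed
  have "semi_hilbert_semigroup.gen X ip (rescaled c) = {(u, w). w \<in> X \<and> (u, w - c *\<^sub>R u) \<in> A}"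
  proof (rule gen_rescaled)
    fix u v u' v'
    assume uv: "(u, v) \<in> A" and X': "u' \<in> X" "v' \<in> X" and null: "nrm (u - u') = 0" "nrm (v - v') = 0"
    have X: "u \<in> X" "v \<in> X" using uv friedrichs_X by (auto simp: A_def)
    have "nrm (1 *\<^sub>R (v - v') + c *\<^sub>R (u - u')) \<le> \<bar>1\<bar> * nrm (v - v') + \<bar>c\<bar> * nrm (u - u')"
      by (rule nrm_lincomb) (use X X' in auto)
    then have "nrm (v + c *\<^sub>R u - (v' + c *\<^sub>R u')) = 0"
      using null X X' by (intro antisym nrm_nonneg) (simp_all add: algebra_simps)
    then show "(u', v') \<in> A"
      using friedrichs_saturated[of u "v + c *\<^sub>R u" u' "v' + c *\<^sub>R u'"] uv null X' by (simp add: A_def)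
  qed
  also have "\<dots> = friedrichs" using friedrichs_X by (auto simp: A_def)
  finally show ?thesis using rescaled_semigroup by blast
qed

section \<open>The space \<open>L\<^sup>2(M)\<close>\<close>

text \<open>The pointwise vector space structure allows the abstract locales to be instantiated with
  sets of functions.\<close>

instantiation "fun" :: (type, scaleR) scaleR
begin
definition scaleR_fun_def: "scaleR r f = (\<lambda>x. r *\<^sub>R f x)"
instance ..
end

instance "fun" :: (type, real_vector) real_vector
  by standard (auto simp: scaleR_fun_def fun_eq_iff algebra_simps)

lemma scaleR_fun_apply [simp]: "(r *\<^sub>R f) x = r *\<^sub>R f x"
  by (simp add: scaleR_fun_def)

lemma L2_measurable: "u \<in> L2_space M \<Longrightarrow> u \<in> borel_measurable M"
  by (simp add: L2_space_def)

lemma L2_mult_integrable: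
  assumes "u \<in> L2_space M" "v \<in> L2_space M" shows "integrable M (\<lambda>x. u x * v x)"
proof (rule Bochner_Integration.integrable_bound)
  show "integrable M (\<lambda>x. (u x)\<^sup>2 + (v x)\<^sup>2)" using assms by (simp add: L2_space_def)
  have "\<bar>r * s\<bar> \<le> r\<^sup>2 + s\<^sup>2" for r s :: real
    using sum_squares_bound[of "\<bar>r\<bar>" "\<bar>s\<bar>"] mult_nonneg_nonneg[of "\<bar>r\<bar>" "\<bar>s\<bar>"]
    unfolding abs_mult power2_abs by linarith
  then show "AE x in M. norm (u x * v x) \<le> norm ((u x)\<^sup>2 + (v x)\<^sup>2)" by simp
qed (use assms in \<open>auto simp: L2_space_def\<close>)

lemma subspace_L2: "subspace (L2_space M)"
proof (rule subspaceI)
  fix u v assume L2: "u \<in> L2_space M" "v \<in> L2_space M"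
  have "(\<lambda>x. ((u + v) x)\<^sup>2) = (\<lambda>x. (u x)\<^sup>2 + (v x)\<^sup>2 + 2 * (u x * v x))"
    by (simp add: power2_sum fun_eq_iff)
  moreover have "integrable M \<dots>"
    using L2 L2_mult_integrable[OF L2] by (auto simp: L2_space_def)
  ultimately show "u + v \<in> L2_space M" using L2 by (auto simp: L2_space_def plus_fun_def)
next
  fix c :: real and u assume "u \<in> L2_space M"
  then show "c *\<^sub>R u \<in> L2_space M"
    by (auto simp: L2_space_def scaleR_fun_def power_mult_distrib)
qed (simp add: L2_space_def zero_fun_def)

interpretation L2: semi_inner "L2_space M" "L2_inner M"
  rewrites "semi_inner.nrm (L2_inner M) = L2_norm M"
  for M :: "'a measure"
proof -
  show *: "semi_inner (L2_space M) (L2_inner M)"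
  proof
    show "subspace (L2_space M)" by (rule subspace_L2)
    fix u v w assume L2: "u \<in> L2_space M" "v \<in> L2_space M" "w \<in> L2_space M"
    show "L2_inner M u v = L2_inner M v u" by (simp add: L2_inner_def mult.commute)
    show "L2_inner M (u + v) w = L2_inner M u w + L2_inner M v w"
      using L2_mult_integrable[OF L2(1,3)] L2_mult_integrable[OF L2(2,3)]
      by (simp add: L2_inner_def distrib_right)
    show "L2_inner M (c *\<^sub>R u) v = c * L2_inner M u v" for c
      by (simp add: L2_inner_def mult.assoc)
    show "0 \<le> L2_inner M u u" by (simp add: L2_inner_def)
  qed
  show "semi_inner.nrm (L2_inner M) = L2_norm M"
    by (simp add: fun_eq_iff semi_inner.nrm_def[OF *] L2_norm_def)
qed

lemma L2_nrm: "semi_inner.nrm (L2_inner M) = L2_norm M"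
  by (simp add: fun_eq_iff semi_inner.nrm_def[OF L2.semi_inner_axioms] L2_norm_def)

lemma L2_norm_sq: "(L2_norm M u)\<^sup>2 = (LINT x|M. (u x)\<^sup>2)"
  by (simp add: L2_norm_def L2_inner_def power2_eq_square)

lemma L2_norm_zero_iff: assumes "u \<in> L2_space M" shows "L2_norm M u = 0 \<longleftrightarrow> (AE x in M. u x = 0)"
proof -
  have "L2_norm M u = 0 \<longleftrightarrow> (LINT x|M. (u x)\<^sup>2) = 0"
    using L2_norm_sq[of M u] by (metis power_zero_numeral zero_eq_power2)
  also have "\<dots> \<longleftrightarrow> (AE x in M. (u x)\<^sup>2 = 0)"
    by (rule integral_nonneg_eq_0_iff_AE) (use assms in \<open>auto simp: L2_space_def\<close>)
  finally show ?thesis by simp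
qed

lemma L2_null_diff_iff:
  "u \<in> L2_space M \<Longrightarrow> v \<in> L2_space M \<Longrightarrow> L2_norm M (u - v) = 0 \<longleftrightarrow> (AE x in M. u x = v x)"
  by (simp add: L2_norm_zero_iff)

lemma nn_integral_L2:
  "u \<in> L2_space M \<Longrightarrow> (\<integral>\<^sup>+x. ennreal ((u x)\<^sup>2) \<partial>M) = ennreal ((L2_norm M u)\<^sup>2)"
  unfolding L2_norm_sq by (rule nn_integral_eq_integral) (auto simp: L2_space_def)

text \<open>With the nonnegative integral in the hypothesis, one estimate yields membership as well
  as the bound. This suits Fatou's lemma, where square integrability of the limit is not yet
  known.\<close>

lemma L2_norm_leI:
  assumes "u \<in> borel_measurable M" "(\<integral>\<^sup>+x. ennreal ((u x)\<^sup>2) \<partial>M) \<le> ennreal (r\<^sup>2)" "0 \<le> r"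
  shows "u \<in> L2_space M" "L2_norm M u \<le> r"
proof -
  have "integrable M (\<lambda>x. (u x)\<^sup>2)"
    by (rule integrableI_bounded) (use assms in \<open>auto intro: le_less_trans\<close>)
  then show L2: "u \<in> L2_space M" using assms by (simp add: L2_space_def)
  have "(L2_norm M u)\<^sup>2 \<le> r\<^sup>2" using assms(2) unfolding nn_integral_L2[OF L2] by simp
  then show "L2_norm M u \<le> r" using \<open>0 \<le> r\<close> by (rule power2_le_imp_le)
qed

lemma L2_abs:
  assumes "u \<in> L2_space M"
  shows "(\<lambda>x. \<bar>u x\<bar>) \<in> L2_space M" "L2_norm M (\<lambda>x. \<bar>u x\<bar>) = L2_norm M u"
  using assms by (auto simp: L2_space_def L2_norm_def L2_inner_def)

text \<open>The partial sums \<open>G K\<close> of the absolute increments have norm at most 2. By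
  monotone convergence their supremum is finite almost everywhere, and at such points the series of
  increments converges absolutely.\<close>

lemma L2_AE_convergent:
  assumes L2: "\<And>k. h k \<in> L2_space M" and le: "\<And>k. L2_norm M (h (Suc k) - h k) \<le> (1 / 2) ^ k"
  shows "AE x in M. convergent (\<lambda>k. h k x)"
proof -
  define d where "d k x = \<bar>h (Suc k) x - h k x\<bar>" for k x
  have d_eq: "d k = (\<lambda>x. \<bar>h (Suc k) x - h k x\<bar>)" for k by (simp add: d_def fun_eq_iff)
  define G where "G K = (\<Sum>k<K. d k)" for K
  have d: "d k \<in> L2_space M" "L2_norm M (d k) \<le> (1 / 2) ^ k" for k
    using L2_abs[of "h (Suc k) - h k" M] L2 le by (simp_all add: d_eq)
  have G_Suc: "G (Suc K) = G K + d K" for K by (simp add: G_def)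
  have G: "G K \<in> L2_space M \<and> L2_norm M (G K) \<le> 2 - 2 * (1 / 2) ^ K" for K
  proof (induction K)
    case 0
    show ?case by (simp add: G_def L2_space_def L2_norm_def L2_inner_def)
  next
    case (Suc K)
    have "G (Suc K) \<in> L2_space M"
      unfolding G_Suc by (rule L2.X_closed(2)) (use Suc d in auto)
    moreover have "L2_norm M (G (Suc K)) \<le> L2_norm M (G K) + L2_norm M (d K)"
      unfolding G_Suc by (rule L2.nrm_triangle) (use Suc d in auto)
    ultimately show ?case using Suc d(2)[of K] by simp
  qed
  have meas: "G K \<in> borel_measurable M" for K using G L2_measurable by blast
  have G_apply: "G K x = (\<Sum>k<K. d k x)" for K x
    by (induction K) (simp_all add: G_Suc, simp add: G_def)
  have mono: "incseq (\<lambda>K x. ennreal ((G K x)\<^sup>2))"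
    unfolding incseq_def le_fun_def
    by (auto simp: G_apply d_def intro!: ennreal_leI power_mono sum_mono2 sum_nonneg)
  have "(\<integral>\<^sup>+x. (SUP K. ennreal ((G K x)\<^sup>2)) \<partial>M) = (SUP K. \<integral>\<^sup>+x. ennreal ((G K x)\<^sup>2) \<partial>M)"
    by (rule nn_integral_monotone_convergence_SUP[OF mono]) (use meas in measurable)
  also have "\<dots> \<le> ennreal (2\<^sup>2)"
  proof (rule SUP_least)
    fix K
    have "0 \<le> (1 / 2 :: real) ^ K" by simp
    then have "L2_norm M (G K) \<le> 2" using G[of K] by linarith
    then have "(L2_norm M (G K))\<^sup>2 \<le> 2\<^sup>2" using G by (intro power_mono) auto
    then show "(\<integral>\<^sup>+x. ennreal ((G K x)\<^sup>2) \<partial>M) \<le> ennreal (2\<^sup>2)"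
      using ennreal_leI[of "(L2_norm M (G K))\<^sup>2" "2\<^sup>2"] nn_integral_L2[of "G K" M] G by simp
  qed
  finally have "(\<integral>\<^sup>+x. (SUP K. ennreal ((G K x)\<^sup>2)) \<partial>M) \<noteq> \<infinity>" by (auto simp: top_unique)
  then have "AE x in M. (SUP K. ennreal ((G K x)\<^sup>2)) \<noteq> \<infinity>"
    by (intro nn_integral_PInf_AE) (use meas in measurable)
  then show ?thesis
  proof eventually_elim
    case (elim x)
    then obtain B where B: "(SUP K. ennreal ((G K x)\<^sup>2)) = ennreal B" "0 \<le> B"
      by (cases "SUP K. ennreal ((G K x)\<^sup>2)") auto
    have "(\<Sum>k<K. norm (h (Suc k) x - h k x)) \<le> sqrt B" for K
    proof -
      have "ennreal ((G K x)\<^sup>2) \<le> ennreal B" unfolding B(1)[symmetric] by (rule SUP_upper) simp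
      then have "(G K x)\<^sup>2 \<le> B" using B by simp
      then have "G K x \<le> sqrt B" by (rule real_le_rsqrt)
      then show ?thesis by (simp add: G_apply d_def)
    qed
    then have "summable (\<lambda>k. norm (h (Suc k) x - h k x))"
      by (intro summableI_nonneg_bounded) auto
    then have "summable (\<lambda>k. h (Suc k) x - h k x)" by (rule summable_norm_cancel)
    then have "convergent (\<lambda>n. \<Sum>k<n. h (Suc k) x - h k x)" by (simp add: summable_iff_convergent)
    then have "convergent (\<lambda>n. h n x - h 0 x)" by (simp add: sum_lessThan_telescope[of "\<lambda>k. h k x"])
    then show ?case using convergent_diff_const_right_iff by blast
  qed
qed

text \<open>This is the theorem of Riesz and Fischer: a rapidly Cauchy subsequence converges almost
  everywhere, and Fatou's lemma turns the Cauchy estimate into an estimate against the pointwise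
  limit.\<close>

lemma L2_complete:
  assumes L2: "\<And>n. f n \<in> L2_space M"
    and Cauchy: "\<And>e. 0 < e \<Longrightarrow> \<exists>N. \<forall>m\<ge>N. \<forall>n\<ge>N. L2_norm M (f m - f n) < e"
  shows "\<exists>l\<in>L2_space M. (\<lambda>n. L2_norm M (f n - l)) \<longlonglongrightarrow> 0"
proof -
  have "\<exists>N. \<forall>m\<ge>N. \<forall>n\<ge>N. L2_norm M (f m - f n) < (1 / 2) ^ k" for k :: nat
    by (rule Cauchy) simp
  then obtain N where N: "\<And>k m n. m \<ge> N k \<Longrightarrow> n \<ge> N k \<Longrightarrow> L2_norm M (f m - f n) < (1 / 2) ^ k"
    by metis
  \<comment> \<open>The sum serves as a common upper bound of \<open>N 0\<close>, ...,
    \<open>N k\<close>.\<close>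
  define r where "r k = (\<Sum>i\<le>k. N i)" for k
  have r: "N i \<le> r k" if "i \<le> k" for i k unfolding r_def by (rule member_le_sum) (use that in auto)
  define h where "h k = f (r k)" for k
  \<comment> \<open>Where the subsequence diverges the value is unspecified; these points form a
    null set, and \<open>l\<close> is measurable all the same.\<close>
  define l where "l x = lim (\<lambda>k. h k x)" for x
  have conv: "AE x in M. convergent (\<lambda>k. h k x)"
  proof (rule L2_AE_convergent)
    show "L2_norm M (h (Suc k) - h k) \<le> (1 / 2) ^ k" for k
      unfolding h_def by (rule less_imp_le[OF N[OF r r]]) auto
  qed (simp add: h_def L2)
  have meas: "f n \<in> borel_measurable M" "h n \<in> borel_measurable M" for n
    using L2 L2_measurable by (auto simp: h_def)
  have l_meas: "l \<in> borel_measurable M"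
    unfolding l_def using meas by (intro borel_measurable_lim_metric) auto
  have near: "f n - l \<in> L2_space M \<and> L2_norm M (f n - l) \<le> (1 / 2) ^ k" if n: "n \<ge> N k" for n k
  proof -
    have "(\<integral>\<^sup>+x. ennreal (((f n - l) x)\<^sup>2) \<partial>M) = (\<integral>\<^sup>+x. liminf (\<lambda>j. ennreal ((f n x - h j x)\<^sup>2)) \<partial>M)"
    proof (rule nn_integral_cong_AE)
      show "AE x in M. ennreal (((f n - l) x)\<^sup>2) = liminf (\<lambda>j. ennreal ((f n x - h j x)\<^sup>2))"
        using conv
      proof eventually_elim
        case (elim x)
        then have "(\<lambda>k. h k x) \<longlonglongrightarrow> l x" by (simp add: l_def convergent_LIMSEQ_iff)
        then have "(\<lambda>j. ennreal ((f n x - h j x)\<^sup>2)) \<longlonglongrightarrow> ennreal ((f n x - l x)\<^sup>2)"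
          by (intro tendsto_intros)
        from lim_imp_Liminf[OF trivial_limit_sequentially this] show ?case by simp
      qed
    qed
    also have "\<dots> \<le> liminf (\<lambda>j. \<integral>\<^sup>+x. ennreal ((f n x - h j x)\<^sup>2) \<partial>M)"
      by (rule nn_integral_liminf) (use meas in measurable)
    also have "\<dots> \<le> ennreal (((1 / 2) ^ k)\<^sup>2)"
    proof (rule Liminf_le)
      show "\<forall>\<^sub>F j in sequentially. (\<integral>\<^sup>+x. ennreal ((f n x - h j x)\<^sup>2) \<partial>M) \<le> ennreal (((1 / 2) ^ k)\<^sup>2)"
        using eventually_ge_at_top[of k]
      proof eventually_elim
        case (elim j)
        have "L2_norm M (f n - h j) \<le> (1 / 2) ^ k"
          unfolding h_def using N[of k n "r j"] n r[OF elim] by simp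
        then have "(L2_norm M (f n - h j))\<^sup>2 \<le> ((1 / 2) ^ k)\<^sup>2"
          using L2 by (intro power_mono) (auto simp: h_def)
        then show ?case
          using nn_integral_L2[of "f n - h j" M] L2 by (simp add: h_def ennreal_leI)
      qed
    qed simp
    finally show ?thesis using L2_norm_leI[of "f n - l" M "(1 / 2) ^ k"] meas l_meas
      by (auto simp: fun_diff_def)
  qed
  have "l = f (N 0) - (f (N 0) - l)" by simp
  then have l: "l \<in> L2_space M" using near[of 0 "N 0"] L2 L2.X_closed(3) by (metis le_refl)
  have "(\<lambda>n. L2_norm M (f n - l)) \<longlonglongrightarrow> 0"
  proof (rule LIMSEQ_I)
    fix e :: real assume "0 < e"
    then obtain k where k: "(1 / 2) ^ k < e" using real_arch_pow_inv[of e "1 / 2"] by auto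
    have "norm (L2_norm M (f n - l) - 0) < e" if "n \<ge> N k" for n
      using near[OF that] k L2 l by simp
    then show "\<exists>no. \<forall>n\<ge>no. norm (L2_norm M (f n - l) - 0) < e" by blast
  qed
  then show ?thesis using l by blast
qed

interpretation L2: semi_hilbert "L2_space M" "L2_inner M"
  rewrites "semi_inner.nrm (L2_inner M) = L2_norm M"
  for M :: "'a measure"
proof -
  show "semi_hilbert (L2_space M) (L2_inner M)"
    by unfold_locales (unfold L2_nrm, rule L2_complete)
qed (rule L2_nrm)

section \<open>Semigroups on \<open>L\<^sup>2(M)\<close>\<close>

text \<open>On the right, independence of representatives is implicit: if \<open>u\<close> and
  \<open>v\<close> agree almost everywhere, boundedness makes \<open>S (u - v)\<close> null, and
  linearity then does so for \<open>S u - S v\<close>.\<close>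

lemma bounded_linear_map_iff:
  "bounded_linear_map M S \<longleftrightarrow>
    (\<forall>u\<in>L2_space M. S u \<in> L2_space M) \<and>
    (\<forall>u\<in>L2_space M. \<forall>v\<in>L2_space M. \<forall>a b.
       L2_norm M (S (a *\<^sub>R u + b *\<^sub>R v) - (a *\<^sub>R S u + b *\<^sub>R S v)) = 0) \<and>
    (\<exists>C. \<forall>u\<in>L2_space M. L2_norm M (S u) \<le> C * L2_norm M u)" (is "_ \<longleftrightarrow> ?inv \<and> ?lin \<and> ?bdd")
proof -
  have lin_iff: "(\<forall>u\<in>L2_space M. \<forall>v\<in>L2_space M. \<forall>a b.
      AE x in M. S (\<lambda>y. a * u y + b * v y) x = a * S u x + b * S v x) \<longleftrightarrow> ?lin" if ?inv
  proof (intro ball_cong all_cong1 refl)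
    fix u v a b assume L2: "u \<in> L2_space M" "v \<in> L2_space M"
    have "(\<lambda>y. a * u y + b * v y) = a *\<^sub>R u + b *\<^sub>R v" by (simp add: fun_eq_iff)
    moreover have "S (a *\<^sub>R u + b *\<^sub>R v) \<in> L2_space M" "a *\<^sub>R S u + b *\<^sub>R S v \<in> L2_space M"
      using L2 that by simp_all
    ultimately show "(AE x in M. S (\<lambda>y. a * u y + b * v y) x = a * S u x + b * S v x) \<longleftrightarrow>
        L2_norm M (S (a *\<^sub>R u + b *\<^sub>R v) - (a *\<^sub>R S u + b *\<^sub>R S v)) = 0"
      by (subst L2_null_diff_iff) simp_all
  qed
  have AE: "AE x in M. S u x = S v x"
    if ?inv ?lin ?bdd and L2: "u \<in> L2_space M" "v \<in> L2_space M" and eq: "AE x in M. u x = v x" for u v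
  proof -
    have "L2_norm M (S (u - v)) = 0"
    proof -
      obtain C where "L2_norm M (S (u - v)) \<le> C * L2_norm M (u - v)" using \<open>?bdd\<close> L2 by fastforce
      moreover have "L2_norm M (u - v) = 0" using L2_null_diff_iff L2 eq by blast
      ultimately show ?thesis using L2 \<open>?inv\<close> by (intro antisym L2.nrm_nonneg) simp_all
    qed
    moreover have "L2_norm M (S (1 *\<^sub>R u + (- 1) *\<^sub>R v) - (1 *\<^sub>R S u + (- 1) *\<^sub>R S v)) = 0"
      using \<open>?lin\<close> L2 by blast
    ultimately have "L2_norm M (S u - S v) = 0"
      using L2.nrm_eq_of_null_diff[of "S (u - v)" M "S u - S v"] L2 \<open>?inv\<close> by simp
    then show ?thesis using L2_null_diff_iff L2 \<open>?inv\<close> by blast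
  qed
  show ?thesis
  proof
    assume bl: "bounded_linear_map M S"
    then have ?inv ?bdd by (simp_all add: bounded_linear_map_def)
    moreover have ?lin using lin_iff[OF \<open>?inv\<close>, THEN iffD1]
        bl[unfolded bounded_linear_map_def, THEN conjunct2, THEN conjunct2, THEN conjunct1] .
    ultimately show "?inv \<and> ?lin \<and> ?bdd" by (intro conjI)
  next
    assume "?inv \<and> ?lin \<and> ?bdd"
    then have *: ?inv ?lin ?bdd by simp_all
    have "\<forall>u\<in>L2_space M. \<forall>v\<in>L2_space M. (AE x in M. u x = v x) \<longrightarrow> (AE x in M. S u x = S v x)"
      by (intro ballI impI) (rule AE[OF *])
    then show "bounded_linear_map M S"
      unfolding bounded_linear_map_def
      by (rule conjI[OF *(1) conjI[OF _ conjI[OF lin_iff[OF *(1), THEN iffD2, OF *(2)] *(3)]]])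
  qed
qed

lemma C0_semigroup_iff:
  "C0_semigroup M T \<longleftrightarrow> semi_hilbert_semigroup (L2_space M) (L2_inner M) T"
proof
  assume C0: "C0_semigroup M T"
  then have bl: "bounded_linear_map M (T t)" if "0 \<le> t" for t
    using that by (simp add: C0_semigroup_def)
  note bl = bl[unfolded bounded_linear_map_iff]
  have X: "T t u \<in> L2_space M" if "0 \<le> t" "u \<in> L2_space M" for t u
    using bl that by blast
  show "semi_hilbert_semigroup (L2_space M) (L2_inner M) T"
  proof (unfold_locales, unfold L2_nrm)
    fix u assume u: "u \<in> L2_space M"
    have "AE x in M. T 0 u x = u x" using C0 u unfolding C0_semigroup_def by blast
    then show "L2_norm M (T 0 u - u) = 0" using L2_null_diff_iff X u by blast
    have "((\<lambda>t. L2_norm M (\<lambda>x. T t u x - u x)) \<longlongrightarrow> 0) (at_right 0)"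
      using C0 u unfolding C0_semigroup_def by blast
    then show "((\<lambda>t. L2_norm M (T t u - u)) \<longlongrightarrow> 0) (at_right 0)" by (simp only: fun_diff_def)
  next
    fix s t u assume stu: "0 \<le> (s::real)" "0 \<le> (t::real)" "u \<in> L2_space M"
    then have "AE x in M. T (s + t) u x = T s (T t u) x" using C0 unfolding C0_semigroup_def by blast
    then show "L2_norm M (T (s + t) u - T s (T t u)) = 0"
      using L2_null_diff_iff[OF X[of "s + t" u] X[of s "T t u"]] X stu by simp
  qed (use bl X in blast)+
next
  assume "semi_hilbert_semigroup (L2_space M) (L2_inner M) T"
  then interpret T: semi_hilbert_semigroup "L2_space M" "L2_inner M" T .
  note T = T.T_X T.T_linear T.T_bounded T.T_zero T.T_add T.T_continuous
  note T = T[unfolded L2_nrm]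
  show "C0_semigroup M T"
    unfolding C0_semigroup_def
  proof (intro conjI allI impI ballI)
    show "bounded_linear_map M (T t)" if "0 \<le> t" for t
      unfolding bounded_linear_map_iff using T(1-3) that by blast
    fix u assume u: "u \<in> L2_space M"
    show "AE x in M. T 0 u x = u x" using T(4)[OF u] L2_null_diff_iff[OF T(1)[of 0 u] u] u by simp
    show "((\<lambda>t. L2_norm M (\<lambda>x. T t u x - u x)) \<longlongrightarrow> 0) (at_right 0)"
      using T(6)[OF u] by (simp only: fun_diff_def)
    show "AE x in M. T (s + t) u x = T s (T t u) x" if "0 \<le> s" "0 \<le> t" for s t
      using T(5)[OF that u] L2_null_diff_iff[OF T(1)[of "s + t" u] T(1)[of s "T t u"]] T(1)[of t u] that u
      by simp
  qed
qed

lemma generator_of_eq: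
  assumes "C0_semigroup M T"
  shows "generator_of M T = semi_hilbert_semigroup.gen (L2_space M) (L2_inner M) T"
proof -
  have "(\<lambda>x. (T t u x - u x) / t - v x) = (1 / t) *\<^sub>R (T t u - u) - v" for t u v
    by (simp add: fun_eq_iff)
  then show ?thesis
    using assms
    by (auto simp: generator_of_def semi_hilbert_semigroup.gen_def C0_semigroup_iff L2_nrm)
qed

lemma semigroup_of:
  assumes "is_generator M L"
  shows "C0_semigroup M (semigroup_of M L)" "generator_of M (semigroup_of M L) = L"
  using someI_ex[OF assms[unfolded is_generator_def]] unfolding semigroup_of_def by auto

lemma linear_operatorD:
  assumes lin: "linear_operator M L" and uv: "(u, v) \<in> L"
  shows "u \<in> L2_space M" "v \<in> L2_space M"
    and "(u', v') \<in> L \<Longrightarrow> (a *\<^sub>R u + b *\<^sub>R u', a *\<^sub>R v + b *\<^sub>R v') \<in> L"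
    and "(u', v') \<in> L \<Longrightarrow> AE x in M. u x = u' x \<Longrightarrow> AE x in M. v x = v' x"
proof -
  show "u \<in> L2_space M" "v \<in> L2_space M" using assms by (auto simp: linear_operator_def)
  assume uv': "(u', v') \<in> L"
  have "\<forall>(u, v)\<in>L. \<forall>(u', v')\<in>L. \<forall>a b.
      ((\<lambda>x. a * u x + b * u' x), (\<lambda>x. a * v x + b * v' x)) \<in> L"
    using lin unfolding linear_operator_def by (elim conjE)
  from this[THEN bspec, OF uv, unfolded split_conv, THEN bspec, OF uv', unfolded split_conv]
  show "(a *\<^sub>R u + b *\<^sub>R u', a *\<^sub>R v + b *\<^sub>R v') \<in> L"
    by (simp add: plus_fun_def scaleR_fun_def)
  have "\<forall>(u, v)\<in>L. \<forall>(u', v')\<in>L. (AE x in M. u x = u' x) \<longrightarrow> (AE x in M. v x = v' x)"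
    using lin unfolding linear_operator_def by (elim conjE)
  from this[THEN bspec, OF uv, unfolded split_conv, THEN bspec, OF uv', unfolded split_conv]
  show "AE x in M. u x = u' x \<Longrightarrow> AE x in M. v x = v' x" by (rule mp)
qed

lemma symmetric_operatorD:
  "symmetric_operator M L \<Longrightarrow> (u, v) \<in> L \<Longrightarrow> (u', v') \<in> L \<Longrightarrow> L2_inner M v u' = L2_inner M u v'"
  by (fastforce simp: symmetric_operator_def adjoint_operator_def)

section \<open>The Friedrichs extension\<close>

lemma operator_form_eq:
  assumes lin: "linear_operator M L" and uw: "(u, w) \<in> L" and v: "v \<in> L2_space M"
  shows "operator_form M L u v = L2_inner M w v"
proof -
  have L: "(u, SOME w. (u, w) \<in> L) \<in> L" by (rule someI[where P = "\<lambda>w. (u, w) \<in> L", OF uw])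
  then have "AE x in M. (SOME w. (u, w) \<in> L) x = w x"
    by (rule linear_operatorD(4)[OF lin _ uw]) simp
  then have "L2_norm M ((SOME w. (u, w) \<in> L) - w) = 0"
    using L2_null_diff_iff linear_operatorD(2)[OF lin L] linear_operatorD(2)[OF lin uw] by blast
  then show ?thesis
    unfolding operator_form_def
    by (intro L2.ip_null_left linear_operatorD(2)[OF lin L] linear_operatorD(2)[OF lin uw] v)
qed

lemma upper_boundedD:
  assumes "upper_bounded M L" "linear_operator M L"
  obtains c where "\<And>u v. (u, v) \<in> L \<Longrightarrow> L2_inner M v u \<le> c * L2_inner M u u"
proof -
  obtain c where c: "\<And>u v. (u, v) \<in> L \<Longrightarrow> \<not> (AE x in M. u x = 0) \<Longrightarrow>
      L2_inner M v u / (L2_norm M u)\<^sup>2 \<le> c"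
    using assms(1) unfolding upper_bounded_def bdd_above_def by blast
  have "L2_inner M v u \<le> c * L2_inner M u u" if uv: "(u, v) \<in> L" for u v
  proof -
    have L2: "u \<in> L2_space M" "v \<in> L2_space M" by (fact linear_operatorD(1,2)[OF assms(2) uv])+
    show ?thesis
    proof (cases "L2_norm M u = 0")
      \<comment> \<open>Null functions are excluded from the supremum; for them both sides vanish by
        Cauchy-Schwarz.\<close>
      case True
      then show ?thesis
        using L2.Cauchy_Schwarz[of v M u] L2.nrm_sq[of u M] L2 by simp
    next
      case False
      then have "L2_inner M v u / (L2_norm M u)\<^sup>2 \<le> c" using c[OF uv] L2 by (simp add: L2_norm_zero_iff)
      moreover have "0 < (L2_norm M u)\<^sup>2" using False by simp
      ultimately show ?thesis using L2.nrm_sq[of u M] L2 by (simp add: pos_divide_le_eq)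
    qed
  qed
  then show ?thesis by (rule that)
qed

lemma friedrichs_extension:
  assumes lin: "linear_operator M L" and dense: "dense_subset_L2 M (Domain L)"
    and sym: "symmetric_operator M L" and ub: "upper_bounded M L"
  shows "linear_operator M (Friedrichs_extension M L)" "L \<subseteq> Friedrichs_extension M L"
    "is_generator M (Friedrichs_extension M L)" "symmetric_operator M (Friedrichs_extension M L)"
proof -
  obtain c where c: "\<And>u v. (u, v) \<in> L \<Longrightarrow> L2_inner M v u \<le> c * L2_inner M u u"
    using upper_boundedD[OF ub lin] by blast
  let ?q = "operator_form M L"
  have L2: "u \<in> L2_space M" "v \<in> L2_space M" if "(u, v) \<in> L" for u v
    by (fact linear_operatorD(1,2)[OF lin that])+
  note q = operator_form_eq[OF lin]
  interpret F: semibounded_form "L2_space M" "L2_inner M" "Domain L" ?q c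
    rewrites nrm: "semi_inner.nrm (L2_inner M) = L2_norm M"
  proof -
    show "semibounded_form (L2_space M) (L2_inner M) (Domain L) ?q c"
    proof
      show "subspace (Domain L)"
      proof (rule subspaceI)
        show "0 \<in> Domain L" using lin by (auto simp: linear_operator_def zero_fun_def)
      next
        fix u v assume "u \<in> Domain L" "v \<in> Domain L"
        then show "u + v \<in> Domain L" using linear_operatorD(3)[OF lin, of u _ v _ 1 1] by fastforce
      next
        fix r :: real and u assume "u \<in> Domain L"
        then show "r *\<^sub>R u \<in> Domain L" using linear_operatorD(3)[OF lin, of u _ u _ r 0] by fastforce
      qed
      show "Domain L \<subseteq> L2_space M" using L2 by auto
    next
      fix u v assume "u \<in> Domain L" "v \<in> Domain L"
      then obtain y z where uv: "(u, y) \<in> L" "(v, z) \<in> L" by blast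
      then show "?q u v = ?q v u"
        using q L2 symmetric_operatorD[OF sym uv] L2.ip_sym[of u M z] by simp
    next
      fix u v w assume "u \<in> Domain L" "v \<in> Domain L" "w \<in> Domain L"
      then obtain y z w' where uv: "(u, y) \<in> L" "(v, z) \<in> L" "(w, w') \<in> L" by blast
      have "(u + v, y + z) \<in> L" using linear_operatorD(3)[OF lin uv(1,2), of 1 1] by simp
      then show "?q (u + v) w = ?q u w + ?q v w"
        using q uv L2 L2.ip_add_left by metis
    next
      fix u v r assume "u \<in> Domain L" "v \<in> Domain L"
      then obtain y z where uv: "(u, y) \<in> L" "(v, z) \<in> L" by blast
      have "(r *\<^sub>R u, r *\<^sub>R y) \<in> L" using linear_operatorD(3)[OF lin uv(1,1), of r 0] by simp
      then show "?q (r *\<^sub>R u) v = r * ?q u v"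
        using q uv L2 L2.ip_scale_left by metis
    next
      fix u assume "u \<in> Domain L"
      then obtain y where "(u, y) \<in> L" by blast
      then show "?q u u \<le> c * L2_inner M u u" using q L2 c by metis
    next
      fix u assume "u \<in> Domain L"
      then obtain y where "(u, y) \<in> L" by blast
      then show "\<exists>w\<in>L2_space M. \<forall>v\<in>Domain L. ?q u v = L2_inner M w v"
        using q L2 by (intro bexI[of _ y]) auto
    qed
  qed (rule L2_nrm)
  have approx: "form_approx M (Domain L) ?q = F.approx"
    by (intro ext) (simp add: form_approx_def F.approx_def fun_diff_def)
  have dom: "closure_domain M (Domain L) ?q = F.cl_dom"
    by (simp add: closure_domain_def F.cl_dom_def approx)
  have form: "closure_form M (Domain L) ?q = F.cl_form"
    by (intro ext) (simp add: closure_form_def F.cl_form_def approx)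
  have eq: "Friedrichs_extension M L = F.friedrichs"
    by (simp add: Friedrichs_extension_def form_operator_def F.friedrichs_def dom form)
  have dense': "\<exists>u'\<in>Domain L. L2_norm M (u - u') < e" if "u \<in> L2_space M" "0 < e" for u e
    using dense that unfolding dense_subset_L2_def by (simp add: fun_diff_def)
  show ext: "L \<subseteq> Friedrichs_extension M L"
  proof (rule subrelI)
    fix u w assume uw: "(u, w) \<in> L"
    then show "(u, w) \<in> Friedrichs_extension M L"
      unfolding eq by (intro F.friedrichs_extends) (use L2 q[OF uw] in auto)
  qed
  obtain T where T: "semi_hilbert_semigroup (L2_space M) (L2_inner M) T"
    "semi_hilbert_semigroup.gen (L2_space M) (L2_inner M) T = F.friedrichs"
    using F.friedrichs_generates dense' by blast
  then show "is_generator M (Friedrichs_extension M L)"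
    unfolding is_generator_def eq using generator_of_eq[of M T] by (auto simp: C0_semigroup_iff)
  show "symmetric_operator M (Friedrichs_extension M L)"
    unfolding symmetric_operator_def adjoint_operator_def eq
    using F.friedrichs_X F.friedrichs_symmetric by auto
  have lincomb: "((\<lambda>x. r * u x + s * u' x), (\<lambda>x. r * v x + s * v' x)) \<in> F.friedrichs"
    if "(u, v) \<in> F.friedrichs" "(u', v') \<in> F.friedrichs" for u v u' v' r s
    using F.friedrichs_linear[OF that, of r s] by (simp add: plus_fun_def scaleR_fun_def)
  have single: "AE x in M. v x = v' x"
    if F: "(u, v) \<in> F.friedrichs" "(u', v') \<in> F.friedrichs" and AE: "AE x in M. u x = u' x" for u v u' v'
  proof -
    have "L2_norm M (u - u') = 0" using L2_null_diff_iff F.friedrichs_X F AE by blast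
    then have "L2_norm M (v - v') = 0" using F.friedrichs_single_valued[OF dense' F] by blast
    then show ?thesis using L2_null_diff_iff F.friedrichs_X F by blast
  qed
  have saturated: "(u', v') \<in> F.friedrichs"
    if F: "(u, v) \<in> F.friedrichs" and L2': "u' \<in> L2_space M" "v' \<in> L2_space M"
      and AE: "AE x in M. u x = u' x" "AE x in M. v x = v' x" for u v u' v'
  proof -
    have "L2_norm M (u - u') = 0" "L2_norm M (v - v') = 0"
      using L2_null_diff_iff F.friedrichs_X AE F L2' by blast+
    then show ?thesis using F.friedrichs_saturated[OF F L2'] by blast
  qed
  show "linear_operator M (Friedrichs_extension M L)"
    unfolding linear_operator_def
  proof (intro conjI)
    show "Friedrichs_extension M L \<subseteq> L2_space M \<times> L2_space M"
      unfolding eq using F.friedrichs_X by auto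
    show "((\<lambda>x. 0), (\<lambda>x. 0)) \<in> Friedrichs_extension M L"
      using ext lin unfolding linear_operator_def by blast
    show "\<forall>(u, v)\<in>Friedrichs_extension M L. \<forall>(u', v')\<in>Friedrichs_extension M L. \<forall>a b.
        ((\<lambda>x. a * u x + b * u' x), (\<lambda>x. a * v x + b * v' x)) \<in> Friedrichs_extension M L"
      unfolding eq by (intro ballI case_prodI2 allI impI; hypsubst; rule lincomb)
    show "\<forall>(u, v)\<in>Friedrichs_extension M L. \<forall>(u', v')\<in>Friedrichs_extension M L.
        (AE x in M. u x = u' x) \<longrightarrow> (AE x in M. v x = v' x)"
      unfolding eq by (intro ballI case_prodI2 allI impI; hypsubst; rule single)
    show "\<forall>(u, v)\<in>Friedrichs_extension M L. \<forall>u'\<in>L2_space M. \<forall>v'\<in>L2_space M.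
        (AE x in M. u x = u' x) \<longrightarrow> (AE x in M. v x = v' x) \<longrightarrow> (u', v') \<in> Friedrichs_extension M L"
      unfolding eq by (intro ballI case_prodI2 allI impI; hypsubst; rule saturated)
  qed
qed

section \<open>Uniqueness\<close>

text \<open>The truncation \<open>min (max w 0) 1\<close> is an admissible test function whose
  product with \<open>w\<close> is nonnegative. Its integral vanishes, which forces
  \<open>w \<le> 0\<close> almost everywhere, and likewise for \<open>- w\<close>.\<close>

lemma L2_null_by_unit_functions:
  assumes w: "w \<in> L2_space M"
    and orth: "\<And>u. u \<in> L2_space M \<Longrightarrow> AE x in M. 0 \<le> u x \<and> u x \<le> 1 \<Longrightarrow> L2_inner M w u = 0"
  shows "L2_norm M w = 0"
proof -
  have pos: "AE x in M. w x \<le> 0"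
    if w: "w \<in> L2_space M"
      and orth: "\<And>u. u \<in> L2_space M \<Longrightarrow> AE x in M. 0 \<le> u x \<and> u x \<le> 1 \<Longrightarrow> L2_inner M w u = 0" for w
  proof -
    define u where "u x = min (max (w x) 0) 1" for x
    have "u \<in> borel_measurable M" unfolding u_def using L2_measurable[OF w] by measurable
    moreover have "integrable M (\<lambda>x. (u x)\<^sup>2)"
    proof (rule Bochner_Integration.integrable_bound)
      show "integrable M (\<lambda>x. (w x)\<^sup>2)" using w by (simp add: L2_space_def)
      have "(u x)\<^sup>2 \<le> (w x)\<^sup>2" for x by (rule abs_le_square_iff[THEN iffD1]) (auto simp: u_def)
      then show "AE x in M. norm ((u x)\<^sup>2) \<le> norm ((w x)\<^sup>2)" by simp
    qed (use \<open>u \<in> borel_measurable M\<close> in measurable)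
    ultimately have u: "u \<in> L2_space M" by (simp add: L2_space_def)
    have "L2_inner M w u = 0" by (rule orth[OF u]) (simp add: u_def)
    then have "(LINT x|M. w x * u x) = 0" by (simp add: L2_inner_def)
    moreover have "0 \<le> w x * u x" for x by (auto simp: u_def min_def max_def)
    ultimately have "AE x in M. w x * u x = 0"
      using integral_nonneg_eq_0_iff_AE[OF L2_mult_integrable[OF w u]] by simp
    then show ?thesis by eventually_elim (auto simp: u_def min_def max_def split: if_splits)
  qed
  have "AE x in M. (- w) x \<le> 0"
  proof (rule pos)
    show "L2_inner M (- w) u = 0" if "u \<in> L2_space M" "AE x in M. 0 \<le> u x \<and> u x \<le> 1" for u
      using orth[OF that] that w by (simp add: L2.ip_minus_left)
  qed (rule L2.X_closed(4)[OF w])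
  moreover have "AE x in M. w x \<le> 0" using pos w orth by blast
  ultimately have "AE x in M. w x = 0" by eventually_elim simp
  then show ?thesis using L2_norm_zero_iff[OF w] by simp
qed

text \<open>Links the Lebesgue integral of the density hypothesis with the gauge integral, to which
  the fundamental theorem of calculus is applied.\<close>

lemma interval_Lebesgue:
  fixes f :: "real \<Rightarrow> real"
  assumes "continuous_on {0..b} f"
  shows "integrable (restrict_space lborel {0..b}) f"
    and "(LINT t|restrict_space lborel {0..b}. f t) = integral {0..b} f"
  using borel_integrable_atLeastAtMost'[OF assms] set_borel_integral_eq_integral(2)[of "{0..b}" f]
  by (simp_all add: integrable_restrict_space integral_restrict_space set_integrable_def
      set_lebesgue_integral_def)

text \<open>Testing against \<open>f' \<otimes> \<phi> + f \<otimes> \<psi>\<close> gives the integral of the derivative of \<open>f (d, \<phi>)\<close>.  Hence the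
  bounded function \<open>d\<close> annihilates a dense subspace of \<open>L\<^sup>1\<close>; pairing with \<open>k \<otimes> \<phi>\<close>,
  \<open>k = (d, \<phi>)\<close>, shows that \<open>k\<close> vanishes, and no joint measurability of \<open>d\<close> is needed.\<close>

lemma bounded_weak_solution_zero:
  assumes "sigma_finite_measure M" and lin: "linear_operator M L" and range: "Range L \<subseteq> L1_space M"
    and b: "0 < b"
    and dense: "dense_subset_L1 (restrict_space lborel {0..b} \<Otimes>\<^sub>M M) (fun_span (parabolic_range b L))"
    and d: "\<And>t. t \<in> {0..b} \<Longrightarrow> d t \<in> L2_space M"
    and d_le: "\<And>t. t \<in> {0..b} \<Longrightarrow> AE x in M. \<bar>d t x\<bar> \<le> 1"
    and d0: "L2_norm M (d 0) = 0"
    and deriv: "\<And>\<phi> \<psi> t. (\<phi>, \<psi>) \<in> L \<Longrightarrow> t \<in> {0..b} \<Longrightarrow>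
      ((\<lambda>s. L2_inner M (d s) \<phi>) has_real_derivative L2_inner M (d t) \<psi>) (at t within {0..b})"
    and cont: "\<And>w. w \<in> L2_space M \<Longrightarrow> continuous_on {0..b} (\<lambda>t. L2_inner M (d t) w)"
    and \<phi>\<psi>: "(\<phi>, \<psi>) \<in> L" and t: "t \<in> {0..b}"
  shows "L2_inner M (d t) \<phi> = 0"
proof -
  define \<mu> where "\<mu> = restrict_space lborel {0..b}"
  interpret M: sigma_finite_measure M by fact
  interpret \<mu>: sigma_finite_measure \<mu>
    unfolding \<mu>_def by (intro sigma_finite_measure_restrict_space sigma_finite_lborel) auto
  interpret P: pair_sigma_finite \<mu> M ..
  note dense = dense[folded \<mu>_def]
  note Leb = interval_Lebesgue[of b, folded \<mu>_def]
  have space: "space \<mu> = {0..b}" by (simp add: \<mu>_def space_restrict_space)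
  have L2: "\<phi> \<in> L2_space M" "\<psi> \<in> L2_space M" if "(\<phi>, \<psi>) \<in> L" for \<phi> \<psi>
    by (fact linear_operatorD(1,2)[OF lin that])+
  have \<psi>1: "integrable M \<psi>" if "(\<phi>, \<psi>) \<in> L" for \<phi> \<psi> using range that by (auto simp: L1_space_def)
  \<comment> \<open>Only \<open>\<psi>\<close> is assumed integrable. For \<open>\<phi>\<close>,
    integrability is extracted from the density hypothesis, which places the parabolic range in
    \<open>L^1\<close> of the product: with \<open>f t = b - t\<close>, almost every time slice
    \<open>(b - t) \<psi> - \<phi>\<close> is integrable, and \<open>b > 0\<close> guarantees that
    such a slice exists.\<close>
  have \<phi>1: "integrable M \<phi>" if \<phi>\<psi>: "(\<phi>, \<psi>) \<in> L" for \<phi> \<psi>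
  proof -
    let ?h = "\<lambda>z. ((\<lambda>_. - 1) \<otimes>\<^sub>t \<phi>) z + ((\<lambda>t. b - t) \<otimes>\<^sub>t \<psi>) z"
    have "C1_with_deriv b (\<lambda>t. b - t) (\<lambda>_. - 1)"
      unfolding C1_with_deriv_def by (auto intro!: derivative_eq_intros)
    then have h: "?h \<in> parabolic_range b L" using \<phi>\<psi> unfolding parabolic_range_def by fastforce
    have "?h \<in> fun_span (parabolic_range b L)"
      unfolding fun_span_def using h
      by (intro CollectI exI[of _ 1] exI[of _ "\<lambda>_. 1"] exI[of _ "\<lambda>_. ?h"]) auto
    then have "integrable (\<mu> \<Otimes>\<^sub>M M) ?h" using dense by (auto simp: dense_subset_L1_def L1_space_def)
    then have "AE t in \<mu>. integrable M (\<lambda>x. ?h (t, x))" by (rule P.AE_integrable_fst')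
    moreover have "ae_filter \<mu> \<noteq> bot"
      unfolding ae_filter_eq_bot_iff space using b by (simp add: \<mu>_def emeasure_restrict_space)
    ultimately obtain t where "integrable M (\<lambda>x. ?h (t, x))"
      using eventually_happens by blast
    then have "integrable M (\<lambda>x. (b - t) * \<psi> x - ?h (t, x))"
      by (intro Bochner_Integration.integrable_diff integrable_mult_right \<psi>1[OF \<phi>\<psi>])
    then show ?thesis by (simp add: tensor_def)
  qed
  define k where "k t = L2_inner M (d t) \<phi>" for t
  have k_cont: "continuous_on {0..b} k" unfolding k_def by (rule cont[OF L2(1)[OF \<phi>\<psi>]])
  have kint: "integrable (\<mu> \<Otimes>\<^sub>M M) (k \<otimes>\<^sub>t \<phi>)"
  proof (rule P.Fubini_integrable)
    have [measurable]: "k \<in> borel_measurable \<mu>" "\<phi> \<in> borel_measurable M"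
      using Leb(1)[OF k_cont] \<phi>1[OF \<phi>\<psi>] by auto
    show "k \<otimes>\<^sub>t \<phi> \<in> borel_measurable (\<mu> \<Otimes>\<^sub>M M)" unfolding tensor_def by measurable
    have "continuous_on {0..b} (\<lambda>t. \<bar>k t\<bar> * (LINT x|M. \<bar>\<phi> x\<bar>))"
      by (intro continuous_intros k_cont)
    from Leb(1)[OF this]
    show "integrable \<mu> (\<lambda>t. LINT x|M. norm ((k \<otimes>\<^sub>t \<phi>) (t, x)))" by (simp add: tensor_def abs_mult)
    show "AE t in \<mu>. integrable M (\<lambda>x. (k \<otimes>\<^sub>t \<phi>) (t, x))"
      using \<phi>1[OF \<phi>\<psi>] by (simp add: tensor_def)
  qed
  \<comment> \<open>Let \<open>g\<close> approximate the tensor product of \<open>k\<close> and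
    \<open>\<phi>\<close> in \<open>L^1\<close>. Pairing time slices with \<open>d t\<close> turns
    the tensor product into \<open>(k t)^2\<close> and \<open>g\<close> into a function with time
    integral 0; since \<open>d\<close> is bounded by 1, the error is at most the \<open>L^1\<close>
    distance.\<close>
  have small: "integral {0..b} (\<lambda>t. (k t)\<^sup>2) < e" if e: "0 < e" for e
  proof -
    obtain g where g: "g \<in> fun_span (parabolic_range b L)"
      and ge: "L1_norm (\<mu> \<Otimes>\<^sub>M M) (\<lambda>z. (k \<otimes>\<^sub>t \<phi>) z - g z) < e"
      using dense e kint unfolding dense_subset_L1_def L1_space_def by blast
    obtain n :: nat and c G where g_eq: "g = (\<lambda>z. \<Sum>i<n. c i * G i z)"
      and G: "\<And>i. i < n \<Longrightarrow> G i \<in> parabolic_range b L"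
      using g unfolding fun_span_def by blast
    define Q where "Q i f f' p q \<longleftrightarrow> G i = (\<lambda>z. (f' \<otimes>\<^sub>t p) z + (f \<otimes>\<^sub>t q) z) \<and>
      (p, q) \<in> L \<and> C1_with_deriv b f f' \<and> f b = 0" for i f f' p q
    have "\<exists>f f' p q. Q i f f' p q" if "i < n" for i
      using G[OF that] unfolding parabolic_range_def Q_def by blast
    then obtain f f' p q where Q: "\<And>i. i < n \<Longrightarrow> Q i (f i) (f' i) (p i) (q i)" by metis
    then have G_eq: "\<And>i. i < n \<Longrightarrow> G i = (\<lambda>z. (f' i \<otimes>\<^sub>t p i) z + (f i \<otimes>\<^sub>t q i) z)"
      and pq: "\<And>i. i < n \<Longrightarrow> (p i, q i) \<in> L" and C1: "\<And>i. i < n \<Longrightarrow> C1_with_deriv b (f i) (f' i)"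
      and fb: "\<And>i. i < n \<Longrightarrow> f i b = 0"
      unfolding Q_def by blast+
    define \<alpha> where "\<alpha> i t = L2_inner M (d t) (p i)" for i t
    define \<beta> where "\<beta> i t = L2_inner M (d t) (q i)" for i t
    define h where "h i t = f' i t * \<alpha> i t + f i t * \<beta> i t" for i t
    define R where "R t = (\<lambda>x. (k \<otimes>\<^sub>t \<phi>) (t, x) - g (t, x))" for t
    have f_deriv: "(f i has_real_derivative f' i t) (at t within {0..b})" if "i < n" "t \<in> {0..b}" for i t
      using C1[OF that(1)] that(2) by (simp add: C1_with_deriv_def)
    have f_cont: "continuous_on {0..b} (f i)" "continuous_on {0..b} (f' i)" if "i < n" for i
    proof -
      show "continuous_on {0..b} (f i)" by (rule DERIV_continuous_on[OF f_deriv[OF that]])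
      show "continuous_on {0..b} (f' i)" using C1[OF that] by (simp add: C1_with_deriv_def)
    qed
    have \<alpha>\<beta>_cont: "continuous_on {0..b} (\<alpha> i)" "continuous_on {0..b} (\<beta> i)" if "i < n" for i
      unfolding \<alpha>_def \<beta>_def by (intro cont L2(1)[OF pq[OF that]] L2(2)[OF pq[OF that]])+
    have h_cont: "continuous_on {0..b} (h i)" if "i < n" for i
      unfolding h_def by (intro continuous_intros f_cont \<alpha>\<beta>_cont that)
    \<comment> \<open>The boundary terms vanish because \<open>f i b = 0\<close> and
      \<open>d 0\<close> is null.\<close>
    have h_int: "(h i has_integral 0) {0..b}" if i: "i < n" for i
    proof -
      have "(h i has_integral f i b * \<alpha> i b - f i 0 * \<alpha> i 0) {0..b}"
      proof (rule fundamental_theorem_of_calculus)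
        fix t assume t: "t \<in> {0..b}"
        have "((\<lambda>s. f i s * \<alpha> i s) has_real_derivative h i t) (at t within {0..b})"
          unfolding h_def \<alpha>_def \<beta>_def
          by (rule DERIV_cong[OF DERIV_mult[OF f_deriv[OF i t] deriv[OF pq[OF i] t]]]) simp
        then show "((\<lambda>s. f i s * \<alpha> i s) has_vector_derivative h i t) (at t within {0..b})"
          by (simp add: has_real_derivative_iff_has_vector_derivative)
      qed (use b in simp)
      moreover have "\<alpha> i 0 = 0"
        using L2.Cauchy_Schwarz[OF d L2(1)[OF pq[OF i]], of 0] d0 b by (simp add: \<alpha>_def)
      ultimately show ?thesis using fb[OF i] by simp
    qed
    \<comment> \<open>\<open>W n t\<close> is the slice of \<open>g\<close> at time
      \<open>t\<close>, written as a vector of \<open>L^2\<close> so that it can be paired with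
      \<open>d t\<close> for each fixed \<open>t\<close>.\<close>
    define W where "W m t = (\<Sum>i<m. c i *\<^sub>R (f' i t *\<^sub>R p i + f i t *\<^sub>R q i))" for m t
    have W_Suc: "W (Suc m) t = W m t + c m *\<^sub>R (f' m t *\<^sub>R p m + f m t *\<^sub>R q m)" for m t
      unfolding W_def by (rule sum.lessThan_Suc)
    have W_apply: "W m t x = (\<Sum>i<m. c i * (f' i t * p i x + f i t * q i x))" for m t x
      by (induction m) (simp_all add: W_Suc, simp add: W_def)
    have R_eq: "R t = k t *\<^sub>R \<phi> - W n t" for t
      by (rule ext) (simp add: W_apply R_def g_eq G_eq tensor_def)
    have W: "W m t \<in> L2_space M \<and> (t \<in> {0..b} \<longrightarrow> L2_inner M (d t) (W m t) = (\<Sum>i<m. c i * h i t))"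
      if "m \<le> n" for m t
      using that
    proof (induction m)
      case 0
      show ?case by (simp add: W_def L2_inner_def L2_space_def)
    next
      case (Suc m)
      let ?r = "f' m t *\<^sub>R p m + f m t *\<^sub>R q m"
      have s: "W m t \<in> L2_space M" and s_eq: "t \<in> {0..b} \<Longrightarrow> L2_inner M (d t) (W m t) = (\<Sum>i<m. c i * h i t)"
        using Suc.IH[OF Suc_leD[OF Suc.prems]] by blast+
      have pqL2: "p m \<in> L2_space M" "q m \<in> L2_space M" using L2 pq[of m] Suc.prems by auto
      have r: "?r \<in> L2_space M" by (intro L2.X_closed pqL2)
      have "L2_inner M (d t) (W (Suc m) t) = (\<Sum>i<Suc m. c i * h i t)" if t: "t \<in> {0..b}"
      proof -
        have "L2_inner M (d t) ?r = h m t"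
          unfolding h_def \<alpha>_def \<beta>_def
          by (simp only: L2.ip_add_right L2.ip_scale_right L2.X_closed pqL2 d[OF t])
        moreover have "L2_inner M (d t) (W (Suc m) t) = L2_inner M (d t) (W m t) + c m * L2_inner M (d t) ?r"
          unfolding W_Suc by (simp only: L2.ip_add_right L2.ip_scale_right L2.X_closed s r d[OF t])
        ultimately show ?thesis by (simp only: s_eq[OF t] sum.lessThan_Suc)
      qed
      moreover have "W (Suc m) t \<in> L2_space M" unfolding W_Suc by (intro L2.X_closed s r)
      ultimately show ?case by blast
    qed
    have R_L2: "R t \<in> L2_space M" for t
      unfolding R_eq using W[OF order_refl] L2(1)[OF \<phi>\<psi>] by (intro L2.X_closed) auto
    have dR: "L2_inner M (d t) (R t) = (k t)\<^sup>2 - (\<Sum>i<n. c i * h i t)" if t: "t \<in> {0..b}" for t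
    proof -
      have "L2_inner M (d t) (R t) = k t * k t - L2_inner M (d t) (W n t)"
        unfolding R_eq k_def using W[OF order_refl, of t] L2(1)[OF \<phi>\<psi>] d[OF t]
        by (simp only: L2.ip_diff_right L2.ip_scale_right L2.X_closed)
      then show ?thesis using W[OF order_refl, of t] t by (simp add: power2_eq_square)
    qed
    have g_int: "integrable (\<mu> \<Otimes>\<^sub>M M) g" using dense g by (auto simp: dense_subset_L1_def L1_space_def)
    have R_int: "integrable (\<mu> \<Otimes>\<^sub>M M) (\<lambda>z. \<bar>(k \<otimes>\<^sub>t \<phi>) z - g z\<bar>)"
      by (intro integrable_abs Bochner_Integration.integrable_diff kint g_int)
    \<comment> \<open>The left-hand side is \<open>L2_inner M (d t) (R t)\<close>, and
      \<open>d t\<close> is bounded by 1.\<close>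
    have le: "\<bar>(k t)\<^sup>2 - (\<Sum>i<n. c i * h i t)\<bar> \<le> (LINT x|M. \<bar>(k \<otimes>\<^sub>t \<phi>) (t, x) - g (t, x)\<bar>)"
      if t: "t \<in> {0..b}" for t
    proof -
      have "integrable M (\<lambda>x. (k \<otimes>\<^sub>t \<phi>) (t, x) - g (t, x))"
        unfolding g_eq using \<phi>1[OF \<phi>\<psi>] \<phi>1[OF pq] \<psi>1[OF pq]
        by (intro Bochner_Integration.integrable_diff Bochner_Integration.integrable_sum integrable_mult_right)
          (auto simp: tensor_def G_eq)
      then have "integrable M (R t)" by (simp add: R_def)
      moreover have "integrable M (\<lambda>x. d t x * R t x)" by (rule L2_mult_integrable[OF d[OF t] R_L2])
      moreover have "AE x in M. \<bar>d t x * R t x\<bar> \<le> \<bar>R t x\<bar>"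
        using d_le[OF t]
      proof eventually_elim
        case (elim x)
        then show ?case using mult_right_mono[of "\<bar>d t x\<bar>" 1 "\<bar>R t x\<bar>"] by (simp add: abs_mult)
      qed
      ultimately have "(LINT x|M. \<bar>d t x * R t x\<bar>) \<le> (LINT x|M. \<bar>R t x\<bar>)"
        by (intro integral_mono_AE integrable_abs)
      moreover have "\<bar>LINT x|M. d t x * R t x\<bar> \<le> (LINT x|M. \<bar>d t x * R t x\<bar>)"
        by (rule integral_abs_bound)
      ultimately have "\<bar>L2_inner M (d t) (R t)\<bar> \<le> (LINT x|M. \<bar>R t x\<bar>)" unfolding L2_inner_def by linarith
      then show ?thesis unfolding dR[OF t] by (simp add: R_def)
    qed
    have sum_int: "((\<lambda>t. \<Sum>i<n. c i * h i t) has_integral 0) {0..b}"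
      using has_integral_sum[of "{..<n}" "\<lambda>i t. c i * h i t" "\<lambda>i. c i * 0" "{0..b}"]
        has_integral_mult_right[OF h_int] by simp
    have k2_cont: "continuous_on {0..b} (\<lambda>t. (k t)\<^sup>2)" by (intro continuous_intros k_cont)
    have diff_cont: "continuous_on {0..b} (\<lambda>t. (k t)\<^sup>2 - (\<Sum>i<n. c i * h i t))"
      by (intro continuous_intros k_cont h_cont) auto
    have "integral {0..b} (\<lambda>t. (k t)\<^sup>2) = integral {0..b} (\<lambda>t. (k t)\<^sup>2 - (\<Sum>i<n. c i * h i t))"
      using sum_int integrable_continuous_real[OF k2_cont]
      by (simp add: Henstock_Kurzweil_Integration.integral_diff has_integral_integrable_integral)
    also have "\<dots> = (LINT t|\<mu>. (k t)\<^sup>2 - (\<Sum>i<n. c i * h i t))" by (rule Leb(2)[OF diff_cont, symmetric])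
    also have "\<dots> \<le> (LINT t|\<mu>. LINT x|M. \<bar>(k \<otimes>\<^sub>t \<phi>) (t, x) - g (t, x)\<bar>)"
    proof (rule integral_mono)
      show "integrable \<mu> (\<lambda>t. LINT x|M. \<bar>(k \<otimes>\<^sub>t \<phi>) (t, x) - g (t, x)\<bar>)"
        by (rule P.integrable_fst'[OF R_int])
      show "(k t)\<^sup>2 - (\<Sum>i<n. c i * h i t) \<le> (LINT x|M. \<bar>(k \<otimes>\<^sub>t \<phi>) (t, x) - g (t, x)\<bar>)"
        if "t \<in> space \<mu>" for t
        using le[of t] that by (simp add: space)
    qed (rule Leb(1)[OF diff_cont])
    also have "\<dots> = L1_norm (\<mu> \<Otimes>\<^sub>M M) (\<lambda>z. (k \<otimes>\<^sub>t \<phi>) z - g z)"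
      unfolding L1_norm_def by (rule P.integral_fst'[OF R_int])
    also have "\<dots> < e" by (rule ge)
    finally show ?thesis .
  qed
  have k2_cont: "continuous_on {0..b} (\<lambda>t. (k t)\<^sup>2)" by (intro continuous_intros k_cont)
  have "integral {0..b} (\<lambda>t. (k t)\<^sup>2) \<le> 0" using small by (meson linorder_not_less less_irrefl)
  moreover have "0 \<le> integral {0..b} (\<lambda>t. (k t)\<^sup>2)"
    by (intro Henstock_Kurzweil_Integration.integral_nonneg integrable_continuous_real k2_cont) simp
  ultimately have "\<forall>t\<in>{0..b}. (k t)\<^sup>2 = 0"
    using integral_eq_0_iff[OF k2_cont b] by simp
  then show ?thesis using t by (simp add: k_def)
qed

lemma M_sym_Markov_unique:
  assumes sf: "sigma_finite_measure M"
    and lin: "linear_operator M L\<^sub>0"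
    and dense: "dense_subset_L2 M (Domain L\<^sub>0)"
    and range: "Range L\<^sub>0 \<subseteq> L1_space M"
    and parabolic: "\<And>b. 0 < b \<Longrightarrow>
      dense_subset_L1 (restrict_space lborel {0..b} \<Otimes>\<^sub>M M) (fun_span (parabolic_range b L\<^sub>0))"
    and L: "L \<in> M_sym_Markov M L\<^sub>0" "L' \<in> M_sym_Markov M L\<^sub>0"
  shows "L = L'"
proof -
  have dense': "\<exists>v\<in>Domain L\<^sub>0. L2_norm M (u - v) < e" if "u \<in> L2_space M" "0 < e" for u e
    using dense that unfolding dense_subset_L2_def by (simp add: fun_diff_def)
  have L0_L2: "\<phi> \<in> L2_space M" "\<psi> \<in> L2_space M" if "(\<phi>, \<psi>) \<in> L\<^sub>0" for \<phi> \<psi>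
    by (fact linear_operatorD(1,2)[OF lin that])+
  define T where "T = semigroup_of M L"
  define T' where "T' = semigroup_of M L'"
  have props: "C0_semigroup M (semigroup_of M L)" "generator_of M (semigroup_of M L) = L"
      "symmetric_operator M L" "L\<^sub>0 \<subseteq> L" "sub_Markovian M (semigroup_of M L)"
    if "L \<in> M_sym_Markov M L\<^sub>0" for L
    using that semigroup_of[of M L] by (auto simp: M_sym_Markov_def)
  note p = props[OF L(1), folded T_def] and p' = props[OF L(2), folded T'_def]
  interpret T: semi_hilbert_semigroup "L2_space M" "L2_inner M" T
    rewrites "semi_inner.nrm (L2_inner M) = L2_norm M"
    using p(1) by (simp_all only: C0_semigroup_iff L2_nrm)
  interpret T': semi_hilbert_semigroup "L2_space M" "L2_inner M" T'
    rewrites "semi_inner.nrm (L2_inner M) = L2_norm M"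
    using p'(1) by (simp_all only: C0_semigroup_iff L2_nrm)
  have gen: "T.gen = L" "T'.gen = L'" using p p' generator_of_eq by metis+
  have sym: "L2_inner M (T t u) w = L2_inner M u (T t w)"
    if "0 \<le> t" "u \<in> L2_space M" "w \<in> L2_space M" for t u w
  proof (rule T.T_symmetric)
    show "\<exists>(u', v)\<in>T.gen. L2_norm M (u - u') < e" if "u \<in> L2_space M" "0 < e" for u e
      using dense'[OF that] p(4) gen by blast
    show "L2_inner M v u' = L2_inner M u v'" if "(u, v) \<in> T.gen" "(u', v') \<in> T.gen" for u v u' v'
      using symmetric_operatorD[OF p(3)] that gen by blast
  qed (use that in auto)
  have sym': "L2_inner M (T' t u) w = L2_inner M u (T' t w)"
    if "0 \<le> t" "u \<in> L2_space M" "w \<in> L2_space M" for t u w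
  proof (rule T'.T_symmetric)
    show "\<exists>(u', v)\<in>T'.gen. L2_norm M (u - u') < e" if "u \<in> L2_space M" "0 < e" for u e
      using dense'[OF that] p'(4) gen by blast
    show "L2_inner M v u' = L2_inner M u v'" if "(u, v) \<in> T'.gen" "(u', v') \<in> T'.gen" for u v u' v'
      using symmetric_operatorD[OF p'(3)] that gen by blast
  qed (use that in auto)
  \<comment> \<open>Sub-Markovianity speaks only about such \<open>u\<close>. Both orbits take
    values in \<open>[0, 1]\<close>, so their difference \<open>d\<close> is bounded by 1.\<close>
  have unit: "L2_norm M (T t u - T' t u) = 0"
    if t: "0 \<le> t" and u: "u \<in> L2_space M" and u1: "AE x in M. 0 \<le> u x \<and> u x \<le> 1" for t u
  proof -
    define d where "d s = T s u - T' s u" for s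
    have d_L2: "d s \<in> L2_space M" if "0 \<le> s" for s using that u by (simp add: d_def)
    have d_eq: "L2_inner M (d s) w = L2_inner M u (T s w) - L2_inner M u (T' s w)"
      if "0 \<le> s" "w \<in> L2_space M" for s w
      using that u sym sym' by (simp add: d_def L2.ip_diff_left)
    \<comment> \<open>Positive even for \<open>t = 0\<close>, and \<open>{0..b}\<close> contains
      \<open>t\<close>.\<close>
    define b where "b = t + 1"
    have sub: "{0..b} \<subseteq> {0..}" by auto
    have "L2_inner M (d t) \<phi> = 0" if \<phi>: "\<phi> \<in> Domain L\<^sub>0" for \<phi>
    proof -
      obtain \<psi> where \<phi>\<psi>: "(\<phi>, \<psi>) \<in> L\<^sub>0" using \<phi> by blast
      show ?thesis
      proof (rule bounded_weak_solution_zero[OF sf lin range _ parabolic, of b])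
        show "0 < b" "0 < b" "t \<in> {0..b}" using t by (auto simp: b_def)
        show "(\<phi>, \<psi>) \<in> L\<^sub>0" by (rule \<phi>\<psi>)
        show "d s \<in> L2_space M" if "s \<in> {0..b}" for s using d_L2 that by simp
        show "AE x in M. \<bar>d s x\<bar> \<le> 1" if s: "s \<in> {0..b}" for s
        proof -
          have "AE x in M. 0 \<le> T s u x \<and> T s u x \<le> 1" "AE x in M. 0 \<le> T' s u x \<and> T' s u x \<le> 1"
            using p(5) p'(5) s u u1 unfolding sub_Markovian_def by auto
          then show ?thesis by eventually_elim (auto simp: d_def)
        qed
        have "d 0 = (T 0 u - u) - (T' 0 u - u)" by (simp add: d_def)
        then have "L2_norm M (d 0) \<le> 0"
          using L2.nrm_triangle_diff[of "T 0 u - u" M "T' 0 u - u"] T.T_zero[OF u] T'.T_zero[OF u] u by simp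
        then show "L2_norm M (d 0) = 0" using d_L2[of 0] by (intro antisym L2.nrm_nonneg) auto
      next
        fix \<phi> \<psi> s assume \<phi>\<psi>: "(\<phi>, \<psi>) \<in> L\<^sub>0" and s: "s \<in> {0..b}"
        have "((\<lambda>r. L2_inner M u (T r \<phi>)) has_real_derivative L2_inner M u (T s \<psi>)) (at s within {0..})"
          by (rule T.weak_derivative) (use \<phi>\<psi> p(4) gen u s in auto)
        moreover have "((\<lambda>r. L2_inner M u (T' r \<phi>)) has_real_derivative L2_inner M u (T' s \<psi>)) (at s within {0..})"
          by (rule T'.weak_derivative) (use \<phi>\<psi> p'(4) gen u s in auto)
        ultimately have "((\<lambda>r. L2_inner M u (T r \<phi>) - L2_inner M u (T' r \<phi>)) has_real_derivative
            L2_inner M (d s) \<psi>) (at s within {0..b})"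
          using d_eq[of s \<psi>] L0_L2[OF \<phi>\<psi>] s by (auto intro!: DERIV_diff DERIV_subset[OF _ sub])
        then show "((\<lambda>r. L2_inner M (d r) \<phi>) has_real_derivative L2_inner M (d s) \<psi>) (at s within {0..b})"
          by (rule has_field_derivative_transform_within[OF _ zero_less_one s])
            (use d_eq L0_L2[OF \<phi>\<psi>] in auto)
      next
        fix w assume w: "w \<in> L2_space M"
        have "continuous_on {0..b} (\<lambda>s. L2_inner M u (T s w) - L2_inner M u (T' s w))"
          by (intro continuous_on_diff continuous_on_subset[OF T.weak_continuous sub]
              continuous_on_subset[OF T'.weak_continuous sub] u w)
        then show "continuous_on {0..b} (\<lambda>s. L2_inner M (d s) w)"
          by (rule continuous_on_eq) (use d_eq w in auto)
      qed
    qed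
    then have "L2_norm M (d t) = 0"
      by (intro L2.null_by_orthogonality[of "Domain L\<^sub>0"]) (use dense' d_L2 t L0_L2 in auto)
    then show ?thesis by (simp add: d_def)
  qed
  \<comment> \<open>Symmetry moves the difference of the semigroups from \<open>v\<close> to the
    test function \<open>u\<close>, for which \<open>unit\<close> applies; thus a general
    \<open>v\<close> is reached without decomposing or approximating it.\<close>
  have "L2_norm M (T t v - T' t v) = 0" if t: "0 \<le> t" and v: "v \<in> L2_space M" for t v
  proof (rule L2_null_by_unit_functions)
    fix u assume u: "u \<in> L2_space M" and u1: "AE x in M. 0 \<le> u x \<and> u x \<le> 1"
    have "L2_inner M (T t v - T' t v) u = L2_inner M v (T t u - T' t u)"
      using t u v by (simp add: L2.ip_diff_left L2.ip_diff_right sym sym')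
    then show "L2_inner M (T t v - T' t v) u = 0"
      using L2.Cauchy_Schwarz[of v M "T t u - T' t u"] unit[OF t u u1] t u v by simp
  qed (use t v in simp)
  then have "T.gen = T'.gen"
    using T.gen_cong[OF T'.semi_hilbert_semigroup_axioms] by simp
  then show ?thesis using gen by simp
qed

theorem proposition2p3:
  fixes M :: "'a measure" and L\<^sub>0 :: "'a operator"
  assumes "sigma_finite_measure M"
    and "linear_operator M L\<^sub>0"
    and "dense_subset_L2 M (Domain L\<^sub>0)"
    and "symmetric_operator M L\<^sub>0"
    and "upper_bounded M L\<^sub>0"
    and "Range L\<^sub>0 \<subseteq> L1_space M"
    and "\<And>b. 0 < b \<Longrightarrow>
      dense_subset_L1 (restrict_space lborel {0..b} \<Otimes>\<^sub>M M) (fun_span (parabolic_range b L\<^sub>0))"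
  shows "(\<forall>L\<in>M_sym_Markov M L\<^sub>0. \<forall>L'\<in>M_sym_Markov M L\<^sub>0. L = L') \<and>
    (sub_Markovian M (semigroup_of M (Friedrichs_extension M L\<^sub>0)) \<longrightarrow>
       M_sym_Markov M L\<^sub>0 = {Friedrichs_extension M L\<^sub>0})"
proof (intro conjI ballI impI)
  show unique: "L = L'" if "L \<in> M_sym_Markov M L\<^sub>0" "L' \<in> M_sym_Markov M L\<^sub>0" for L L'
    by (rule M_sym_Markov_unique[OF assms(1-3,6,7) that])
  assume "sub_Markovian M (semigroup_of M (Friedrichs_extension M L\<^sub>0))"
  then have "Friedrichs_extension M L\<^sub>0 \<in> M_sym_Markov M L\<^sub>0"
    using friedrichs_extension[OF assms(2-5)] by (simp add: M_sym_Markov_def)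
  then show "M_sym_Markov M L\<^sub>0 = {Friedrichs_extension M L\<^sub>0}" using unique by blast
qed

end
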